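(* There exist a formal power series $\mathfrak{z}^{+}(z)$ in $z^{-1}$ and a formal power series $\mathfrak{z}^{-}(z)$ in $z$, with coefficients in the quantum affine superalgebra $\mathrm{U}_q(\widehat{\mathfrak{gl}}_{M|N})$, such that $$L^{\pm}(zq^{2N-2M})^{st}\,D\,\bigl(L^{\pm}(z)^{-1}\bigr)^{st}=\mathfrak{z}^{\pm}(z)\,D$$ and $$\bigl(L^{\pm}(z)^{-1}\bigr)^{st}\,D^{-1}\,L^{\pm}(zq^{2N-2M})^{st}=\mathfrak{z}^{\pm}(z)\,D^{-1}.$$ Moreover, all coefficients of the series $\mathfrak{z}^{\pm}(z)$ belong to the center of $\mathrm{U}_q(\widehat{\mathfrak{gl}}_{M|N})$.
   Context: Let $M,N\ge 0$ be integers with $M\ne N$. The base field is $\mathbb{C}(q)$ ($q$ is not a root of unity). For $1\le i\le M+N$ put $\bar i=0$ if $i\le M$ and $\bar i=1$ if $i>M$, and $q_i=q^{1-2\bar i}$. $\mathbb{C}^{M|N}$ is the superspace with basis $e_i$ of parity $\bar i$, and $E_{ij}\in\mathrm{End}\,\mathbb{C}^{M|N}$ are the matrix units (of parity $\bar i+\bar j$). Tensor products of superalgebras are graded: $(a\otimes b)(a'\otimes b')=(-1)^{|b||a'|}aa'\otimes bb'$. Put $R(z,w)=\sum_i (zq_i-wq_i^{-1})E_{ii}\otimes E_{ii}+(z-w)\sum_{i\ne j}E_{ii}\otimes E_{jj}+z\sum_{i<j}(q_j-q_j^{-1})E_{ij}\otimes E_{ji}+w\sum_{i>j}(q_j-q_j^{-1})E_{ij}\otimes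 E_{ji}$, $\overline R(x)=R(x,1)/(xq-q^{-1})$ and $R(x)=f(x)\overline R(x)$, where $f(x)=1+\sum_{k\ge1}f_kx^{-k}$ is the formal series uniquely determined by $f(xq^{2N-2M})=f(x)\frac{(1-xq^{-2})(1-xq^{2N-2M+2})}{(1-x)(1-xq^{2N-2M})}$; $R(x)$ is expanded in powers of $x^{-1}$. $\mathrm{U}_q(\widehat{\mathfrak{gl}}_{M|N})$ is the superalgebra over $\mathbb{C}(q)$ generated by $l_{ij}^{\pm(r)}$ ($1\le i,j\le M+N$, $r\ge 0$, parity $\bar i+\bar j$) and an invertible central even element $q^c$. Put $l_{ij}^{\pm}(z)=\sum_{r\ge0}l_{ij}^{\pm(r)}z^{\mp r}$, $L^{\pm}(z)=\sum_{i,j}l^{\pm}_{ij}(z)\otimes E_{ij}$, and let $L_a^\pm(z)$ denote $L^\pm(z)$ acting in the $a$-th copy of $\mathrm{End}\,\mathbb{C}^{M|N}$. The defining relations are: $l_{ji}^{+(0)}=l_{ij}^{-(0)}=0$ for $i<j$; $l_{ii}^{-(0)}l_{ii}^{+(0)}=l_{ii}^{+(0)}l_{ii}^{-(0)}=1$; $R(z/w)L_1^{\pm}(z)L_2^{\pm}(w)=L_2^{\pm}(w)L_1^{\pm}(z)R(z/w)$; $R(zq^{c}/w)L_1^{+}(z)L_2^{-}(w)=L_2^{-}(w)L_1^{+}(z)R(zq^{-c}/w)$. Products and inverses of matrices such as $L^\pm(z)$ are taken in $\mathrm{U}_q(\widehat{\mathfrak{gl}}_{M|N})\otimes\mathrm{End}\,\mathbb{C}^{M|N}$.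 The supertranspose of $A=\sum a_{ij}E_{ij}$ is $A^{st}=\sum_{i,j}(-1)^{\bar i(\bar i+\bar j)}a_{ji}E_{ij}$. $D=\mathrm{diag}[q^{2},q^{4},\ldots,q^{2M},q^{2M},q^{2M-2},\ldots,q^{2M-2N+2}]$.
   Formalization: The matrix D is replaced by its inverse, D = diag[q^{-2}, ..., q^{-2M}, q^{-2M}, ..., q^{-2M+2N-2}] (so D and D^{-1} are interchanged), since with D as printed the identities fail, for example for M=2, N=0. *)

theory Defs
  imports
    "HOL-Library.Poly_Mapping"
    "HOL-Library.Type_Length"
    "HOL-Computational_Algebra.Computational_Algebra"
begin

type_synonym ratfun = "complex poly fract"

definition qvar :: ratfun where
  "qvar = Fract [:0, 1:] 1"

abbreviation idx :: "nat \<Rightarrow> nat \<Rightarrow> nat set" where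
  "idx M N \<equiv> {1..M + N}"

definition bar :: "nat \<Rightarrow> nat \<Rightarrow> nat" where
  "bar M i = (if i \<le> M then 0 else 1)"

definition qi :: "nat \<Rightarrow> nat \<Rightarrow> ratfun" where
  "qi M i = qvar powi (1 - 2 * int (bar M i))"

definition shift_exp :: "nat \<Rightarrow> nat \<Rightarrow> int" where
  "shift_exp M N = 2 * int N - 2 * int M"

text \<open>
  Coefficient of \<open>E\<^sub>i\<^sub>j \<otimes> E\<^sub>k\<^sub>l\<close> in \<open>R(z,w)\<close>, where \<open>z\<close> and \<open>w\<close> are taken in a power series
  ring over the base field.
\<close>
definition R_poly ::
  "nat \<Rightarrow> nat \<Rightarrow> ratfun fps \<Rightarrow> ratfun fps \<Rightarrow> nat \<Rightarrow> nat \<Rightarrow> nat \<Rightarrow> nat \<Rightarrow> ratfun fps" where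
  "R_poly M N z w i j k l =
    (if {i, j, k, l} \<subseteq> idx M N then
       if i = j \<and> k = l then
         (if i = k then z * fps_const (qi M i) - w * fps_const (inverse (qi M i)) else z - w)
       else if i = l \<and> k = j then
         (if i < j then z else w) * fps_const (qi M j - inverse (qi M j))
       else 0
     else 0)"

text \<open>
  Expansions in powers of \<open>x\<^sup>-\<^sup>1\<close> are formal power series in \<open>u = x\<^sup>-\<^sup>1\<close>.  The substitution
  \<open>x \<mapsto> x q\<^sup>s\<close> becomes \<open>u \<mapsto> u q\<^sup>-\<^sup>s\<close>, and numerators and denominators of rational functions
  in \<open>x\<close> are rewritten in \<open>u\<close> by multiplying both with the same power of \<open>u\<close>.
\<close>
definition f_series :: "nat \<Rightarrow> nat \<Rightarrow> ratfun fps" where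
  "f_series M N = (THE f. fps_nth f 0 = 1 \<and>
     f oo (fps_const (qvar powi (- shift_exp M N)) * fps_X) =
     f * (((fps_X - fps_const (qvar powi -2)) * (fps_X - fps_const (qvar powi (shift_exp M N + 2)))) /
          ((fps_X - 1) * (fps_X - fps_const (qvar powi shift_exp M N)))))"

definition R_bar :: "nat \<Rightarrow> nat \<Rightarrow> nat \<Rightarrow> nat \<Rightarrow> nat \<Rightarrow> nat \<Rightarrow> ratfun fps" where
  "R_bar M N i j k l =
     R_poly M N 1 fps_X i j k l / (fps_const qvar - fps_const (inverse qvar) * fps_X)"

definition R_series :: "nat \<Rightarrow> nat \<Rightarrow> nat \<Rightarrow> nat \<Rightarrow> nat \<Rightarrow> nat \<Rightarrow> ratfun fps" where
  "R_series M N i j k l = f_series M N * R_bar M N i j k l"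

text \<open>
  A superalgebra is a ring with its parity automorphism \<open>\<sigma>\<close>, which is \<open>(-1)\<^sup>p\<close> on the part of
  parity \<open>p\<close>.  A function \<open>A\<close> stands for \<open>\<Sum> A\<^sub>i\<^sub>j \<otimes> E\<^sub>i\<^sub>j\<close>; since
  \<open>(a \<otimes> E\<^sub>i\<^sub>j) (b \<otimes> E\<^sub>j\<^sub>k) = (-1)\<^bsup>(i+j)|b|\<^esup> ab \<otimes> E\<^sub>i\<^sub>k\<close>, the automorphism yields the sign.
\<close>
type_synonym 'a smat = "nat \<Rightarrow> nat \<Rightarrow> 'a"

definition smat_mult ::
  "nat \<Rightarrow> nat \<Rightarrow> ('a \<Rightarrow> 'a) \<Rightarrow> 'a::ring_1 smat \<Rightarrow> 'a smat \<Rightarrow> 'a smat" where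
  "smat_mult M N \<sigma> A B = (\<lambda>i k.
     if i \<in> idx M N \<and> k \<in> idx M N
     then \<Sum>j\<in>idx M N. A i j * (\<sigma> ^^ (bar M i + bar M j)) (B j k) else 0)"

definition smat_diag :: "nat \<Rightarrow> nat \<Rightarrow> (nat \<Rightarrow> 'a) \<Rightarrow> 'a::ring_1 smat" where
  "smat_diag M N d = (\<lambda>i j. if i \<in> idx M N \<and> i = j then d i else 0)"

definition smat_inverse ::
  "nat \<Rightarrow> nat \<Rightarrow> ('a \<Rightarrow> 'a) \<Rightarrow> 'a::ring_1 smat \<Rightarrow> 'a smat" where
  "smat_inverse M N \<sigma> A = (THE B.
     (\<forall>i j. \<not> (i \<in> idx M N \<and> j \<in> idx M N) \<longrightarrow> B i j = 0) \<and>
     smat_mult M N \<sigma> A B = smat_diag M N (\<lambda>_. 1) \<and>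
     smat_mult M N \<sigma> B A = smat_diag M N (\<lambda>_. 1))"

definition supertranspose :: "nat \<Rightarrow> nat \<Rightarrow> 'a::ring_1 smat \<Rightarrow> 'a smat" where
  "supertranspose M N A = (\<lambda>i j.
     if i \<in> idx M N \<and> j \<in> idx M N
     then (-1) ^ (bar M i * (bar M i + bar M j)) * A j i else 0)"

text \<open>
  \<open>T\<close> stands for \<open>\<Sum> T\<^sub>i\<^sub>j\<^sub>k\<^sub>l \<otimes> E\<^sub>i\<^sub>j \<otimes> E\<^sub>k\<^sub>l\<close>.  The further sign comes from
  \<open>(E\<^sub>i\<^sub>j \<otimes> E\<^sub>k\<^sub>l) (E\<^sub>j\<^sub>m \<otimes> E\<^sub>l\<^sub>n) = (-1)\<^bsup>(k+l)(j+m)\<^esup> E\<^sub>i\<^sub>m \<otimes> E\<^sub>k\<^sub>n\<close>.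
\<close>
type_synonym 'a stens = "nat \<Rightarrow> nat \<Rightarrow> nat \<Rightarrow> nat \<Rightarrow> 'a"

definition stens_mult ::
  "nat \<Rightarrow> nat \<Rightarrow> ('a \<Rightarrow> 'a) \<Rightarrow> 'a::ring_1 stens \<Rightarrow> 'a stens \<Rightarrow> 'a stens" where
  "stens_mult M N \<sigma> S T = (\<lambda>i m k n.
     \<Sum>j\<in>idx M N. \<Sum>l\<in>idx M N. (-1) ^ ((bar M k + bar M l) * (bar M j + bar M m)) *
       (S i j k l * (\<sigma> ^^ (bar M i + bar M j + bar M k + bar M l)) (T j m l n)))"

definition copy1 :: "'a::zero smat \<Rightarrow> 'a stens" where
  "copy1 A = (\<lambda>i j k l. if k = l then A i j else 0)"

definition copy2 :: "'a::zero smat \<Rightarrow> 'a stens" where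
  "copy2 A = (\<lambda>i j k l. if i = j then A k l else 0)"

datatype 'a free_word = FWord (letters: "'a list")

instantiation free_word :: (type) monoid_add
begin

definition zero_free_word :: "'a free_word" where
  "zero_free_word = FWord []"

definition plus_free_word :: "'a free_word \<Rightarrow> 'a free_word \<Rightarrow> 'a free_word" where
  "plus_free_word v w = FWord (letters v @ letters w)"

instance
  by standard (simp_all add: zero_free_word_def plus_free_word_def)

end

datatype pm = Plus | Minus

fun pm_sgn :: "pm \<Rightarrow> int" where
  "pm_sgn Plus = 1"
| "pm_sgn Minus = -1"

text \<open>
  \<open>GenL s i j r\<close> is \<open>l\<^sub>i\<^sub>j\<close> with superscript \<open>s(r)\<close>; \<open>GenQc\<close> and \<open>GenQcInv\<close> are the central
  generator and its inverse.
\<close>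
datatype gen = GenL pm nat nat nat | GenQc | GenQcInv

type_synonym free_alg = "gen free_word \<Rightarrow>\<^sub>0 ratfun"

definition free_gen :: "gen \<Rightarrow> free_alg" where
  "free_gen g = Poly_Mapping.single (FWord [g]) 1"

definition free_scalar :: "ratfun \<Rightarrow> free_alg" where
  "free_scalar c = Poly_Mapping.single 0 c"

fun gen_parity :: "nat \<Rightarrow> gen \<Rightarrow> nat" where
  "gen_parity M (GenL s i j r) = bar M i + bar M j"
| "gen_parity M GenQc = 0"
| "gen_parity M GenQcInv = 0"

definition word_sign :: "nat \<Rightarrow> gen free_word \<Rightarrow> ratfun" where
  "word_sign M w = (-1) ^ sum_list (map (gen_parity M) (letters w))"

definition free_parity :: "nat \<Rightarrow> free_alg \<Rightarrow> free_alg" where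
  "free_parity M x = Poly_Mapping.mapp (\<lambda>w c. word_sign M w * c) x"

definition free_L :: "nat \<Rightarrow> nat \<Rightarrow> pm \<Rightarrow> nat \<Rightarrow> free_alg smat" where
  "free_L M N s r = (\<lambda>i j.
     if i \<in> idx M N \<and> j \<in> idx M N then free_gen (GenL s i j r) else 0)"

text \<open>
  The coefficient of \<open>x\<^sup>-\<^sup>n\<close> in \<open>R(x)\<close>, times \<open>g\<^sup>n\<close>; that is, the coefficient of \<open>(w/z)\<^sup>n\<close>
  in \<open>R(z g\<^sup>-\<^sup>1 / w)\<close> for an invertible central even \<open>g\<close>.
\<close>
definition free_R :: "nat \<Rightarrow> nat \<Rightarrow> free_alg \<Rightarrow> nat \<Rightarrow> free_alg stens" where
  "free_R M N g n = (\<lambda>i j k l. free_scalar (fps_nth (R_series M N i j k l) n) * g ^ n)"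

text \<open>
  With \<open>L\<^sup>s(z) = \<Sum>\<^sub>r L\<^sup>s\<^sup>(\<^sup>r\<^sup>) z\<^bsup>- pm_sgn s * r\<^esup>\<close>, the set of all \<open>(n, r, t)\<close> such that the term
  \<open>(w/z)\<^sup>n\<close> of the R-matrix, the \<open>r\<close>-th term of \<open>L\<^sup>s(z)\<close> and the \<open>t\<close>-th term of
  \<open>L\<^bsup>s'\<^esup>(w)\<close> contribute to \<open>z\<^sup>a w\<^sup>b\<close>.  It is finite in the three cases
  \<open>(s, s') = (Plus, Plus), (Minus, Minus), (Plus, Minus)\<close> that occur.
\<close>
definition rll_terms :: "pm \<Rightarrow> pm \<Rightarrow> int \<Rightarrow> int \<Rightarrow> (nat \<times> nat \<times> nat) set" where
  "rll_terms s s' a b =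
     {(n, r, t). a = - int n - pm_sgn s * int r \<and> b = int n - pm_sgn s' * int t}"

lemma finite_rll_terms:
  assumes "(s, s') \<noteq> (Minus, Plus)"
  shows "finite (rll_terms s s' a b)"
proof -
  have "rll_terms s s' a b \<subseteq>
      {..nat (\<bar>a\<bar> + \<bar>b\<bar>)} \<times> {..2 * nat (\<bar>a\<bar> + \<bar>b\<bar>)} \<times> {..2 * nat (\<bar>a\<bar> + \<bar>b\<bar>)}"
    using assms by (cases s; cases s') (auto simp: rll_terms_def)
  then show ?thesis
    by (rule finite_subset) simp
qed

text \<open>
  The coefficients of \<open>z\<^sup>a w\<^sup>b\<close> in \<open>R(z g\<^sup>-\<^sup>1/w) L\<^sub>1\<^sup>s(z) L\<^sub>2\<^bsup>s'\<^esup>(w)\<close> and in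
  \<open>L\<^sub>2\<^bsup>s'\<^esup>(w) L\<^sub>1\<^sup>s(z) R(z g\<^sup>-\<^sup>1/w)\<close>.
\<close>
definition rll_left ::
  "nat \<Rightarrow> nat \<Rightarrow> free_alg \<Rightarrow> pm \<Rightarrow> pm \<Rightarrow> int \<Rightarrow> int \<Rightarrow> free_alg stens" where
  "rll_left M N g s s' a b = (\<lambda>i j k l. \<Sum>(n, r, t)\<in>rll_terms s s' a b.
     stens_mult M N (free_parity M)
       (stens_mult M N (free_parity M) (free_R M N g n) (copy1 (free_L M N s r)))
       (copy2 (free_L M N s' t)) i j k l)"

definition rll_right ::
  "nat \<Rightarrow> nat \<Rightarrow> free_alg \<Rightarrow> pm \<Rightarrow> pm \<Rightarrow> int \<Rightarrow> int \<Rightarrow> free_alg stens" where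
  "rll_right M N g s s' a b = (\<lambda>i j k l. \<Sum>(n, r, t)\<in>rll_terms s s' a b.
     stens_mult M N (free_parity M)
       (stens_mult M N (free_parity M) (copy2 (free_L M N s' t)) (copy1 (free_L M N s r)))
       (free_R M N g n) i j k l)"

text \<open>
  An element \<open>x\<close> of this set is the relation \<open>x = 0\<close>.  The type of generators admits arbitrary
  index pairs; rule \<open>outside\<close> removes those that are not in \<open>{1..M+N}\<close>.
\<close>
inductive_set uq_relations :: "nat \<Rightarrow> nat \<Rightarrow> free_alg set" for M N :: nat where
  outside: "\<not> (i \<in> idx M N \<and> j \<in> idx M N) \<Longrightarrow> free_gen (GenL s i j r) \<in> uq_relations M N"
| plus_zero: "\<lbrakk>i \<in> idx M N; j \<in> idx M N; i < j\<rbrakk> \<Longrightarrow>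
    free_gen (GenL Plus j i 0) \<in> uq_relations M N"
| minus_zero: "\<lbrakk>i \<in> idx M N; j \<in> idx M N; i < j\<rbrakk> \<Longrightarrow>
    free_gen (GenL Minus i j 0) \<in> uq_relations M N"
| minus_plus_diag: "i \<in> idx M N \<Longrightarrow>
    free_gen (GenL Minus i i 0) * free_gen (GenL Plus i i 0) - 1 \<in> uq_relations M N"
| plus_minus_diag: "i \<in> idx M N \<Longrightarrow>
    free_gen (GenL Plus i i 0) * free_gen (GenL Minus i i 0) - 1 \<in> uq_relations M N"
| qc_inverse_right: "free_gen GenQc * free_gen GenQcInv - 1 \<in> uq_relations M N"
| qc_inverse_left: "free_gen GenQcInv * free_gen GenQc - 1 \<in> uq_relations M N"
| qc_central: "free_gen GenQc * free_gen g - free_gen g * free_gen GenQc \<in> uq_relations M N"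
| rll_same: "\<lbrakk>i \<in> idx M N; j \<in> idx M N; k \<in> idx M N; l \<in> idx M N\<rbrakk> \<Longrightarrow>
    rll_left M N 1 s s a b i j k l - rll_right M N 1 s s a b i j k l \<in> uq_relations M N"
| rll_mixed: "\<lbrakk>i \<in> idx M N; j \<in> idx M N; k \<in> idx M N; l \<in> idx M N\<rbrakk> \<Longrightarrow>
    rll_left M N (free_gen GenQcInv) Plus Minus a b i j k l -
    rll_right M N (free_gen GenQc) Plus Minus a b i j k l \<in> uq_relations M N"

inductive_set two_sided_ideal :: "'a::ring_1 set \<Rightarrow> 'a set" for S :: "'a set" where
  zero: "0 \<in> two_sided_ideal S"
| gen: "s \<in> S \<Longrightarrow> a * s * b \<in> two_sided_ideal S"
| add: "\<lbrakk>x \<in> two_sided_ideal S; y \<in> two_sided_ideal S\<rbrakk> \<Longrightarrow> x + y \<in> two_sided_ideal S"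

lemma two_sided_ideal_mult_left:
  "x \<in> two_sided_ideal S \<Longrightarrow> c * x \<in> two_sided_ideal S"
proof (induction rule: two_sided_ideal.induct)
  case (gen s a b)
  then show ?case
    using two_sided_ideal.gen[of s S "c * a" b] by (simp add: mult.assoc)
qed (auto simp: distrib_left intro: two_sided_ideal.intros)

lemma two_sided_ideal_mult_right:
  "x \<in> two_sided_ideal S \<Longrightarrow> x * c \<in> two_sided_ideal S"
proof (induction rule: two_sided_ideal.induct)
  case (gen s a b)
  then show ?case
    using two_sided_ideal.gen[of s S a "b * c"] by (simp add: mult.assoc)
qed (auto simp: distrib_right intro: two_sided_ideal.intros)

lemma two_sided_ideal_uminus:
  "x \<in> two_sided_ideal S \<Longrightarrow> - x \<in> two_sided_ideal S"
  using two_sided_ideal_mult_left[of x S "-1"] by simp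

lemma two_sided_ideal_diff:
  "x \<in> two_sided_ideal S \<Longrightarrow> y \<in> two_sided_ideal S \<Longrightarrow> x - y \<in> two_sided_ideal S"
  using two_sided_ideal.add[OF _ two_sided_ideal_uminus, of x S y] by simp

lemma word_sign_0 [simp]: "word_sign M 0 = 1"
  by (simp add: word_sign_def zero_free_word_def)

lemma word_sign_plus: "word_sign M (v + w) = word_sign M v * word_sign M w"
  by (simp add: word_sign_def plus_free_word_def power_add)

lemma lookup_free_parity:
  "Poly_Mapping.lookup (free_parity M x) w = word_sign M w * Poly_Mapping.lookup x w"
  by (simp add: free_parity_def mapp.rep_eq when_def in_keys_iff)

lemma free_parity_add: "free_parity M (x + y) = free_parity M x + free_parity M y"
  by (rule poly_mapping_eqI) (simp add: lookup_free_parity lookup_add algebra_simps)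

lemma free_parity_diff: "free_parity M (x - y) = free_parity M x - free_parity M y"
  by (rule poly_mapping_eqI) (simp add: lookup_free_parity lookup_minus algebra_simps)

lemma free_parity_0 [simp]: "free_parity M 0 = 0"
  by (rule poly_mapping_eqI) (simp add: lookup_free_parity)

lemma free_parity_uminus: "free_parity M (- x) = - free_parity M x"
  using free_parity_diff[of M 0 x] by simp

lemma free_parity_single:
  "free_parity M (Poly_Mapping.single w c) = Poly_Mapping.single w (word_sign M w * c)"
  by (rule poly_mapping_eqI) (simp add: lookup_free_parity lookup_single when_def)

lemma free_parity_scalar [simp]: "free_parity M (free_scalar c) = free_scalar c"
  by (simp add: free_scalar_def free_parity_single)

lemma free_parity_1 [simp]: "free_parity M 1 = 1"
  unfolding single_one[symmetric] free_parity_single by simp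

lemma free_parity_sum: "free_parity M (sum h A) = (\<Sum>a\<in>A. free_parity M (h a))"
  by (induction A rule: infinite_finite_induct) (simp_all add: free_parity_add)

lemma free_alg_induct [case_names zero add]:
  fixes x :: free_alg
  assumes "P 0" and "\<And>w c x. P x \<Longrightarrow> P (Poly_Mapping.single w c + x)"
  shows "P x"
proof (induction x rule: update_induct)
  case const
  show ?case by (rule assms(1))
next
  case (update x w c)
  have "Poly_Mapping.update w c x = Poly_Mapping.single w c + x"
    using update.hyps(1)
    by (intro poly_mapping_eqI) (auto simp: lookup_update lookup_add lookup_single when_def in_keys_iff)
  then show ?case using assms(2)[OF update.IH, of w c] by simp
qed

lemma free_parity_mult: "free_parity M (x * y) = free_parity M x * free_parity M y"
proof (induction x rule: free_alg_induct)
  case (add v c x)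
  have "free_parity M (Poly_Mapping.single v c * y) =
        free_parity M (Poly_Mapping.single v c) * free_parity M y"
    by (induction y rule: free_alg_induct)
      (simp_all add: distrib_left free_parity_add free_parity_single mult_single word_sign_plus
        mult.commute mult.left_commute)
  with add show ?case
    by (simp add: distrib_right free_parity_add)
qed simp

lemma free_parity_gen: "free_parity M (free_gen g) = (-1) ^ gen_parity M g * free_gen g"
proof -
  have "free_parity M (free_gen g) = Poly_Mapping.single (FWord [g]) ((-1) ^ gen_parity M g)"
    by (simp add: free_gen_def free_parity_single word_sign_def)
  also have "\<dots> = (-1) ^ gen_parity M g * free_gen g"
    by (cases "even (gen_parity M g)") (simp_all add: free_gen_def single_uminus)
  finally show ?thesis .
qed

text \<open>
  The elements of \<open>A \<otimes> End \<otimes> End\<close> that are even.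
\<close>
definition even_stens :: "nat \<Rightarrow> nat \<Rightarrow> free_alg stens \<Rightarrow> bool" where
  "even_stens M N T \<longleftrightarrow> (\<forall>i j k l. {i, j, k, l} \<subseteq> idx M N \<longrightarrow>
     free_parity M (T i j k l) = (-1) ^ (bar M i + bar M j + bar M k + bar M l) * T i j k l)"

lemma free_parity_sign: "free_parity M ((-1) ^ p * x) = (-1) ^ p * free_parity M x"
  by (cases "even p") (simp_all add: free_parity_uminus)

lemma free_parity_sign_1 [simp]: "free_parity M ((-1) ^ p) = (-1) ^ p"
  using free_parity_sign[of M p 1] by simp

lemma free_parity_funpow_sign:
  assumes "free_parity M x = (-1) ^ p * x"
  shows "(free_parity M ^^ m) x = (-1) ^ (m * p) * x"
proof (induction m)
  case (Suc m)
  then show ?case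
    by (simp add: free_parity_sign assms power_add mult.assoc) (simp flip: mult.assoc power_add add: add.commute)
qed simp

lemma even_stens_mult:
  assumes "even_stens M N S" "even_stens M N T"
  shows "even_stens M N (stens_mult M N (free_parity M) S T)"
  unfolding even_stens_def
proof (intro allI impI)
  fix i m k n
  assume idx: "{i, m, k, n} \<subseteq> idx M N"
  have "free_parity M ((-1) ^ p * (S i j k l * (free_parity M ^^ p') (T j m l n))) =
        (-1) ^ (bar M i + bar M m + bar M k + bar M n) *
        ((-1) ^ p * (S i j k l * (free_parity M ^^ p') (T j m l n)))"
    if "j \<in> idx M N" "l \<in> idx M N" for j l p p'
  proof -
    have S: "free_parity M (S i j k l) =
        (-1) ^ (bar M i + bar M j + bar M k + bar M l) * S i j k l"
      using assms(1) idx that by (simp add: even_stens_def)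
    have T: "free_parity M (T j m l n) =
        (-1) ^ (bar M j + bar M m + bar M l + bar M n) * T j m l n"
      using assms(2) idx that by (simp add: even_stens_def)
    show ?thesis
      unfolding free_parity_sign free_parity_mult free_parity_funpow_sign[OF T] S T
      by (simp add: bar_def)
  qed
  then show "free_parity M (stens_mult M N (free_parity M) S T i m k n) =
      (-1) ^ (bar M i + bar M m + bar M k + bar M n) * stens_mult M N (free_parity M) S T i m k n"
    unfolding stens_mult_def free_parity_sum sum_distrib_left
    by (intro sum.cong refl) auto
qed

lemma even_stens_L:
  "even_stens M N (copy1 (free_L M N s r))" "even_stens M N (copy2 (free_L M N s r))"
  by (auto simp: even_stens_def copy1_def copy2_def free_L_def free_parity_gen bar_def)

lemma free_parity_power:
  "free_parity M g = g \<Longrightarrow> free_parity M (g ^ n) = g ^ n"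
  by (induction n) (simp_all add: free_parity_mult)

lemma even_stens_R:
  assumes "free_parity M g = g"
  shows "even_stens M N (free_R M N g n)"
proof -
  have zero: "free_R M N g n i j k l = 0"
    if "odd (bar M i + bar M j + bar M k + bar M l)" for i j k l
  proof -
    have "\<not> (i = j \<and> k = l)" "\<not> (i = l \<and> k = j)"
      using that by auto
    then have "R_poly M N 1 fps_X i j k l = 0"
      unfolding R_poly_def by presburger
    then show ?thesis
      by (simp add: free_R_def R_series_def R_bar_def free_scalar_def)
  qed
  have "free_parity M (free_R M N g n i j k l) = free_R M N g n i j k l" for i j k l
    by (simp add: free_R_def free_parity_mult free_parity_power[OF assms])
  then have "free_parity M (free_R M N g n i j k l) =
      (-1) ^ (bar M i + bar M j + bar M k + bar M l) * free_R M N g n i j k l" for i j k l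
    using zero[of i j k l] by (cases "even (bar M i + bar M j + bar M k + bar M l)") simp_all
  then show ?thesis
    unfolding even_stens_def by blast
qed

lemma free_parity_rll:
  assumes "{i, j, k, l} \<subseteq> idx M N" "free_parity M g = g"
  shows "free_parity M (rll_left M N g s s' a b i j k l) =
           (-1) ^ (bar M i + bar M j + bar M k + bar M l) * rll_left M N g s s' a b i j k l"
    and "free_parity M (rll_right M N g s s' a b i j k l) =
           (-1) ^ (bar M i + bar M j + bar M k + bar M l) * rll_right M N g s s' a b i j k l"
proof -
  have "even_stens M N (stens_mult M N (free_parity M)
         (stens_mult M N (free_parity M) (free_R M N g n) (copy1 (free_L M N s r)))
         (copy2 (free_L M N s' t)))" for n r t
    by (intro even_stens_mult even_stens_L even_stens_R assms)
  moreover have "even_stens M N (stens_mult M N (free_parity M)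
         (stens_mult M N (free_parity M) (copy2 (free_L M N s' t)) (copy1 (free_L M N s r)))
         (free_R M N g n))" for n r t
    by (intro even_stens_mult even_stens_L even_stens_R assms)
  ultimately show "free_parity M (rll_left M N g s s' a b i j k l) =
           (-1) ^ (bar M i + bar M j + bar M k + bar M l) * rll_left M N g s s' a b i j k l"
    and "free_parity M (rll_right M N g s s' a b i j k l) =
           (-1) ^ (bar M i + bar M j + bar M k + bar M l) * rll_right M N g s s' a b i j k l"
    using assms(1) unfolding rll_left_def rll_right_def even_stens_def
    by (auto simp: free_parity_sum sum_distrib_left intro!: sum.cong)
qed

lemma free_parity_relations:
  assumes "x \<in> uq_relations M N"
  shows "\<exists>p. free_parity M x = (-1) ^ p * x"
  using assms
proof cases
  case (rll_same i j k l s a b)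
  then show ?thesis
    using free_parity_rll[of i j k l M N 1 s s a b]
    by (intro exI[of _ "bar M i + bar M j + bar M k + bar M l"])
      (simp add: free_parity_diff right_diff_distrib)
next
  case (rll_mixed i j k l a b)
  then show ?thesis
    using free_parity_rll[of i j k l M N "free_gen GenQc" Plus Minus a b]
      free_parity_rll[of i j k l M N "free_gen GenQcInv" Plus Minus a b]
    by (intro exI[of _ "bar M i + bar M j + bar M k + bar M l"])
      (simp add: free_parity_diff free_parity_gen right_diff_distrib)
next
  case (qc_central g)
  then have "free_parity M x = (-1) ^ gen_parity M g * x"
    by (cases "even (gen_parity M g)") (simp_all add: free_parity_diff free_parity_mult free_parity_gen)
  then show ?thesis ..
next
  case (outside i j s r)
  then show ?thesis by (auto simp: free_parity_gen intro!: exI[of _ "bar M i + bar M j"])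
next
  case (plus_zero i j)
  then show ?thesis by (auto simp: free_parity_gen intro!: exI[of _ "bar M j + bar M i"])
next
  case (minus_zero i j)
  then show ?thesis by (auto simp: free_parity_gen intro!: exI[of _ "bar M i + bar M j"])
qed (auto simp: free_parity_diff free_parity_mult free_parity_gen bar_def intro!: exI[of _ 0])

lemma free_parity_ideal:
  assumes "x \<in> two_sided_ideal (uq_relations M N)"
  shows "free_parity M x \<in> two_sided_ideal (uq_relations M N)"
  using assms
proof induction
  case (gen s a b)
  obtain p where "free_parity M s = (-1) ^ p * s"
    using free_parity_relations[OF gen] by blast
  then have "free_parity M (a * s * b) = (free_parity M a * (-1) ^ p) * s * free_parity M b"
    by (simp add: free_parity_mult mult.assoc)
  also have "\<dots> \<in> two_sided_ideal (uq_relations M N)"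
    by (rule two_sided_ideal.gen[OF gen])
  finally show ?case .
qed (simp_all add: free_parity_add two_sided_ideal.intros)

text \<open>
  The augmentation \<open>L\<^sup>\<plusminus>(z) \<mapsto> 1\<close>, \<open>q\<^sup>c \<mapsto> 1\<close>, which shows that the quotient is not the zero ring.
\<close>
fun aug_gen :: "nat \<Rightarrow> nat \<Rightarrow> gen \<Rightarrow> ratfun" where
  "aug_gen M N (GenL s i j r) = (if i \<in> idx M N \<and> i = j \<and> r = 0 then 1 else 0)"
| "aug_gen M N GenQc = 1"
| "aug_gen M N GenQcInv = 1"

definition aug_word :: "nat \<Rightarrow> nat \<Rightarrow> gen free_word \<Rightarrow> ratfun" where
  "aug_word M N w = prod_list (map (aug_gen M N) (letters w))"

definition aug :: "nat \<Rightarrow> nat \<Rightarrow> free_alg \<Rightarrow> ratfun" where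
  "aug M N x = (\<Sum>w\<in>Poly_Mapping.keys x. Poly_Mapping.lookup x w * aug_word M N w)"

lemma aug_superset:
  assumes "finite W" "Poly_Mapping.keys x \<subseteq> W"
  shows "aug M N x = (\<Sum>w\<in>W. Poly_Mapping.lookup x w * aug_word M N w)"
  unfolding aug_def using assms by (intro sum.mono_neutral_left) (auto simp: in_keys_iff)

lemma aug_add: "aug M N (x + y) = aug M N x + aug M N y"
proof -
  let ?W = "Poly_Mapping.keys x \<union> Poly_Mapping.keys y"
  have "Poly_Mapping.keys (x + y) \<subseteq> ?W"
    by (rule keys_add)
  then show ?thesis
    by (simp add: aug_superset[of ?W] lookup_add distrib_right sum.distrib)
qed

lemma aug_single: "aug M N (Poly_Mapping.single w c) = c * aug_word M N w"
  by (simp add: aug_superset[of "{w}"])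

lemma aug_0 [simp]: "aug M N 0 = 0"
  by (simp add: aug_def)

lemma aug_diff: "aug M N (x - y) = aug M N x - aug M N y"
  using aug_add[of M N "x - y" y] by simp

lemma aug_sum: "aug M N (sum h A) = (\<Sum>a\<in>A. aug M N (h a))"
  by (induction A rule: infinite_finite_induct) (simp_all add: aug_add)

lemma aug_word_plus: "aug_word M N (v + w) = aug_word M N v * aug_word M N w"
  by (simp add: aug_word_def plus_free_word_def)

lemma aug_mult: "aug M N (x * y) = aug M N x * aug M N y"
proof (induction x rule: free_alg_induct)
  case (add v c x)
  have "aug M N (Poly_Mapping.single v c * y) = aug M N (Poly_Mapping.single v c) * aug M N y"
    by (induction y rule: free_alg_induct)
      (simp_all add: distrib_left aug_add aug_single mult_single aug_word_plus
        mult.commute mult.left_commute)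
  with add show ?case
    by (simp add: distrib_right aug_add)
qed simp

lemma aug_gen_free [simp]: "aug M N (free_gen g) = aug_gen M N g"
  by (simp add: free_gen_def aug_single aug_word_def)

lemma aug_1 [simp]: "aug M N 1 = 1"
  unfolding single_one[symmetric] aug_single by (simp add: aug_word_def zero_free_word_def)

lemma aug_power: "aug M N (x ^ n) = aug M N x ^ n"
  by (induction n) (simp_all add: aug_mult)

lemma aug_sign: "aug M N ((-1) ^ p) = (-1) ^ p"
  using aug_diff[of M N 0 1] by (simp add: aug_power)

lemma aug_word_parity: "word_sign M w * aug_word M N w = aug_word M N w"
proof -
  have "(-1) ^ sum_list (map (gen_parity M) ws) * prod_list (map (aug_gen M N) ws) =
        prod_list (map (aug_gen M N) ws)" for ws
  proof (induction ws)
    case (Cons g ws)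
    then show ?case
      by (cases g) (auto simp: power_add bar_def)
  qed simp
  then show ?thesis by (simp add: word_sign_def aug_word_def)
qed

lemma aug_parity: "aug M N (free_parity M x) = aug M N x"
proof (induction x rule: free_alg_induct)
  case (add w c x)
  then show ?case
    using aug_word_parity[of M w N]
    by (simp add: free_parity_add aug_add free_parity_single aug_single mult.commute mult.left_commute)
qed simp

lemma aug_parity_funpow: "aug M N ((free_parity M ^^ p) x) = aug M N x"
  by (induction p) (simp_all add: aug_parity)

lemma aug_stens_mult:
  "aug M N (stens_mult M N (free_parity M) S T i m k n) =
     (\<Sum>j\<in>idx M N. \<Sum>l\<in>idx M N. (-1) ^ ((bar M k + bar M l) * (bar M j + bar M m)) *
        (aug M N (S i j k l) * aug M N (T j m l n)))"
  by (simp add: stens_mult_def aug_sum aug_mult aug_sign aug_parity_funpow)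

definition aug_unit :: "nat \<Rightarrow> nat \<Rightarrow> ratfun \<Rightarrow> free_alg stens \<Rightarrow> bool" where
  "aug_unit M N c T \<longleftrightarrow> (\<forall>i\<in>idx M N. \<forall>j\<in>idx M N. \<forall>k\<in>idx M N. \<forall>l\<in>idx M N.
     aug M N (T i j k l) = (if i = j \<and> k = l then c else 0))"

lemma aug_stens_mult_unit_right:
  assumes "aug_unit M N c T" "m \<in> idx M N" "n \<in> idx M N"
  shows "aug M N (stens_mult M N (free_parity M) S T i m k n) = aug M N (S i m k n) * c"
proof -
  have "aug M N (stens_mult M N (free_parity M) S T i m k n) =
     (\<Sum>j\<in>idx M N. \<Sum>l\<in>idx M N. if j = m \<and> l = n then aug M N (S i m k n) * c else 0)"
    unfolding aug_stens_mult using assms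
    by (intro sum.cong refl) (auto simp: aug_unit_def bar_def)
  also have "\<dots> = (\<Sum>j\<in>idx M N. if j = m then aug M N (S i m k n) * c else 0)"
    using assms by (intro sum.cong refl) (auto simp: sum.delta)
  finally show ?thesis using assms by (simp add: sum.delta)
qed

lemma aug_stens_mult_unit_left:
  assumes "aug_unit M N c S" "i \<in> idx M N" "k \<in> idx M N"
  shows "aug M N (stens_mult M N (free_parity M) S T i m k n) = c * aug M N (T i m k n)"
proof -
  have "aug M N (stens_mult M N (free_parity M) S T i m k n) =
     (\<Sum>j\<in>idx M N. \<Sum>l\<in>idx M N. if j = i \<and> l = k then c * aug M N (T i m k n) else 0)"
    unfolding aug_stens_mult using assms
    by (intro sum.cong refl) (auto simp: aug_unit_def bar_def)
  also have "\<dots> = (\<Sum>j\<in>idx M N. if j = i then c * aug M N (T i m k n) else 0)"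
    using assms by (intro sum.cong refl) (auto simp: sum.delta)
  finally show ?thesis using assms by (simp add: sum.delta)
qed

lemma aug_unit_L:
  "aug_unit M N (if r = 0 then 1 else 0) (copy1 (free_L M N s r))"
  "aug_unit M N (if r = 0 then 1 else 0) (copy2 (free_L M N s r))"
  by (auto simp: aug_unit_def copy1_def copy2_def free_L_def)

lemma aug_rll:
  assumes idx: "i \<in> idx M N" "j \<in> idx M N" "k \<in> idx M N" "l \<in> idx M N"
    and g: "aug M N g = 1" "aug M N g' = 1"
  shows "aug M N (rll_left M N g s s' a b i j k l) = aug M N (rll_right M N g' s s' a b i j k l)"
proof -
  let ?c = "\<lambda>r::nat. if r = 0 then 1 else 0 :: ratfun"
  have R: "aug M N (free_R M N g n i j k l) = aug M N (free_R M N g' n i j k l)" for n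
    using g by (simp add: free_R_def aug_mult aug_power)
  have LL: "aug_unit M N (?c t * ?c r)
      (stens_mult M N (free_parity M) (copy2 (free_L M N s' t)) (copy1 (free_L M N s r)))" for r t
    unfolding aug_unit_def
  proof (intro ballI)
    fix i j k l
    assume *: "i \<in> idx M N" "j \<in> idx M N" "k \<in> idx M N" "l \<in> idx M N"
    show "aug M N (stens_mult M N (free_parity M) (copy2 (free_L M N s' t))
            (copy1 (free_L M N s r)) i j k l) = (if i = j \<and> k = l then ?c t * ?c r else 0)"
      unfolding aug_stens_mult_unit_left[OF aug_unit_L(2) *(1) *(3)]
      using aug_unit_L(1)[of M N r s] * by (auto simp: aug_unit_def)
  qed
  show ?thesis
    unfolding rll_left_def rll_right_def aug_sum case_prod_unfold
      aug_stens_mult_unit_right[OF aug_unit_L(2) idx(2,4)]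
      aug_stens_mult_unit_right[OF aug_unit_L(1) idx(2,4)]
      aug_stens_mult_unit_left[OF LL idx(1,3)] R
    by (simp add: ac_simps)
qed

lemma aug_relations: "x \<in> uq_relations M N \<Longrightarrow> aug M N x = 0"
proof (induction rule: uq_relations.induct)
  case (rll_same i j k l s a b)
  then show ?case by (simp add: aug_diff aug_rll[where g' = 1])
next
  case (rll_mixed i j k l a b)
  then show ?case by (simp add: aug_diff aug_rll[where g' = "free_gen GenQc"])
qed (auto simp: aug_diff aug_mult)

lemma aug_ideal: "x \<in> two_sided_ideal (uq_relations M N) \<Longrightarrow> aug M N x = 0"
  by (induction rule: two_sided_ideal.induct) (simp_all add: aug_add aug_mult aug_relations)

text \<open>
  The parameters \<open>M\<close> and \<open>N\<close> are type-level numbers; class \<open>len0\<close> admits \<open>0\<close>.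
\<close>
quotient_type (overloaded) ('m, 'n) uq = free_alg /
  "\<lambda>x y. x - y \<in> two_sided_ideal (uq_relations LENGTH('m::len0) LENGTH('n::len0))"
proof (intro equivpI reflpI sympI transpI)
  let ?I = "two_sided_ideal (uq_relations LENGTH('m) LENGTH('n))"
  fix x y z :: free_alg
  show "x - x \<in> ?I"
    by (simp add: two_sided_ideal.zero)
  show "y - x \<in> ?I" if "x - y \<in> ?I"
    using two_sided_ideal_uminus[OF that] by simp
  show "x - z \<in> ?I" if "x - y \<in> ?I" "y - z \<in> ?I"
    using two_sided_ideal.add[OF that] by simp
qed

instantiation uq :: (len0, len0) ring_1
begin

lift_definition zero_uq :: "('a, 'b) uq" is 0 .

lift_definition one_uq :: "('a, 'b) uq" is 1 .

lift_definition plus_uq :: "('a, 'b) uq \<Rightarrow> ('a, 'b) uq \<Rightarrow> ('a, 'b) uq" is "(+)"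
  by (simp only: add_diff_add two_sided_ideal.add)

lift_definition minus_uq :: "('a, 'b) uq \<Rightarrow> ('a, 'b) uq \<Rightarrow> ('a, 'b) uq" is "(-)"
proof -
  fix x x' y y' :: free_alg
  let ?I = "two_sided_ideal (uq_relations LENGTH('a) LENGTH('b))"
  assume "x - x' \<in> ?I" "y - y' \<in> ?I"
  then have "(x - x') - (y - y') \<in> ?I"
    by (rule two_sided_ideal_diff)
  then show "x - y - (x' - y') \<in> ?I"
    by (simp add: algebra_simps)
qed

lift_definition uminus_uq :: "('a, 'b) uq \<Rightarrow> ('a, 'b) uq" is uminus
proof -
  fix x x' :: free_alg
  let ?I = "two_sided_ideal (uq_relations LENGTH('a) LENGTH('b))"
  assume "x - x' \<in> ?I"
  then show "- x - - x' \<in> ?I"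
    using two_sided_ideal_uminus[of "x - x'"] by simp
qed

lift_definition times_uq :: "('a, 'b) uq \<Rightarrow> ('a, 'b) uq \<Rightarrow> ('a, 'b) uq" is "(*)"
proof -
  fix x x' y y' :: free_alg
  let ?I = "two_sided_ideal (uq_relations LENGTH('a) LENGTH('b))"
  assume "x - x' \<in> ?I" "y - y' \<in> ?I"
  then have "(x - x') * y + x' * (y - y') \<in> ?I"
    by (intro two_sided_ideal.add two_sided_ideal_mult_left two_sided_ideal_mult_right)
  then show "x * y - x' * y' \<in> ?I"
    by (simp add: algebra_simps)
qed

instance
proof
  fix a b c :: "('a, 'b) uq"
  show "a * b * c = a * (b * c)"
    by transfer (simp add: mult.assoc two_sided_ideal.zero)
  show "a + b + c = a + (b + c)"
    by transfer (simp add: add.assoc two_sided_ideal.zero)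
  show "a + b = b + a"
    by transfer (simp add: add.commute two_sided_ideal.zero)
  show "0 + a = a"
    by transfer (simp add: two_sided_ideal.zero)
  show "- a + a = 0"
    by transfer (simp add: two_sided_ideal.zero)
  show "a - b = a + - b"
    by transfer (simp add: two_sided_ideal.zero)
  show "(a + b) * c = a * c + b * c"
    by transfer (simp add: distrib_right two_sided_ideal.zero)
  show "a * (b + c) = a * b + a * c"
    by transfer (simp add: distrib_left two_sided_ideal.zero)
  show "1 * a = a"
    by transfer (simp add: two_sided_ideal.zero)
  show "a * 1 = a"
    by transfer (simp add: two_sided_ideal.zero)
  have "(1 :: free_alg) \<notin> two_sided_ideal (uq_relations LENGTH('a) LENGTH('b))"
    using aug_ideal[of 1 "LENGTH('a)" "LENGTH('b)"] by auto
  then have "0 - 1 \<notin> two_sided_ideal (uq_relations LENGTH('a) LENGTH('b))"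
    using two_sided_ideal_uminus[of "0 - 1" "uq_relations LENGTH('a) LENGTH('b)"] by auto
  then show "(0 :: ('a, 'b) uq) \<noteq> 1"
    unfolding zero_uq_def one_uq_def uq.abs_eq_iff .
qed

end

lift_definition uq_gen :: "gen \<Rightarrow> ('m::len0, 'n::len0) uq" is free_gen .

lift_definition uq_scalar :: "ratfun \<Rightarrow> ('m::len0, 'n::len0) uq" is free_scalar .

lift_definition uq_parity :: "('m::len0, 'n::len0) uq \<Rightarrow> ('m, 'n) uq"
  is "free_parity LENGTH('m)"
  using free_parity_ideal by (simp flip: free_parity_diff)

definition center :: "'a::ring_1 set" where
  "center = {x. \<forall>y. x * y = y * x}"

text \<open>
  A series in \<open>z\<^sup>-\<^sup>1\<close> (for sign \<open>Plus\<close>) or in \<open>z\<close> (for sign \<open>Minus\<close>) is a formal power series in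
  \<open>z\<^bsup>- pm_sgn s\<^esup>\<close>.  The formal variable is even.
\<close>
definition uq_L :: "pm \<Rightarrow> ('m::len0, 'n::len0) uq fps smat" where
  "uq_L s = (\<lambda>i j. Abs_fps (\<lambda>r. uq_gen (GenL s i j r)))"

definition uq_L_shifted :: "pm \<Rightarrow> int \<Rightarrow> ('m::len0, 'n::len0) uq fps smat" where
  "uq_L_shifted s e = (\<lambda>i j.
     uq_L s i j oo (fps_const (uq_scalar (qvar powi (- pm_sgn s * e))) * fps_X))"

definition fps_parity :: "('m::len0, 'n::len0) uq fps \<Rightarrow> ('m, 'n) uq fps" where
  "fps_parity f = Abs_fps (\<lambda>r. uq_parity (fps_nth f r))"

definition uq_mult ::
  "('m::len0, 'n::len0) uq fps smat \<Rightarrow> ('m, 'n) uq fps smat \<Rightarrow> ('m, 'n) uq fps smat"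
  (infixl "\<odot>" 70) where
  "A \<odot> B = smat_mult LENGTH('m) LENGTH('n) fps_parity A B"

definition uq_inverse :: "('m::len0, 'n::len0) uq fps smat \<Rightarrow> ('m, 'n) uq fps smat" where
  "uq_inverse A = smat_inverse LENGTH('m) LENGTH('n) fps_parity A"

definition uq_st :: "('m::len0, 'n::len0) uq fps smat \<Rightarrow> ('m, 'n) uq fps smat" where
  "uq_st A = supertranspose LENGTH('m) LENGTH('n) A"

definition uq_scale :: "('m::len0, 'n::len0) uq fps \<Rightarrow> ('m, 'n) uq fps smat \<Rightarrow> ('m, 'n) uq fps smat"
  where "uq_scale f A = (\<lambda>i j. f * A i j)"

text \<open>
  The matrix \<open>D = diag[q\<^sup>-\<^sup>2, q\<^sup>-\<^sup>4, \<dots>, q\<^bsup>-2M\<^esup>, q\<^bsup>-2M\<^esup>, q\<^bsup>-2M+2\<^esup>, \<dots>, q\<^bsup>-2M+2N-2\<^esup>]\<close>.  Beware of its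
  direction.  The source displays \<open>D\<close> with the opposite exponents, \<open>diag[q\<^sup>2, q\<^sup>4, \<dots>]\<close>, but then the
  identities \<open>L(zq\<^bsup>2N-2M\<^esup>)\<^sup>s\<^sup>t D (L(z)\<^sup>-\<^sup>1)\<^sup>s\<^sup>t = \<zeta>(z) D\<close> and
  \<open>(L(z)\<^sup>-\<^sup>1)\<^sup>s\<^sup>t D\<^sup>-\<^sup>1 L(zq\<^bsup>2N-2M\<^esup>)\<^sup>s\<^sup>t = \<zeta>(z) D\<^sup>-\<^sup>1\<close> are incompatible with the above relations:
  for \<open>M = 2\<close>, \<open>N = 0\<close> and \<open>D = diag[d\<^sub>1, d\<^sub>2]\<close>, put \<open>a = l\<^sub>1\<^sub>1\<close>, \<open>b = l\<^sub>1\<^sub>2\<close>, \<open>d = l\<^sub>2\<^sub>2\<close> with superscript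
  \<open>+(0)\<close>.  The relations give \<open>ad = da\<close>, \<open>ba = q ab\<close> and \<open>db = q bd\<close>, and the constant term of
  the \<open>(2,1)\<close> entry of the first identity is
  \<open>d\<^sub>1 b a\<^sup>-\<^sup>1 - d\<^sub>2 d a\<^sup>-\<^sup>1 b d\<^sup>-\<^sup>1 = (d\<^sub>1 - q\<^sup>2 d\<^sub>2) b a\<^sup>-\<^sup>1 = 0\<close>, so that \<open>d\<^sub>2 = q\<^sup>-\<^sup>2 d\<^sub>1\<close>.
\<close>
definition D_entry :: "nat \<Rightarrow> nat \<Rightarrow> ratfun" where
  "D_entry M i =
     (if i \<le> M then qvar powi (- (2 * int i))
      else qvar powi (- (2 * int M - 2 * (int i - int M) + 2)))"

definition uq_diag :: "(nat \<Rightarrow> ratfun) \<Rightarrow> ('m::len0, 'n::len0) uq fps smat" where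
  "uq_diag d = smat_diag LENGTH('m) LENGTH('n) (\<lambda>i. fps_const (uq_scalar (d i)))"

definition uq_D :: "('m::len0, 'n::len0) uq fps smat" where
  "uq_D = uq_diag (D_entry LENGTH('m))"

definition uq_D_inv :: "('m::len0, 'n::len0) uq fps smat" where
  "uq_D_inv = uq_diag (\<lambda>i. inverse (D_entry LENGTH('m) i))"

end

theory Submission
  imports Defs
begin

section \<open>Central series of the quantum affine superalgebra\<close>

text \<open>
  Adjoin an involution \<open>\<tau>\<close> that implements the parity automorphism. For \<open>T\<^sub>i\<^sub>j = l\<^sub>i\<^sub>j \<tau>\<^sup>i\<close> the defining relations become
  ungraded RTT relations, with an R-matrix of the shape of the one of \<open>gl\<^sub>n\<close> in which the parameter \<open>q\<close> is replaced by a
  root \<open>\<kappa>\<^sub>i \<in> {q, -q\<^sup>-\<^sup>1}\<close> of \<open>x - x\<^sup>-\<^sup>1 = q - q\<^sup>-\<^sup>1\<close> that depends on the index.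

  Let \<open>Y = T(z)\<^sup>-\<^sup>1\<close> and let \<open>x = q\<^bsup>2N-2M\<^esup>\<close>. The partial transpose of \<open>R(xz, z)\<close> has a kernel that is spanned
  by a single vector \<open>v\<close>, given by the entries of \<open>D\<close>. The RTT relation shows that \<open>T(xz)\<^sup>t Y v\<close> lies in this kernel, which defines
  \<open>\<zeta>\<close> by \<open>T(xz)\<^sup>t Y v = \<zeta> v\<close>. Crossing symmetry says that \<open>R\<^sup>t(xz, w) R(z, w)\<^sup>-\<^sup>1\<close> acts on \<open>v\<close> by a scalar, and so
  \<open>\<zeta>\<close> commutes with every \<open>T\<^sup>\<plusminus>(w)\<close>; for relations that mix the two signs the functional equation of \<open>f\<close> makes the scalars on the two
  sides cancel. Finally the first identity reads \<open>X Z = \<zeta>\<close> for matrices with \<open>X\<close> invertible and \<open>\<zeta>\<close> central, hence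
  \<open>Z X = \<zeta>\<close>, which is the second one.
\<close>

section \<open>Matrices over noncommutative rings\<close>

text \<open>The two spectral parameters are independent, so commutators have to be read off from
  series in two formal variables p and q, with T a series in p and S one in q. For equal signs R
  depends on p/q, which is no power series; the scalar factor is stripped and the relation is
  multiplied by one variable, after which R is linear in p and q. For opposite signs the argument is
  p q times a central power of \<open>q^c\<close>, and the scalar factor stays. To cover these cases
  and the one-variable case p = c q at once, the RTT argument runs over an arbitrary commutative
  ring that acts by central elements. Linear forms such as q - p are not units there, so nothing is
  divided: R is inverted only up to the factor \<Delta>, and scalars are cancelled at the very end
  because multiplication by them is injective. The vector v is annihilated for one ratio of the
  parameters only: the transposed R(z, w) maps it to the vector with all coordinates z - x w, which
  is where the shift x comes from. That the kernel at z = x w is a line uses the invertibility of x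
  - 1, that is M \<noteq> N.\<close>

definition mat_mult :: "nat set \<Rightarrow> (nat \<Rightarrow> nat \<Rightarrow> 'a::ring_1) \<Rightarrow> (nat \<Rightarrow> nat \<Rightarrow> 'a) \<Rightarrow> nat \<Rightarrow> nat \<Rightarrow> 'a" where
  "mat_mult I A B i k = (\<Sum>j\<in>I. A i j * B j k)"

definition mat_unit :: "nat \<Rightarrow> nat \<Rightarrow> 'a::ring_1" where
  "mat_unit i k = (if i = k then 1 else 0)"

definition mat_inverse :: "nat set \<Rightarrow> (nat \<Rightarrow> nat \<Rightarrow> 'a::ring_1) \<Rightarrow> (nat \<Rightarrow> nat \<Rightarrow> 'a) \<Rightarrow> bool" where
  "mat_inverse I A B \<longleftrightarrow> (\<forall>i\<in>I. \<forall>k\<in>I. mat_mult I A B i k = mat_unit i k \<and> mat_mult I B A i k = mat_unit i k)"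

lemma mat_inverse_iff:
  "mat_inverse I A B \<longleftrightarrow> (\<forall>i\<in>I. \<forall>k\<in>I. (\<Sum>j\<in>I. A i j * B j k) = (if i = k then 1 else 0) \<and>
     (\<Sum>j\<in>I. B i j * A j k) = (if i = k then 1 else 0))"
  by (simp add: mat_inverse_def mat_mult_def mat_unit_def)

lemma mat_mult_assoc: "mat_mult I (mat_mult I A B) C i k = mat_mult I A (mat_mult I B C) i k"
  unfolding mat_mult_def sum_distrib_left sum_distrib_right mult.assoc by (rule sum.swap)

lemma mat_mult_cong:
  "(\<And>j. j \<in> I \<Longrightarrow> A i j = A' i j) \<Longrightarrow> (\<And>j. j \<in> I \<Longrightarrow> B j k = B' j k) \<Longrightarrow> mat_mult I A B i k = mat_mult I A' B' i k"
  by (simp add: mat_mult_def cong: sum.cong)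

lemma mat_mult_unit_left: "finite I \<Longrightarrow> i \<in> I \<Longrightarrow> mat_mult I mat_unit A i k = A i k"
  by (simp add: mat_mult_def mat_unit_def if_distrib[of "\<lambda>x. x * _"] cong: if_cong)

lemma mat_mult_unit_right: "finite I \<Longrightarrow> k \<in> I \<Longrightarrow> mat_mult I A mat_unit i k = A i k"
  by (simp add: mat_mult_def mat_unit_def if_distrib[of "\<lambda>x. _ * x"] cong: if_cong)

lemma mat_left_right_inverse:
  assumes fin: "finite I" and "\<And>i k. i \<in> I \<Longrightarrow> k \<in> I \<Longrightarrow> mat_mult I B A i k = mat_unit i k"
    and "\<And>i k. i \<in> I \<Longrightarrow> k \<in> I \<Longrightarrow> mat_mult I A C i k = mat_unit i k" and I: "i \<in> I" "k \<in> I"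
  shows "B i k = C i k"
proof -
  have "B i k = mat_mult I B (mat_mult I A C) i k"
    using assms mat_mult_cong[of I B i B "mat_mult I A C" k mat_unit]
    by (simp add: mat_mult_unit_right)
  also have "\<dots> = mat_mult I (mat_mult I B A) C i k" by (simp add: mat_mult_assoc)
  also have "\<dots> = C i k"
    using assms mat_mult_cong[of I "mat_mult I B A" i mat_unit C k C]
    by (simp add: mat_mult_unit_left)
  finally show ?thesis .
qed

lemma mat_inverse_unique:
  assumes "finite I" "mat_inverse I A B" "mat_inverse I A C" "i \<in> I" "k \<in> I"
  shows "B i k = C i k"
  using assms by (intro mat_left_right_inverse[of I B A C]) (auto simp: mat_inverse_def)

text \<open>Triangularity with respect to the order of \<open>xs\<close>, so that both shapes are covered.\<close>
lemma triangular_mat_inverse: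
  assumes "distinct xs" "sorted_wrt (\<lambda>i j. A j i = 0) xs"
    and "\<And>i. i \<in> set xs \<Longrightarrow> \<exists>u. A i i * u = 1 \<and> u * A i i = (1::'a::ring_1)"
  shows "\<exists>B. mat_inverse (set xs) A B"
  using assms
proof (induction xs)
  case Nil
  then show ?case by (simp add: mat_inverse_def)
next
  case (Cons a xs)
  let ?J = "set xs"
  obtain C where C: "mat_inverse ?J A C" using Cons by auto
  obtain u where u: "A a a * u = 1" "u * A a a = 1" using Cons.prems(3)[of a] by auto
  have z: "A j a = 0" if "j \<in> ?J" for j using Cons.prems(2) that by auto
  have a: "a \<notin> ?J" using Cons.prems(1) by simp
  \<comment> \<open>Block inversion: if A has first row (x, b), zeros below x and lower right block
    A', then its inverse has first row (u, - u b C) and lower right block C, where C inverts A'. The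
    row b C is \<open>r\<close>.\<close>
  define r where "r k = mat_mult ?J A C a k" for k
  define B where "B i k = (if i = a then (if k = a then u else - (u * r k)) else if k = a then 0 else C i k)" for i k
  have ne: "(i = a) = False" "(a = i) = False" if "i \<in> ?J" for i using that a by auto
  have split: "mat_mult (set (a # xs)) X Y i k = X i a * Y a k + mat_mult ?J X Y i k" for X Y :: "nat \<Rightarrow> nat \<Rightarrow> 'a" and i k
    using a by (simp add: mat_mult_def)
  have AC: "mat_mult ?J A C i k = mat_unit i k" "mat_mult ?J C A i k = mat_unit i k" if "i \<in> ?J" "k \<in> ?J" for i k
    using C that by (auto simp: mat_inverse_def)
  have AB: "mat_mult ?J A B i k = (if k = a then 0 else mat_mult ?J A C i k)" for i k
    unfolding mat_mult_def by (auto intro!: sum.cong sum.neutral simp: B_def ne)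
  have BA: "mat_mult ?J B A i k = (if i = a then - (u * mat_mult ?J (\<lambda>_. r) A i k) else mat_mult ?J C A i k)" for i k
    unfolding mat_mult_def by (auto intro!: sum.cong simp: B_def ne sum_distrib_left sum_negf mult.assoc)
  have rA: "mat_mult ?J (\<lambda>_. r) A i k = A a k" if "k \<in> ?J" for i k
  proof -
    have "mat_mult ?J (\<lambda>_. r) A i k = mat_mult ?J (mat_mult ?J A C) A a k"
      by (simp add: mat_mult_def r_def)
    also have "\<dots> = A a k"
      unfolding mat_mult_assoc using mat_mult_cong[of ?J A a A "mat_mult ?J C A" k mat_unit] that
      by (simp add: AC mat_mult_unit_right)
    finally show ?thesis .
  qed
  have z0: "mat_mult ?J X A i a = 0" for X i
    using z by (simp add: mat_mult_def)
  have "mat_inverse (set (a # xs)) A B"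
    unfolding mat_inverse_def
  proof (intro ballI conjI)
    fix i k assume i: "i \<in> set (a # xs)" and k: "k \<in> set (a # xs)"
    have "i = a \<or> i \<in> ?J" "k = a \<or> k \<in> ?J" using i k by auto
    then show "mat_mult (set (a # xs)) A B i k = mat_unit i k"
      unfolding split AB using u z
      by (elim disjE) (simp_all add: B_def ne AC mat_unit_def r_def flip: mult.assoc)
    show "mat_mult (set (a # xs)) B A i k = mat_unit i k"
      unfolding split BA using u \<open>i = a \<or> i \<in> ?J\<close> \<open>k = a \<or> k \<in> ?J\<close>
      by (elim disjE) (simp_all add: B_def ne AC mat_unit_def rA z0)
  qed
  then show ?case by blast
qed

section \<open>Inverses of matrices over power series\<close>

fun inverse_coeffs :: "nat set \<Rightarrow> (nat \<Rightarrow> nat \<Rightarrow> 'a::ring_1 fps) \<Rightarrow> (nat \<Rightarrow> nat \<Rightarrow> 'a) \<Rightarrow> nat \<Rightarrow> nat \<Rightarrow> nat \<Rightarrow> 'a" where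
  "inverse_coeffs I A B0 r = (if r = 0 then B0 else
     (\<lambda>i k. - mat_mult I B0 (\<lambda>j k. \<Sum>s<r. mat_mult I (\<lambda>i j. fps_nth (A i j) (r - s)) (inverse_coeffs I A B0 s) j k) i k))"

declare inverse_coeffs.simps [simp del]

text \<open>For r > 0 the coefficient of order r in A B = 1 says that A_0 B_r plus the sum of all
  A_(r-s) B_s with s < r vanishes. Since \<open>B0\<close> inverts A_0, this determines B_r from the
  earlier coefficients; the solution is \<open>inverse_coeffs\<close>.\<close>

lemma mat_fps_right_inverse:
  assumes fin: "finite I" and B0: "mat_inverse I (\<lambda>i j. fps_nth (A i j) 0) B0"
  shows "\<exists>B. (\<forall>i\<in>I. \<forall>k\<in>I. mat_mult I A B i k = mat_unit i k) \<and> (\<forall>i k. fps_nth (B i k) 0 = B0 i k)"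
proof -
  define c where "c = inverse_coeffs I A B0"
  define B where "B i k = Abs_fps (\<lambda>r. c r i k)" for i k
  let ?A = "\<lambda>r i j. fps_nth (A i j) r"
  have nth: "fps_nth (mat_mult I A B i k) r = (\<Sum>s\<le>r. mat_mult I (?A (r - s)) (c s) i k)" for i k r
  proof -
    have "fps_nth (mat_mult I A B i k) r = (\<Sum>j\<in>I. \<Sum>s\<le>r. ?A (r - s) i j * c s j k)"
      unfolding mat_mult_def fps_sum_nth
    proof (intro sum.cong refl)
      fix j
      have "fps_nth (A i j * B j k) r = (\<Sum>s=0..r. ?A s i j * c (r - s) j k)"
        by (simp add: fps_mult_nth B_def)
      also have "\<dots> = (\<Sum>s\<le>r. ?A (r - s) i j * c s j k)"
        by (rule sum.reindex_bij_witness[of _ "\<lambda>s. r - s" "\<lambda>s. r - s"]) auto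
      finally show "fps_nth (A i j * B j k) r = (\<Sum>s\<le>r. ?A (r - s) i j * c s j k)" .
    qed
    then show ?thesis unfolding mat_mult_def by (simp only: sum.swap[of _ I])
  qed
  have c0: "c 0 = B0" by (simp add: c_def inverse_coeffs.simps)
  have "mat_mult I A B i k = mat_unit i k" if I: "i \<in> I" "k \<in> I" for i k
  proof (rule fps_ext)
    fix r
    show "fps_nth (mat_mult I A B i k) r = fps_nth (mat_unit i k) r"
    proof (cases "r = 0")
      case True
      then show ?thesis using B0 I by (simp add: nth c0 mat_inverse_def mat_unit_def)
    next
      case False
      define g where "g j k = (\<Sum>s<r. mat_mult I (?A (r - s)) (c s) j k)" for j k
      have cr: "c r = (\<lambda>i k. - mat_mult I B0 g i k)"
        using False unfolding c_def g_def by (subst inverse_coeffs.simps) simp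
      have "mat_mult I (?A 0) (c r) i k = - mat_mult I (?A 0) (mat_mult I B0 g) i k"
        by (simp add: mat_mult_def cr sum_negf)
      also have "\<dots> = - mat_mult I (mat_mult I (?A 0) B0) g i k" by (simp add: mat_mult_assoc)
      also have "\<dots> = - g i k"
        using B0 I fin mat_mult_cong[of I "mat_mult I (?A 0) B0" i mat_unit g k g]
        by (simp add: mat_inverse_def mat_mult_unit_left)
      finally have "fps_nth (mat_mult I A B i k) r = 0"
        unfolding nth by (simp add: g_def flip: lessThan_Suc_atMost)
      then show ?thesis using False by (simp add: mat_unit_def)
    qed
  qed
  then show ?thesis by (intro exI[of _ B]) (auto simp: B_def c0)
qed

text \<open>The right inverse B of A has an invertible constant term, so it has a right inverse C
  itself. Then A = A (B C) = (A B) C = C, and B is an inverse on both sides.\<close>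

lemma mat_fps_inverse:
  assumes fin: "finite I" and B0: "mat_inverse I (\<lambda>i j. fps_nth (A i j) 0) B0"
  shows "\<exists>B. mat_inverse I A B"
proof -
  obtain B where B: "\<And>i k. i \<in> I \<Longrightarrow> k \<in> I \<Longrightarrow> mat_mult I A B i k = mat_unit i k" "\<And>i k. fps_nth (B i k) 0 = B0 i k"
    using mat_fps_right_inverse[OF assms] by blast
  have "mat_inverse I (\<lambda>i j. fps_nth (B i j) 0) (\<lambda>i j. fps_nth (A i j) 0)"
    using B0 by (auto simp: mat_inverse_def B(2))
  from mat_fps_right_inverse[OF fin this]
  obtain C where C: "\<And>i k. i \<in> I \<Longrightarrow> k \<in> I \<Longrightarrow> mat_mult I B C i k = mat_unit i k" by blast
  have "A i k = C i k" if "i \<in> I" "k \<in> I" for i k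
    using mat_left_right_inverse[OF fin B(1) C that] .
  then have "mat_mult I B A i k = mat_unit i k" if "i \<in> I" "k \<in> I" for i k
    using C[OF that] mat_mult_cong[of I B i B A k C] that by simp
  then show ?thesis using B(1) by (intro exI[of _ B]) (simp add: mat_inverse_def)
qed

section \<open>The R-matrix and its crossing symmetry\<close>

text \<open>\<open>\<kappa> i\<close> is \<open>q\<^sub>i\<close> times its parity sign, so that \<open>\<kappa> i\<close> is a root of \<open>x - x\<^sup>-\<^sup>1 = \<beta>\<close> for both parities; \<open>\<kappa>'\<close> is the inverse of
  \<open>\<kappa>\<close>, \<open>\<pi> i\<close> is the product of the \<open>\<kappa> j\<^sup>-\<^sup>2\<close> with \<open>j \<le> i\<close>, and \<open>\<pi> n\<close> is the shift of the spectral parameter. \<open>A\<close> and \<open>B\<close> are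
  the coefficients of \<open>E\<^sub>i\<^sub>i \<otimes> E\<^sub>k\<^sub>k\<close> and \<open>E\<^sub>i\<^sub>k \<otimes> E\<^sub>k\<^sub>i\<close> in \<open>R(z, w)\<close>; those of \<open>\<Delta>(z, w) R(z, w)\<^sup>-\<^sup>1\<close> are \<open>A'\<close> and \<open>B'\<close>.\<close>
locale rtt_scalars =
  fixes n :: nat and \<kappa> \<kappa>' d \<pi> :: "nat \<Rightarrow> 'c::comm_ring_1" and \<theta> :: "nat \<Rightarrow> nat \<Rightarrow> 'c" and \<beta> :: 'c
  assumes kappa_inverse: "i \<in> {1..n} \<Longrightarrow> \<kappa> i * \<kappa>' i = 1"
    and beta: "i \<in> {1..n} \<Longrightarrow> \<beta> = \<kappa> i - \<kappa>' i"
    and d_kappa: "i \<in> {1..n} \<Longrightarrow> d i * \<kappa> i = \<pi> (i - 1)"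
    and d_kappa': "i \<in> {1..n} \<Longrightarrow> d i * \<kappa>' i = \<pi> i"
    and pi_0: "\<pi> 0 = 1"
    and theta: "\<theta> i k * \<theta> k i = 1"
begin

abbreviation I where "I \<equiv> {1..n}"

definition A :: "'c \<Rightarrow> 'c \<Rightarrow> nat \<Rightarrow> nat \<Rightarrow> 'c" where
  "A z w i k = (if i = k then \<kappa> i * z - \<kappa>' i * w else \<theta> i k * (z - w))"

definition B :: "'c \<Rightarrow> 'c \<Rightarrow> nat \<Rightarrow> nat \<Rightarrow> 'c" where
  "B z w i k = (if i < k then \<beta> * z else if k < i then \<beta> * w else 0)"

definition A' :: "'c \<Rightarrow> 'c \<Rightarrow> nat \<Rightarrow> nat \<Rightarrow> 'c" where
  "A' z w i k = (if i = k then \<kappa>' i * z - \<kappa> i * w else \<theta> k i * (z - w))"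

definition B' :: "'c \<Rightarrow> 'c \<Rightarrow> nat \<Rightarrow> nat \<Rightarrow> 'c" where
  "B' z w i k = - B z w i k"

definition \<Delta> where
  "\<Delta> z w = (z - w)^2 - \<beta>^2 * z * w"

lemma B_self [simp]: "B z w i i = 0" "B' z w i i = 0"
  by (simp_all add: B_def B'_def)

text \<open>Only the product 1 and the difference \<beta> of \<kappa> i and \<kappa>' i enter, so
  \<Delta> is the same for roots of both kinds. Later the linear factors allow \<Delta> to be
  cancelled.\<close>

lemma Delta_kappa:
  assumes "i \<in> I"
  shows "\<Delta> z w = (\<kappa> i * z - \<kappa>' i * w) * (\<kappa>' i * z - \<kappa> i * w)"
proof -
  have *: "\<kappa> i * \<kappa>' i = 1" by (rule kappa_inverse[OF assms])
  have "(\<kappa> i * z - \<kappa>' i * w) * (\<kappa>' i * z - \<kappa> i * w) =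
     (\<kappa> i * \<kappa>' i) * (z^2 + w^2) - (\<kappa> i^2 + \<kappa>' i^2) * z * w"
    by (simp add: algebra_simps power2_eq_square)
  also have "\<dots> = (z - w)^2 - (\<kappa> i - \<kappa>' i)^2 * z * w + (\<kappa> i * \<kappa>' i - 1) * (z^2 + w^2 - 2 * z * w)"
    by (simp add: algebra_simps power2_eq_square)
  finally show ?thesis by (simp add: \<Delta>_def * flip: beta[OF assms])
qed

text \<open>R preserves the span of e_i \<otimes> e_k and e_k \<otimes> e_i, so this is a
  computation with 2-by-2 blocks. The first two equations are entries of the product with the
  inverse on the left, the last two with the inverse on the right.\<close>

lemma R_inverse:
  assumes "i \<in> I" "k \<in> I"
  shows "A' z w i k * A z w i k + B' z w i k * B z w k i = \<Delta> z w"
    and "A' z w i k * B z w i k + B' z w i k * A z w k i = 0"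
    and "A z w i k * A' z w i k + B z w i k * B' z w k i = \<Delta> z w"
    and "A z w i k * B' z w i k + B z w i k * A' z w k i = 0"
proof -
  have *: "\<theta> k i * (z - w) * (\<theta> i k * (z - w)) = (z - w)^2"
  proof -
    have "\<theta> k i * (z - w) * (\<theta> i k * (z - w)) = (\<theta> k i * \<theta> i k) * (z - w)^2"
      by (simp add: power2_eq_square mult_ac)
    then show ?thesis by (simp add: theta)
  qed
  show 1: "A' z w i k * A z w i k + B' z w i k * B z w k i = \<Delta> z w"
    using Delta_kappa[OF assms(1), of z w] *
    by (auto simp: A_def A'_def B_def B'_def \<Delta>_def mult_ac power2_eq_square)
  show "A' z w i k * B z w i k + B' z w i k * A z w k i = 0"
    by (auto simp: A_def A'_def B_def B'_def)
  show "A z w i k * A' z w i k + B z w i k * B' z w k i = \<Delta> z w"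
    using 1 by (simp add: B'_def mult_ac)
  show "A z w i k * B' z w i k + B z w i k * A' z w k i = 0"
    by (auto simp: A_def A'_def B_def B'_def)
qed

text \<open>With the next lemma this is unitarity: \<Delta>(z, w) times the inverse of R(z, w) is
  minus R(w, z) with exchanged tensor factors.\<close>

lemma A'_sym: "A' z w i k = - A w z k i"
  by (auto simp: A_def A'_def algebra_simps)

lemma B'_sym: "B' z w i k = - B w z k i"
  by (auto simp: B_def B'_def)

lemma Delta_sym: "\<Delta> z w = \<Delta> w z"
  by (simp add: \<Delta>_def algebra_simps power2_eq_square)

text \<open>Subtracting the two hypotheses on d shows \<beta> d_i as a difference of consecutive
  values of \<pi>; this makes all weighted sums below telescope.\<close>

lemma beta_d: "i \<in> I \<Longrightarrow> \<beta> * d i = \<pi> (i - 1) - \<pi> i"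
  using d_kappa[of i] d_kappa'[of i] by (subst beta[of i]) (simp_all add: algebra_simps)

lemma beta_sum:
  assumes "a \<le> b" "b \<le> n"
  shows "\<beta> * (\<Sum>t\<in>{a<..b}. d t) = \<pi> a - \<pi> b"
  using assms
proof (induction b rule: dec_induct)
  case (step b)
  have "{a<..Suc b} = insert (Suc b) {a<..b}" using step by auto
  then show ?case using step beta_d[of "Suc b"] by (simp add: distrib_left)
qed simp

lemma sum_B:
  assumes "i \<in> I"
  shows "(\<Sum>t\<in>I. d t * B z w t i) = z * (1 - \<pi> (i - 1)) + w * (\<pi> i - \<pi> n)"
proof -
  have I: "I = {0<..i - 1} \<union> {i} \<union> {i<..n}" using assms by auto
  have "(\<Sum>t\<in>I. d t * B z w t i) = (\<Sum>t\<in>{0<..i - 1}. d t * B z w t i) + (\<Sum>t\<in>{i<..n}. d t * B z w t i)"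
    unfolding I using assms by (subst sum.union_disjoint; force simp: sum.union_disjoint)+
  also have "(\<Sum>t\<in>{0<..i - 1}. d t * B z w t i) = z * (\<beta> * (\<Sum>t\<in>{0<..i - 1}. d t))"
    unfolding sum_distrib_left using assms by (intro sum.cong) (auto simp: B_def mult_ac)
  also have "(\<Sum>t\<in>{i<..n}. d t * B z w t i) = w * (\<beta> * (\<Sum>t\<in>{i<..n}. d t))"
    unfolding sum_distrib_left by (intro sum.cong) (auto simp: B_def mult_ac)
  also have "\<beta> * (\<Sum>t\<in>{0<..i - 1}. d t) = 1 - \<pi> (i - 1)"
    using assms by (subst beta_sum) (auto simp: pi_0)
  also have "\<beta> * (\<Sum>t\<in>{i<..n}. d t) = \<pi> i - \<pi> n"
    using assms beta_sum[of i n] by simp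
  finally show ?thesis .
qed

text \<open>Partial transposition turns E_ik \<otimes> E_ki into E_ki \<otimes> E_ki, so the left
  side is the coordinate at e_k \<otimes> e_k of the transposed R applied to the sum of the vectors
  d_i e_i \<otimes> e_i.\<close>

lemma kernel:
  assumes "k \<in> I"
  shows "d k * A (\<pi> n) 1 k k + (\<Sum>i\<in>I. d i * B (\<pi> n) 1 i k) = 0"
  using d_kappa[OF assms] d_kappa'[OF assms]
  unfolding sum_B[OF assms] A_def by (simp add: algebra_simps) (simp add: mult.assoc[symmetric] mult_ac)

lemma crossing_diag:
  assumes i: "i \<in> I" and z': "z' = \<pi> n * z"
  shows "d i * A z' w i i * A' z w i i + (\<Sum>t\<in>I. d t * B z' w t i * B' z w i t) = (z' - w) * (z - w) * d i"
proof -
  \<comment> \<open>The two factors have opposite index orders: they give z' w for t < i and w z for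
    t > i. The product is thus again of the form B, and \<open>sum_B\<close> applies.\<close>
  have "(\<Sum>t\<in>I. d t * B z' w t i * B' z w i t) = - \<beta> * (\<Sum>t\<in>I. d t * B (z' * w) (w * z) t i)"
    unfolding sum_distrib_left by (intro sum.cong) (auto simp: B_def B'_def algebra_simps)
  also have "(\<Sum>t\<in>I. d t * B (z' * w) (w * z) t i) = z * w * (\<pi> i - \<pi> n * \<pi> (i - 1))"
    unfolding sum_B[OF i] z' by (simp add: algebra_simps)
  finally have S: "(\<Sum>t\<in>I. d t * B z' w t i * B' z w i t) = - \<beta> * (z * w * (\<pi> i - \<pi> n * \<pi> (i - 1)))" .
  have b: "\<beta> = \<kappa> i - \<kappa>' i" by (rule beta[OF i])
  have p: "\<pi> (i - 1) = d i * \<kappa> i" "\<pi> i = d i * \<kappa>' i"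
    using d_kappa[OF i] d_kappa'[OF i] by simp_all
  have *: "\<kappa> i * \<kappa>' i = 1" by (rule kappa_inverse[OF i])
  have **: "\<kappa> i * (\<kappa>' i * x) = x" for x by (simp add: * flip: mult.assoc)
  show ?thesis unfolding S unfolding A_def A'_def p z' b
    by (simp add: algebra_simps * **)
qed

text \<open>The coefficient that has to vanish for d to be an eigenvector. The sum splits at t and k
  into three telescoping pieces, and z' = \<open>\<pi> n * z\<close> makes the boundary term at n
  cancel the one at 0.\<close>

lemma crossing_off:
  assumes i: "t \<in> I" "k \<in> I" "t \<noteq> k" and z': "z' = \<pi> n * z"
  shows "d k * A z' w k k * B' z w t k + d t * B z' w t k * A' z w t t
    + (\<Sum>j\<in>I. d j * B z' w j k * B' z w t j) = 0"
proof -
  let ?s = "\<lambda>a b. \<beta> * (\<Sum>j\<in>{a<..b}. d j)"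
  have p: "\<pi> (k - Suc 0) = d k * \<kappa> k" "\<pi> k = d k * \<kappa>' k" "\<pi> (t - Suc 0) = d t * \<kappa> t" "\<pi> t = d t * \<kappa>' t"
    using d_kappa d_kappa' i by auto
  let ?F = "\<lambda>j. d j * B z' w j k * B' z w t j"
  let ?a = "min t k" and ?b = "max t k"
  have I: "I = {0<..?a - 1} \<union> {?a<..?b - 1} \<union> {?b<..n} \<union> {t, k}" using i by (auto simp: min_def max_def)
  have "sum ?F I = sum ?F ({0<..?a - 1} \<union> {?a<..?b - 1} \<union> {?b<..n})"
    by (subst I, rule sum.mono_neutral_right) auto
  also have "\<dots> = sum ?F {0<..?a - 1} + sum ?F {?a<..?b - 1} + sum ?F {?b<..n}"
    by (subst sum.union_disjoint; force simp: sum.union_disjoint)+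
  also have "sum ?F {0<..?a - 1} = - (\<beta> * z' * w) * ?s 0 (?a - 1)"
    unfolding sum_distrib_left by (intro sum.cong) (auto simp: B_def B'_def mult_ac)
  \<comment> \<open>Between t and k both factors select the argument of the same kind: z' and z if t
    < k, and w twice otherwise.\<close>
  also have "sum ?F {?a<..?b - 1} = - (\<beta> * (if t < k then z' * z else w * w)) * ?s ?a (?b - 1)"
    unfolding sum_distrib_left by (intro sum.cong) (auto simp: B_def B'_def mult_ac)
  also have "sum ?F {?b<..n} = - (\<beta> * w * z) * ?s ?b n"
    unfolding sum_distrib_left using i by (intro sum.cong) (auto simp: B_def B'_def mult_ac)
  also have "?s 0 (?a - 1) = 1 - \<pi> (?a - 1)" using i by (subst beta_sum) (auto simp: pi_0)
  also have "?s ?a (?b - 1) = \<pi> ?a - \<pi> (?b - 1)" using i by (intro beta_sum) auto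
  also have "?s ?b n = \<pi> ?b - \<pi> n" using i by (intro beta_sum) auto
  finally have S: "sum ?F I = - (\<beta> * z' * w) * (1 - \<pi> (?a - 1)) +
      - (\<beta> * (if t < k then z' * z else w * w)) * (\<pi> ?a - \<pi> (?b - 1)) + - (\<beta> * w * z) * (\<pi> ?b - \<pi> n)" .
  consider "t < k" | "k < t" using i(3) by linarith
  then show ?thesis unfolding S
    by cases (simp_all add: A_def A'_def B_def B'_def min_def max_def z' p algebra_simps)
qed

end


section \<open>RTT relations\<close>

text \<open>Scalars act through a homomorphism, so that they may be of another type than the
  algebra: the base field in one variable, the type \<open>cen\<close> of central elements in two
  variables.\<close>

locale central_hom =
  fixes h :: "'c::comm_ring_1 \<Rightarrow> 'b::ring_1"
  assumes h_add: "h (x + y) = h x + h y"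
    and h_mult: "h (x * y) = h x * h y"
    and h_1: "h 1 = 1"
    and h_central: "h x * b = b * h x"
begin

definition scale (infixr "*s" 75) where "c *s x = h c * x"

sublocale module scale
  by standard (simp_all add: scale_def distrib_left distrib_right h_add h_mult h_1 mult.assoc)

lemma scale_mult_left [simp]: "(c *s x) * y = c *s (x * y)"
  by (simp add: scale_def mult.assoc)

lemma scale_mult_right [simp]: "x * (c *s y) = c *s (x * y)"
  by (simp add: scale_def mult.assoc[symmetric] h_central[of c x])

lemma scale_if: "c *s (if P then x else 0) = (if P then c *s x else 0)"
  by simp

end

locale rtt_algebra = rtt_scalars n \<kappa> \<kappa>' d \<pi> \<theta> \<beta> + central_hom h
  for n and \<kappa> \<kappa>' d \<pi> :: "nat \<Rightarrow> 'c::comm_ring_1" and \<theta> \<beta> and h :: "'c \<Rightarrow> 'b::ring_1"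
begin

text \<open>These are the entries of a R(z, w) T_1 S_2 = a' S_2 T_1 R(z', w'). The sides have
  separate parameters because the relation between L^+ and L^- contains \<open>q^c\<close> on one
  side and its inverse on the other.\<close>

definition RTT :: "'c \<Rightarrow> 'c \<Rightarrow> 'c \<Rightarrow> 'c \<Rightarrow> 'c \<Rightarrow> 'c \<Rightarrow> (nat \<Rightarrow> nat \<Rightarrow> 'b) \<Rightarrow> (nat \<Rightarrow> nat \<Rightarrow> 'b) \<Rightarrow> bool" where
  "RTT a z w a' z' w' T S \<longleftrightarrow> (\<forall>i\<in>I. \<forall>m\<in>I. \<forall>k\<in>I. \<forall>l\<in>I.
     a *s (A z w i k *s (T i m * S k l) + B z w i k *s (T k m * S i l)) =
     a' *s (A z' w' m l *s (S k l * T i m) + B z' w' l m *s (S k m * T i l)))"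

text \<open>The relation is multiplied by \<Delta> R^-1 from the left and from the right, with the
  respective parameters. Every step is polynomial, so that \<Delta> may fail to be a unit.\<close>

lemma RTT_inverse:
  assumes R: "RTT a z w a' z' w' T S" and I: "i \<in> I" "m \<in> I" "k \<in> I" "l \<in> I"
  shows "(a * \<Delta> z w) *s (A' z' w' m l *s (T i m * S k l) + B' z' w' l m *s (T i l * S k m)) =
         (a' * \<Delta> z' w') *s (A' z w i k *s (S k l * T i m) + B' z w i k *s (S i l * T k m))" (is "?l = ?r")
proof -
  define G where "G m l = A' z w i k *s (S k l * T i m) + B' z w i k *s (S i l * T k m)" for m l
  have 1: "(a * \<Delta> z w) *s (T i m * S k l) = a' *s (A z' w' m l *s G m l + B z' w' l m *s G l m)"
    if ml: "m \<in> I" "l \<in> I" for m l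
  proof -
    have "(a * \<Delta> z w) *s (T i m * S k l) =
       a *s ((A' z w i k * A z w i k + B' z w i k * B z w k i) *s (T i m * S k l)
           + (A' z w i k * B z w i k + B' z w i k * A z w k i) *s (T k m * S i l))"
      using I by (simp add: R_inverse)
    also have "\<dots> = A' z w i k *s (a *s (A z w i k *s (T i m * S k l) + B z w i k *s (T k m * S i l)))
        + B' z w i k *s (a *s (A z w k i *s (T k m * S i l) + B z w k i *s (T i m * S k l)))"
      by (simp add: scale_left_distrib scale_right_distrib mult_ac)
    also have "\<dots> = A' z w i k *s (a' *s (A z' w' m l *s (S k l * T i m) + B z' w' l m *s (S k m * T i l)))
        + B' z w i k *s (a' *s (A z' w' m l *s (S i l * T k m) + B z' w' l m *s (S i m * T k l)))"
      using R I ml by (simp add: RTT_def del: scale_scale)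
    also have "\<dots> = a' *s (A z' w' m l *s G m l + B z' w' l m *s G l m)"
      by (simp add: G_def scale_left_distrib scale_right_distrib mult_ac)
    finally show ?thesis .
  qed
  have "?l =
     A' z' w' m l *s ((a * \<Delta> z w) *s (T i m * S k l)) + B' z' w' l m *s ((a * \<Delta> z w) *s (T i l * S k m))"
    by (simp add: scale_right_distrib mult_ac)
  also have "\<dots> = a' *s ((A z' w' m l * A' z' w' m l + B z' w' m l * B' z' w' l m) *s G m l
      + (A' z' w' m l * B z' w' l m + B' z' w' l m * A z' w' l m) *s G l m)"
    using I by (simp add: 1 scale_left_distrib scale_right_distrib mult_ac del: B_self)
  also have "A z' w' m l * A' z' w' m l + B z' w' m l * B' z' w' l m = \<Delta> z' w'"
    using I by (simp add: R_inverse)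
  also have "A' z' w' m l * B z' w' l m + B' z' w' l m * A z' w' l m = 0"
    by (auto simp: A_def A'_def B_def B'_def)
  finally show ?thesis by (simp add: G_def)
qed

text \<open>By unitarity, \<open>RTT_inverse\<close> is again an RTT relation, with T and S
  exchanged and factors \<Delta> as the price. It serves to commute the scalar of L^- with
  L^+.\<close>

lemma RTT_swap:
  assumes "RTT a z w a' z' w' T S"
  shows "RTT (a' * \<Delta> z' w') w z (a * \<Delta> z w) w' z' S T"
  unfolding RTT_def
proof (intro ballI, goal_cases)
  case (1 i m k l)
  then show ?case
    using RTT_inverse[OF assms, of k l i m]
    by (simp add: A'_sym B'_sym scale_minus_left scale_right_distrib) (simp add: algebra_simps)
qed

text \<open>The relation of \<open>RTT_inverse\<close> is multiplied by Y in the first tensor factor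
  from both sides. Each product of Y and T collapses to a Kronecker delta, which leaves the cases p
  = l and k = r.\<close>

lemma RTT_inverse_right:
  assumes R: "RTT a z w a' z' w' T S" and Y: "mat_inverse I T Y"
    and I: "p \<in> I" "r \<in> I" "k \<in> I" "l \<in> I"
  shows "(a * \<Delta> z w) *s (A' z' w' p l *s (S k l * Y p r) + (if p = l then \<Sum>m\<in>I. B' z' w' l m *s (S k m * Y m r) else 0)) =
         (a' * \<Delta> z' w') *s (A' z w r k *s (Y p r * S k l) + (if k = r then \<Sum>i\<in>I. B' z w i k *s (Y p i * S i l) else 0))" (is "?l = ?r")
proof -
  have YT: "(\<Sum>i\<in>I. Y p i * (T i m * x)) = (if p = m then x else 0)" if "m \<in> I" for m x
    using Y I that by (simp add: mat_inverse_iff mult.assoc[symmetric] flip: sum_distrib_right)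
  have TY: "(\<Sum>m\<in>I. x * (T i m * Y m r)) = (if i = r then x else 0)" if "i \<in> I" for i x
    using Y I that by (simp add: mat_inverse_iff flip: sum_distrib_left)
  have "?l =
     (a * \<Delta> z w) *s (\<Sum>m\<in>I. A' z' w' m l *s (if p = m then S k l * Y m r else 0)
        + B' z' w' l m *s (if p = l then S k m * Y m r else 0))"
    using I by (simp add: scale_if sum.distrib)
  also have "\<dots> = (a * \<Delta> z w) *s (\<Sum>m\<in>I. (A' z' w' m l *s (\<Sum>i\<in>I. Y p i * (T i m * (S k l * Y m r)))
        + B' z' w' l m *s (\<Sum>i\<in>I. Y p i * (T i l * (S k m * Y m r)))))"
    using I by (intro arg_cong2[of _ _ _ _ scale] refl sum.cong) (simp add: YT del: One_nat_def)
  also have "\<dots> = (\<Sum>m\<in>I. \<Sum>i\<in>I. Y p i * ((a * \<Delta> z w) *s (A' z' w' m l *s (T i m * S k l) + B' z' w' l m *s (T i l * S k m))) * Y m r)"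
    by (simp add: scale_sum_right scale_right_distrib sum.distrib distrib_left distrib_right mult.assoc)
  also have "\<dots> = (\<Sum>m\<in>I. \<Sum>i\<in>I. Y p i * ((a' * \<Delta> z' w') *s (A' z w i k *s (S k l * T i m) + B' z w i k *s (S i l * T k m))) * Y m r)"
    using I by (intro sum.cong refl) (simp add: RTT_inverse[OF R])
  also have "\<dots> = (\<Sum>i\<in>I. \<Sum>m\<in>I. Y p i * ((a' * \<Delta> z' w') *s (A' z w i k *s (S k l * T i m) + B' z w i k *s (S i l * T k m))) * Y m r)"
    by (rule sum.swap)
  also have "\<dots> = (a' * \<Delta> z' w') *s (\<Sum>i\<in>I. A' z w i k *s (\<Sum>m\<in>I. (Y p i * S k l) * (T i m * Y m r))
     + B' z w i k *s (\<Sum>m\<in>I. (Y p i * S i l) * (T k m * Y m r)))"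
    by (simp add: scale_sum_right scale_right_distrib sum.distrib distrib_left distrib_right mult.assoc)
  also have "\<dots> = ?r"
    using I by (auto simp: TY sum.distrib scale_if simp del: One_nat_def)
  finally show ?thesis .
qed

text \<open>Both sides are values of \<open>(T\<^sub>1\<^sup>t R S R\<^sup>-\<^sup>1 Y) v\<close>, where \<open>v\<close> is the vector with coordinates \<open>d\<close>: \<open>S\<close> is moved to the left
  or to the right, and the R-matrices then act on \<open>v\<close> by a scalar, by crossing symmetry.\<close>
lemma sandwich:
  assumes R1: "RTT a1 z1 w a1' z1' w' T1 S" and R: "RTT a z w a' z' w' T S" and Y: "mat_inverse I T Y"
    and z1: "z1 = \<pi> n * z" "z1' = \<pi> n * z'"
    and \<zeta>: "\<And>m p. m \<in> I \<Longrightarrow> p \<in> I \<Longrightarrow> (\<Sum>i\<in>I. d i *s (T1 i m * Y p i)) = (if m = p then d m *s \<zeta> else 0)"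
    and I: "i \<in> I" "k \<in> I" "l \<in> I"
  shows "(a1' * a * \<Delta> z w * ((z1' - w') * (z' - w')) * d i) *s (S k l * \<zeta>) =
         (a1 * a' * \<Delta> z' w' * ((z1 - w) * (z - w)) * d i) *s (\<zeta> * S k l)"
proof -
  let ?A1 = "A z1 w" and ?B1 = "B z1 w" and ?C = "A' z w" and ?D = "B' z w"
    and ?A1' = "A z1' w'" and ?B1' = "B z1' w'" and ?C' = "A' z' w'" and ?D' = "B' z' w'"
  \<comment> \<open>\<open>Z\<close> joins S with Y and \<open>W\<close> joins T1 with S.
    \<open>X\<close> can be bracketed as W times Y or as T1 times Z; the first moves S to the left
    of \<zeta>, the second to its right.\<close>
  define Z where "Z j x = ?C' i l *s (S x l * Y i j) +
     (if i = l then \<Sum>m\<in>I. ?D' l m *s (S x m * Y m j) else 0)" for j x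
  define W where "W j m = ?A1 j k *s (T1 j i * S k m) + ?B1 j k *s (T1 k i * S j m)" for j m
  define X where "X = (\<Sum>j\<in>I. d j *s (?A1 j k *s (T1 j i * Z j k) + ?B1 j k *s (T1 k i * Z j j)))"
  have Z: "(a * \<Delta> z w) *s Z j x = (a' * \<Delta> z' w') *s (?C j x *s (Y i j * S x l) +
      (if x = j then \<Sum>t\<in>I. ?D t x *s (Y i t * S t l) else 0))" if "j \<in> I" "x \<in> I" for j x
    unfolding Z_def using RTT_inverse_right[OF R Y I(1) that I(3)] .
  have "(a1 * (a * \<Delta> z w)) *s X = (a1' * a * \<Delta> z w * ((z1' - w') * (z' - w')) * d i) *s (S k l * \<zeta>)"
  proof -
    have W: "a1 *s W j m = a1' *s (?A1' i m *s (S k m * T1 j i) + ?B1' m i *s (S k i * T1 j m))"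
      if "j \<in> I" "m \<in> I" for j m
      using R1 I that by (simp add: W_def RTT_def)
    have dW: "a1 *s (\<Sum>j\<in>I. d j *s (W j m * Y t j)) =
       a1' *s (?A1' i m *s (if i = t then d i *s (S k m * \<zeta>) else 0) +
               ?B1' m i *s (if m = t then d m *s (S k i * \<zeta>) else 0))" if "m \<in> I" "t \<in> I" for m t
    proof -
      have "a1 *s (\<Sum>j\<in>I. d j *s (W j m * Y t j)) = (\<Sum>j\<in>I. d j *s ((a1 *s W j m) * Y t j))"
        by (simp add: scale_sum_right mult_ac)
      also have "\<dots> = (\<Sum>j\<in>I. d j *s (a1' *s (?A1' i m *s (S k m * T1 j i) + ?B1' m i *s (S k i * T1 j m)) * Y t j))"
        using that by (intro sum.cong refl) (simp add: W)
      also have "\<dots> = a1' *s (?A1' i m *s (S k m * (\<Sum>j\<in>I. d j *s (T1 j i * Y t j))) +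
          ?B1' m i *s (S k i * (\<Sum>j\<in>I. d j *s (T1 j m * Y t j))))"
        by (simp add: scale_sum_right scale_right_distrib sum.distrib distrib_left distrib_right sum_distrib_left mult_ac)
      also have "\<dots> = a1' *s (?A1' i m *s (if i = t then d i *s (S k m * \<zeta>) else 0) +
               ?B1' m i *s (if m = t then d m *s (S k i * \<zeta>) else 0))"
        unfolding \<zeta>[OF I(1) that(2)] \<zeta>[OF that] by simp
      finally show ?thesis .
    qed
    have "X = ?C' i l *s (\<Sum>j\<in>I. d j *s (W j l * Y i j)) +
       (if i = l then \<Sum>m\<in>I. ?D' l m *s (\<Sum>j\<in>I. d j *s (W j m * Y m j)) else 0)"
    proof (cases "i = l")
      case True
      have *: "(\<Sum>m\<in>I. ?D' l m *s (\<Sum>j\<in>I. d j *s (W j m * Y m j))) =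
          (\<Sum>j\<in>I. \<Sum>m\<in>I. ?D' l m *s (d j *s (W j m * Y m j)))"
        unfolding scale_sum_right by (rule sum.swap)
      show ?thesis unfolding * using True
        by (simp add: X_def Z_def W_def scale_sum_right scale_right_distrib sum.distrib distrib_left distrib_right
            sum_distrib_left mult_ac)
    next
      case False
      then show ?thesis
        by (simp add: X_def Z_def W_def scale_sum_right scale_right_distrib sum.distrib distrib_left distrib_right
            sum_distrib_left mult_ac)
    qed
    then have "a1 *s X = ?C' i l *s (a1 *s (\<Sum>j\<in>I. d j *s (W j l * Y i j))) +
       (if i = l then \<Sum>m\<in>I. ?D' l m *s (a1 *s (\<Sum>j\<in>I. d j *s (W j m * Y m j))) else 0)"
      by (simp add: scale_right_distrib scale_if scale_sum_right mult_ac)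
    also have "\<dots> = a1' *s ((?A1' i l * ?C' i l * d i) *s (S k l * \<zeta>) +
       (if i = l then (\<Sum>m\<in>I. d m * ?B1' m i * ?D' i m) *s (S k l * \<zeta>) else 0))"
    proof -
      have "(\<Sum>m\<in>I. ?D' l m *s (a1 *s (\<Sum>j\<in>I. d j *s (W j m * Y m j)))) =
          a1' *s ((\<Sum>m\<in>I. d m * ?B1' m i * ?D' i m) *s (S k l * \<zeta>))" if "i = l"
      proof -
        have "?D' l m *s (a1 *s (\<Sum>j\<in>I. d j *s (W j m * Y m j))) =
          a1' *s ((d m * ?B1' m i * ?D' i m) *s (S k l * \<zeta>))" if m: "m \<in> I" for m
          unfolding dW[OF m m] using \<open>i = l\<close> by (auto simp: scale_right_distrib mult_ac)
        then have "(\<Sum>m\<in>I. ?D' l m *s (a1 *s (\<Sum>j\<in>I. d j *s (W j m * Y m j)))) =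
          (\<Sum>m\<in>I. a1' *s ((d m * ?B1' m i * ?D' i m) *s (S k l * \<zeta>)))"
          by (intro sum.cong refl)
        also have "\<dots> = a1' *s ((\<Sum>m\<in>I. d m * ?B1' m i * ?D' i m) *s (S k l * \<zeta>))"
          unfolding scale_sum_left by (rule scale_sum_right[symmetric])
        finally show ?thesis .
      qed
      then show ?thesis unfolding dW[OF I(3) I(1)] by (auto simp: scale_right_distrib mult_ac)
    qed
    also have "\<dots> = (a1' * ((z1' - w') * (z' - w')) * d i) *s (S k l * \<zeta>)"
    proof (cases "i = l")
      case True
      then show ?thesis
        using crossing_diag[OF I(1) z1(2), of w'] by (simp add: mult_ac flip: scale_left_distrib)
    next
      case False
      have "?A1' i l * ?C' i l * d i = (\<theta> i l * \<theta> l i) * ((z1' - w') * (z' - w')) * d i"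
        using False by (simp add: A_def A'_def mult_ac)
      then show ?thesis using False by (simp add: theta mult_ac)
    qed
    finally have "(a * \<Delta> z w) *s (a1 *s X) = (a * \<Delta> z w) *s ((a1' * ((z1' - w') * (z' - w')) * d i) *s (S k l * \<zeta>))"
      by (rule arg_cong)
    then show ?thesis by (simp add: mult_ac)
  qed
  moreover have "(a1 * (a * \<Delta> z w)) *s X = (a1 * a' * \<Delta> z' w' * ((z1 - w) * (z - w)) * d i) *s (\<zeta> * S k l)"
  proof -
    define U where "U j = T1 j i * (Y i j * S k l)" for j
    define P where "P t = T1 k i * (Y i t * S t l)" for t
    define V where "V j x = ?C j x *s (Y i j * S x l) +
      (if x = j then \<Sum>t\<in>I. ?D t x *s (Y i t * S t l) else 0)" for j x
    have "(a * \<Delta> z w) *s X = (\<Sum>j\<in>I. d j *s (?A1 j k *s (T1 j i * ((a * \<Delta> z w) *s Z j k)) +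
        ?B1 j k *s (T1 k i * ((a * \<Delta> z w) *s Z j j))))"
      by (simp add: X_def scale_sum_right scale_right_distrib mult_ac)
    also have "\<dots> = (\<Sum>j\<in>I. d j *s (?A1 j k *s (T1 j i * ((a' * \<Delta> z' w') *s V j k)) +
        ?B1 j k *s (T1 k i * ((a' * \<Delta> z' w') *s V j j))))"
      using I by (intro sum.cong refl) (simp only: Z V_def)
    also have "\<dots> = (a' * \<Delta> z' w') *s (\<Sum>j\<in>I. d j *s (?A1 j k *s (T1 j i * V j k) + ?B1 j k *s (T1 k i * V j j)))"
      by (simp add: scale_sum_right scale_right_distrib mult_ac)
    also have "(\<Sum>j\<in>I. d j *s (?A1 j k *s (T1 j i * V j k) + ?B1 j k *s (T1 k i * V j j))) =
      (\<Sum>j\<in>I. (d j * ?A1 j k * ?C j k) *s U j)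
      + (\<Sum>j\<in>I. if k = j then \<Sum>t\<in>I. (d k * ?A1 k k * ?D t k) *s P t else 0)
      + ((\<Sum>j\<in>I. (d j * ?B1 j k * ?C j j) *s P j) + (\<Sum>j\<in>I. \<Sum>t\<in>I. (d j * ?B1 j k * ?D t j) *s P t))"
      unfolding sum.distrib[symmetric]
      by (intro sum.cong refl)
        (auto simp: V_def U_def P_def scale_sum_right scale_right_distrib distrib_left sum_distrib_left mult_ac)
    also have "(\<Sum>j\<in>I. if k = j then \<Sum>t\<in>I. (d k * ?A1 k k * ?D t k) *s P t else 0) =
        (\<Sum>t\<in>I. (d k * ?A1 k k * ?D t k) *s P t)"
      using I by simp
    also have "(\<Sum>j\<in>I. \<Sum>t\<in>I. (d j * ?B1 j k * ?D t j) *s P t) =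
        (\<Sum>t\<in>I. (\<Sum>j\<in>I. d j * ?B1 j k * ?D t j) *s P t)"
      unfolding scale_sum_left by (rule sum.swap)
    also have "(\<Sum>j\<in>I. (d j * ?A1 j k * ?C j k) *s U j) + (\<Sum>t\<in>I. (d k * ?A1 k k * ?D t k) *s P t) +
        ((\<Sum>j\<in>I. (d j * ?B1 j k * ?C j j) *s P j) + (\<Sum>t\<in>I. (\<Sum>j\<in>I. d j * ?B1 j k * ?D t j) *s P t)) =
        (\<Sum>j\<in>I. ((z1 - w) * (z - w) * d j) *s U j)"
      unfolding sum.distrib[symmetric]
    proof (intro sum.cong refl)
      fix j assume j: "j \<in> I"
      show "(d j * ?A1 j k * ?C j k) *s U j + (d k * ?A1 k k * ?D j k) *s P j +
         ((d j * ?B1 j k * ?C j j) *s P j + (\<Sum>ja\<in>I. d ja * ?B1 ja k * ?D j ja) *s P j) =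
         ((z1 - w) * (z - w) * d j) *s U j"
      \<comment> \<open>For j = k the products \<open>U j\<close> and \<open>P j\<close> coincide
        and \<open>crossing_diag\<close> adds up their coefficients. For other j the coefficient of
        \<open>P j\<close> vanishes by \<open>crossing_off\<close>, and in that of
        \<open>U j\<close> the factors \<theta> cancel.\<close>
      proof (cases "j = k")
        case True
        then show ?thesis using crossing_diag[OF j z1(1), of w]
          by (simp add: U_def P_def flip: scale_left_distrib)
      next
        case False
        have "(d k * ?A1 k k * ?D j k) *s P j + ((d j * ?B1 j k * ?C j j) *s P j +
           (\<Sum>ja\<in>I. d ja * ?B1 ja k * ?D j ja) *s P j) = 0"
          using crossing_off[OF j I(2) False z1(1), of w] by (simp add: add.assoc flip: scale_left_distrib)
        moreover have "d j * ?A1 j k * ?C j k = (\<theta> j k * \<theta> k j) * ((z1 - w) * (z - w) * d j)"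
          using False by (simp add: A_def A'_def mult_ac)
        ultimately show ?thesis by (simp add: theta add.assoc)
      qed
    qed
    also have "\<dots> = ((z1 - w) * (z - w)) *s ((\<Sum>j\<in>I. d j *s (T1 j i * Y i j)) * S k l)"
      by (simp add: U_def scale_sum_right sum_distrib_right mult_ac)
    also have "(\<Sum>j\<in>I. d j *s (T1 j i * Y i j)) = d i *s \<zeta>"
      using \<zeta>[OF I(1) I(1)] by simp
    finally have "(a * \<Delta> z w) *s X = (a' * \<Delta> z' w') *s ((z1 - w) * (z - w)) *s (d i *s \<zeta> * S k l)" .
    then have "a1 *s ((a * \<Delta> z w) *s X) = a1 *s ((a' * \<Delta> z' w') *s ((z1 - w) * (z - w)) *s (d i *s \<zeta> * S k l))"
      by (rule arg_cong)
    then show ?thesis by (simp add: mult_ac)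
  qed
  ultimately show ?thesis by simp
qed

text \<open>Multiplying R T_1 S_2 = S_2 T_1 R by the inverse of S_2 from both sides gives Y_2 R T_1
  = T_1 R Y_2, here in entries.\<close>

lemma RTT_mult_inverse:
  assumes R: "RTT 1 z w 1 z w T S" and Y: "mat_inverse I S Y"
    and I: "i \<in> I" "m \<in> I" "p \<in> I" "r \<in> I"
  shows "A z w i r *s (Y p r * T i m) + (if i = r then \<Sum>k\<in>I. B z w i k *s (Y p k * T k m) else 0) =
    A z w m p *s (T i m * Y p r) + (if p = m then \<Sum>l\<in>I. B z w l m *s (T i l * Y l r) else 0)" (is "?l = ?r")
proof -
  have YS: "(\<Sum>k\<in>I. Y p k * (S k l * x)) = (if p = l then x else 0)" if "l \<in> I" for l x
    using Y I that by (simp add: mat_inverse_iff mult.assoc[symmetric] flip: sum_distrib_right)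
  have SY: "(\<Sum>l\<in>I. x * (S k l * Y l r)) = (if k = r then x else 0)" if "k \<in> I" for k x
    using Y I that by (simp add: mat_inverse_iff flip: sum_distrib_left)
  have "?l =
     (\<Sum>k\<in>I. A z w i k *s (if k = r then Y p k * T i m else 0) + B z w i k *s (if i = r then Y p k * T k m else 0))"
    using I by (simp add: scale_if sum.distrib)
  also have "\<dots> = (\<Sum>k\<in>I. A z w i k *s (\<Sum>l\<in>I. Y p k * T i m * (S k l * Y l r))
      + B z w i k *s (\<Sum>l\<in>I. Y p k * T k m * (S i l * Y l r)))"
    using I by (intro sum.cong refl) (simp add: SY del: One_nat_def)
  also have "\<dots> = (\<Sum>k\<in>I. \<Sum>l\<in>I. Y p k * (1 *s (A z w i k *s (T i m * S k l) + B z w i k *s (T k m * S i l))) * Y l r)"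
    by (simp add: scale_sum_right scale_right_distrib sum.distrib distrib_left distrib_right mult.assoc)
  also have "\<dots> = (\<Sum>k\<in>I. \<Sum>l\<in>I. Y p k * (1 *s (A z w m l *s (S k l * T i m) + B z w l m *s (S k m * T i l))) * Y l r)"
    using R I unfolding RTT_def by (intro sum.cong refl) (simp only:)
  also have "\<dots> = (\<Sum>l\<in>I. \<Sum>k\<in>I. Y p k * (1 *s (A z w m l *s (S k l * T i m) + B z w l m *s (S k m * T i l))) * Y l r)"
    by (rule sum.swap)
  also have "\<dots> = (\<Sum>l\<in>I. A z w m l *s (\<Sum>k\<in>I. Y p k * (S k l * (T i m * Y l r)))
      + B z w l m *s (\<Sum>k\<in>I. Y p k * (S k m * (T i l * Y l r))))"
    by (simp add: scale_sum_right scale_right_distrib sum.distrib distrib_left distrib_right mult.assoc)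
  also have "\<dots> = (\<Sum>l\<in>I. A z w m l *s (if p = l then T i m * Y l r else 0) + B z w l m *s (if p = m then T i l * Y l r else 0))"
    using I by (intro sum.cong refl) (simp add: YS del: One_nat_def)
  also have "\<dots> = ?r"
    using I by (simp add: scale_if sum.distrib)
  finally show ?thesis .
qed

text \<open>In \<open>RTT_mult_inverse\<close> put r = i and sum over i with weights d i. One side
  vanishes by \<open>kernel\<close>, so the other says that the matrix X below is itself annihilated
  by the transposed R. Its off-diagonal entries are annihilated by the unit
  \<open>\<theta> m p * (\<pi> n - 1)\<close>, and its diagonal is determined by one entry.\<close>

lemma twisted_product_scalar:
  assumes R: "RTT 1 (\<pi> n) 1 1 (\<pi> n) 1 T S" and Y: "mat_inverse I S Y" and u: "u * (\<pi> n - 1) = 1"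
  shows "\<exists>\<zeta>. \<forall>m\<in>I. \<forall>p\<in>I. (\<Sum>i\<in>I. d i *s (T i m * Y p i)) = (if m = p then d m *s \<zeta> else 0)"
proof -
  let ?A = "A (\<pi> n) 1" and ?B = "B (\<pi> n) 1"
  define X where "X p m = (\<Sum>i\<in>I. d i *s (T i m * Y p i))" for p m
  have *: "?A m p *s X p m + (if p = m then \<Sum>l\<in>I. ?B l m *s X l l else 0) = 0"
    if mp: "m \<in> I" "p \<in> I" for m p
  proof -
    have "(\<Sum>i\<in>I. d i *s (?A m p *s (T i m * Y p i) + (if p = m then \<Sum>l\<in>I. ?B l m *s (T i l * Y l i) else 0)))
      = ?A m p *s X p m + (if p = m then \<Sum>i\<in>I. \<Sum>l\<in>I. ?B l m *s (d i *s (T i l * Y l i)) else 0)"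
      by (auto simp: X_def scale_right_distrib scale_sum_right sum.distrib mult_ac)
    also have "(\<Sum>i\<in>I. \<Sum>l\<in>I. ?B l m *s (d i *s (T i l * Y l i))) = (\<Sum>l\<in>I. ?B l m *s X l l)"
      unfolding X_def scale_sum_right by (rule sum.swap)
    finally have "?A m p *s X p m + (if p = m then \<Sum>l\<in>I. ?B l m *s X l l else 0) =
       (\<Sum>i\<in>I. d i *s (?A m p *s (T i m * Y p i) + (if p = m then \<Sum>l\<in>I. ?B l m *s (T i l * Y l i) else 0)))"
      by simp
    also have "\<dots> = (\<Sum>i\<in>I. d i *s (?A i i *s (Y p i * T i m) + (\<Sum>k\<in>I. ?B i k *s (Y p k * T k m))))"
    proof (intro sum.cong refl)
      fix i assume i: "i \<in> I"
      show "d i *s (?A m p *s (T i m * Y p i) + (if p = m then \<Sum>l\<in>I. ?B l m *s (T i l * Y l i) else 0)) =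
        d i *s (?A i i *s (Y p i * T i m) + (\<Sum>k\<in>I. ?B i k *s (Y p k * T k m)))"
        using RTT_mult_inverse[OF R Y i mp i] by (simp only: simp_thms if_True)
    qed
    also have "\<dots> = (\<Sum>i\<in>I. (d i * ?A i i) *s (Y p i * T i m)) + (\<Sum>i\<in>I. \<Sum>k\<in>I. (d i * ?B i k) *s (Y p k * T k m))"
      by (simp add: scale_right_distrib scale_sum_right sum.distrib mult_ac)
    also have "(\<Sum>i\<in>I. \<Sum>k\<in>I. (d i * ?B i k) *s (Y p k * T k m)) = (\<Sum>k\<in>I. (\<Sum>i\<in>I. d i * ?B i k) *s (Y p k * T k m))"
      unfolding scale_sum_left by (rule sum.swap)
    also have "(\<Sum>i\<in>I. (d i * ?A i i) *s (Y p i * T i m)) + \<dots> = (\<Sum>k\<in>I. 0)"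
      unfolding sum.distrib[symmetric] scale_left_distrib[symmetric]
      by (intro sum.cong refl) (simp only: kernel scale_zero_left)
    finally show ?thesis by simp
  qed
  have off: "X p m = 0" if "m \<in> I" "p \<in> I" "m \<noteq> p" for m p
  proof -
    have "(\<theta> m p * (\<pi> n - 1)) *s X p m = 0"
      using *[OF that(1,2)] that(3) by (auto simp: A_def)
    then have "(u * \<theta> p m) *s ((\<theta> m p * (\<pi> n - 1)) *s X p m) = 0"
      by (simp only: scale_zero_right)
    moreover have "(u * \<theta> p m) * (\<theta> m p * (\<pi> n - 1)) = 1"
      using arg_cong2[OF theta[of p m] u, of "(*)"] by (simp only: mult_ac mult_1)
    ultimately show ?thesis by simp
  qed
  \<comment> \<open>The normalization comes from
    \<open>d 1 * \<kappa> 1 = \<pi> 0 = 1\<close>.\<close>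
  define \<zeta> where "\<zeta> = \<kappa> 1 *s X 1 1"
  have diag: "X m m = d m *s \<zeta>" if "m \<in> I" for m
  proof -
    have "1 \<le> m" "m \<le> n" using that by auto
    then show ?thesis
    proof (induction m rule: dec_induct)
      case base
      then show ?case using d_kappa[of 1] by (simp add: \<zeta>_def pi_0)
    next
      case (step m)
      then have m: "m \<in> I" "Suc m \<in> I" by auto
      \<comment> \<open>B depends only on the order of its indices, so in the difference of two
        consecutive equations only l = m and l = m + 1 survive. The result is a two-term recursion
        for the diagonal.\<close>
      have "(\<Sum>l\<in>I. (?B l (Suc m) - ?B l m) *s X l l) =
          (\<Sum>l\<in>{m, Suc m}. (?B l (Suc m) - ?B l m) *s X l l)"
        using m by (intro sum.mono_neutral_right) (auto simp: B_def)
      also have "\<dots> = (\<beta> * \<pi> n) *s X m m - \<beta> *s X (Suc m) (Suc m)"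
        by (simp add: B_def scale_left_diff_distrib)
      finally have "(\<Sum>l\<in>I. ?B l (Suc m) *s X l l) - (\<Sum>l\<in>I. ?B l m *s X l l) =
          (\<beta> * \<pi> n) *s X m m - \<beta> *s X (Suc m) (Suc m)"
        by (simp add: scale_left_diff_distrib sum_subtractf)
      moreover have "(\<Sum>l\<in>I. ?B l m *s X l l) = - (?A m m *s X m m)" if "m \<in> I" for m
        using *[OF that that] by (simp add: eq_neg_iff_add_eq_0 add.commute)
      ultimately have "?A (Suc m) (Suc m) *s X (Suc m) (Suc m) - ?A m m *s X m m
         + ((\<beta> * \<pi> n) *s X m m - \<beta> *s X (Suc m) (Suc m)) = 0"
        using m by (simp add: algebra_simps del: One_nat_def)
      then have "(?A (Suc m) (Suc m) - \<beta>) *s X (Suc m) (Suc m) + (\<beta> * \<pi> n - ?A m m) *s X m m = 0"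
        by (simp add: scale_left_diff_distrib algebra_simps)
      moreover have "?A (Suc m) (Suc m) - \<beta> = \<kappa> (Suc m) * (\<pi> n - 1)"
        by (simp add: A_def beta[OF m(2)] algebra_simps)
      moreover have "\<beta> * \<pi> n - ?A m m = - (\<kappa>' m * (\<pi> n - 1))"
        by (simp add: A_def beta[OF m(1)] algebra_simps)
      ultimately have "(\<kappa> (Suc m) * (\<pi> n - 1)) *s X (Suc m) (Suc m) = (\<kappa>' m * (\<pi> n - 1)) *s X m m"
        by simp
      then have "(\<kappa>' (Suc m) * u) *s ((\<kappa> (Suc m) * (\<pi> n - 1)) *s X (Suc m) (Suc m)) =
          (\<kappa>' (Suc m) * u) *s ((\<kappa>' m * (\<pi> n - 1)) *s X m m)"
        by (rule arg_cong)
      moreover have "(\<kappa>' (Suc m) * u) * (\<kappa> (Suc m) * (\<pi> n - 1)) = 1"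
        using arg_cong2[OF kappa_inverse[OF m(2)] u, of "(*)"] by (simp only: mult_ac mult_1)
      moreover have "(\<kappa>' (Suc m) * u) * (\<kappa>' m * (\<pi> n - 1)) = \<kappa>' (Suc m) * \<kappa>' m"
        using arg_cong[OF u, of "(*) (\<kappa>' (Suc m) * \<kappa>' m)"] by (simp only: mult_ac mult_1_right mult_1)
      ultimately have "X (Suc m) (Suc m) = (\<kappa>' (Suc m) * \<kappa>' m) *s X m m"
        by (simp only: scale_scale scale_one)
      also have "\<dots> = (\<kappa>' (Suc m) * \<kappa>' m * d m) *s \<zeta>"
        using step by simp
      also have "\<kappa>' (Suc m) * \<kappa>' m * d m = d (Suc m) * (\<kappa> (Suc m) * \<kappa>' (Suc m))"
        using arg_cong[OF d_kappa'[OF m(1)], of "(*) (\<kappa>' (Suc m))"]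
          arg_cong[OF d_kappa[OF m(2)], of "(*) (\<kappa>' (Suc m))"] by (simp add: mult_ac)
      finally show ?case by (simp only: kappa_inverse[OF m(2)] mult_1_right)
    qed
  qed
  show ?thesis
    using off diag by (intro exI[of _ \<zeta>]) (auto simp: X_def simp del: One_nat_def)
qed

end

section \<open>Central elements\<close>

lemma centerI: "(\<And>y. x * y = y * x) \<Longrightarrow> x \<in> center"
  by (simp add: center_def)

lemma centerD: "x \<in> center \<Longrightarrow> x * y = y * x"
  by (simp add: center_def)

lemma center_0: "0 \<in> center" and center_1: "1 \<in> center"
  by (simp_all add: center_def)

lemma center_add: "x \<in> center \<Longrightarrow> y \<in> center \<Longrightarrow> x + y \<in> center"
  by (rule centerI) (simp only: distrib_left distrib_right centerD[of x] centerD[of y])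

lemma center_uminus: "x \<in> center \<Longrightarrow> - x \<in> center"
  by (rule centerI) (simp only: centerD[of x] mult_minus_left mult_minus_right)

lemma center_mult:
  assumes "x \<in> center" "y \<in> center"
  shows "x * y \<in> center"
proof (rule centerI)
  fix b
  have "x * y * b = x * (b * y)" unfolding mult.assoc centerD[OF assms(2)] ..
  also have "\<dots> = b * x * y" unfolding mult.assoc[symmetric] centerD[OF assms(1), of b] ..
  finally show "x * y * b = b * (x * y)" by (simp only: mult.assoc)
qed

lemma center_power: "x \<in> center \<Longrightarrow> x ^ n \<in> center"
  by (induction n) (simp_all add: center_1 center_mult)

lemma center_fps:
  assumes "\<And>n. fps_nth f n \<in> center"
  shows "f \<in> center"
proof (rule centerI, rule fps_ext)
  fix g n
  have "fps_nth (f * g) n = (\<Sum>i=0..n. fps_nth g (n - i) * fps_nth f i)"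
    unfolding fps_mult_nth by (rule sum.cong[OF refl centerD[OF assms]])
  also have "\<dots> = (\<Sum>i=0..n. fps_nth g i * fps_nth f (n - i))"
    by (rule sum.reindex_bij_witness[of _ "\<lambda>s. n - s" "\<lambda>s. n - s"]) auto
  finally show "fps_nth (f * g) n = fps_nth (g * f) n" by (simp add: fps_mult_nth)
qed

lemma center_fps_const: "x \<in> center \<Longrightarrow> fps_const x \<in> center"
  by (rule center_fps) (simp add: center_0)

lemma center_fps_X: "fps_X \<in> center"
  by (rule center_fps) (simp add: fps_X_def center_0 center_1)

text \<open>The center as a commutative ring, in which both the formal variables and
  \<open>q^c\<close> can serve as scalars of the RTT argument.\<close>

typedef (overloaded) ('b::ring_1) cen = "center :: 'b set"
  morphisms of_cen to_cen
  using center_0 by blast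

instantiation cen :: (ring_1) comm_ring_1
begin

definition "0 = to_cen 0"
definition "1 = to_cen 1"
definition "x + y = to_cen (of_cen x + of_cen y)"
definition "- x = to_cen (- of_cen x)"
definition "x - y = to_cen (of_cen x - of_cen y)"
definition "x * y = to_cen (of_cen x * of_cen y)"

lemma of_cen_0: "of_cen (0 :: 'a cen) = 0"
  unfolding zero_cen_def by (rule to_cen_inverse[OF center_0])

lemma of_cen_1: "of_cen (1 :: 'a cen) = 1"
  unfolding one_cen_def by (rule to_cen_inverse[OF center_1])

lemma of_cen_add: "of_cen (x + y :: 'a cen) = of_cen x + of_cen y"
  unfolding plus_cen_def by (rule to_cen_inverse[OF center_add[OF of_cen of_cen]])

lemma of_cen_uminus: "of_cen (- x :: 'a cen) = - of_cen x"
  unfolding uminus_cen_def by (rule to_cen_inverse[OF center_uminus[OF of_cen]])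

lemma of_cen_diff: "of_cen (x - y :: 'a cen) = of_cen x - of_cen y"
  unfolding minus_cen_def using center_add[OF of_cen center_uminus[OF of_cen], of x y]
  by (simp add: to_cen_inverse)

lemma of_cen_mult: "of_cen (x * y :: 'a cen) = of_cen x * of_cen y"
  unfolding times_cen_def by (rule to_cen_inverse[OF center_mult[OF of_cen of_cen]])

lemmas of_cen_simps = of_cen_0 of_cen_1 of_cen_add of_cen_uminus of_cen_diff of_cen_mult

instance
proof
  fix a b :: "'a cen"
  show "a * b = b * a"
    by (simp add: times_cen_def centerD[OF of_cen, of a "of_cen b"])
qed (simp_all add: of_cen_inject[symmetric] of_cen_simps algebra_simps)

end

interpretation cen: central_hom of_cen
  by standard (rule of_cen_simps centerD[OF of_cen])+

section \<open>Change of scalars\<close>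

locale ring_hom =
  fixes \<phi> :: "'c::comm_ring_1 \<Rightarrow> 'd::comm_ring_1"
  assumes hom_add: "\<phi> (x + y) = \<phi> x + \<phi> y"
    and hom_mult: "\<phi> (x * y) = \<phi> x * \<phi> y"
    and hom_1: "\<phi> 1 = 1"
begin

sublocale additive \<phi> by standard (rule hom_add)

lemmas hom_simps = hom_add hom_mult hom_1 zero minus diff

lemma hom_power: "\<phi> (x ^ n) = \<phi> x ^ n"
  by (induction n) (simp_all add: hom_simps)

end

lemma ring_hom_fps_const: "ring_hom (fps_const :: 'k::comm_ring_1 \<Rightarrow> 'k fps)"
  by standard simp_all

lemma rtt_scalars_hom:
  assumes "rtt_scalars n \<kappa> \<kappa>' d \<pi> \<theta> \<beta>" "ring_hom \<phi>"
  shows "rtt_scalars n (\<lambda>i. \<phi> (\<kappa> i)) (\<lambda>i. \<phi> (\<kappa>' i)) (\<lambda>i. \<phi> (d i)) (\<lambda>i. \<phi> (\<pi> i)) (\<lambda>i k. \<phi> (\<theta> i k)) (\<phi> \<beta>)"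
proof -
  interpret rtt_scalars n \<kappa> \<kappa>' d \<pi> \<theta> \<beta> by fact
  interpret ring_hom \<phi> by fact
  show ?thesis
  proof
    fix i k assume i: "i \<in> {1..n}"
    show "\<phi> (\<kappa> i) * \<phi> (\<kappa>' i) = 1" "\<phi> \<beta> = \<phi> (\<kappa> i) - \<phi> (\<kappa>' i)" "\<phi> (d i) * \<phi> (\<kappa> i) = \<phi> (\<pi> (i - 1))"
      "\<phi> (d i) * \<phi> (\<kappa>' i) = \<phi> (\<pi> i)"
      using kappa_inverse[OF i] beta[OF i] d_kappa[OF i] d_kappa'[OF i]
      by (simp_all add: hom_1 flip: hom_mult diff)
  qed (simp_all add: pi_0 theta hom_1 flip: hom_mult)
qed

context rtt_scalars
begin

lemma A_scale: "A (u * z) (u * w) i k = u * A z w i k"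
  and B_scale: "B (u * z) (u * w) i k = u * B z w i k"
  by (auto simp: A_def B_def algebra_simps)

lemma
  assumes "ring_hom \<phi>"
  shows A_hom: "rtt_scalars.A (\<lambda>i. \<phi> (\<kappa> i)) (\<lambda>i. \<phi> (\<kappa>' i)) (\<lambda>i k. \<phi> (\<theta> i k)) (\<phi> z) (\<phi> w) i k = \<phi> (A z w i k)"
    and B_hom: "rtt_scalars.B (\<phi> \<beta>) (\<phi> z) (\<phi> w) i k = \<phi> (B z w i k)"
    and Delta_hom: "rtt_scalars.\<Delta> (\<phi> \<beta>) (\<phi> z) (\<phi> w) = \<phi> (\<Delta> z w)"
proof -
  interpret ring_hom \<phi> by fact
  interpret h: rtt_scalars n "\<lambda>i. \<phi> (\<kappa> i)" "\<lambda>i. \<phi> (\<kappa>' i)" "\<lambda>i. \<phi> (d i)" "\<lambda>i. \<phi> (\<pi> i)" "\<lambda>i k. \<phi> (\<theta> i k)" "\<phi> \<beta>"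
    by (rule rtt_scalars_hom) unfold_locales
  show "h.A (\<phi> z) (\<phi> w) i k = \<phi> (A z w i k)" by (simp add: h.A_def A_def hom_simps)
  show "h.B (\<phi> z) (\<phi> w) i k = \<phi> (B z w i k)" by (simp add: h.B_def B_def hom_simps)
  show "h.\<Delta> (\<phi> z) (\<phi> w) = \<phi> (\<Delta> z w)" by (simp add: h.\<Delta>_def \<Delta>_def hom_simps hom_power)
qed

end

context rtt_algebra
begin

text \<open>R(z, w) is homogeneous of degree one, so a common factor of both pairs of arguments can
  be inserted.\<close>

lemma RTT_scale:
  assumes "RTT a z w a' z' w' T S"
  shows "RTT a (u * z) (u * w) a' (u * z') (u * w') T S"
  unfolding RTT_def
proof (intro ballI, goal_cases)
  case I: (1 i m k l)
  have "u *s (a *s (A z w i k *s (T i m * S k l) + B z w i k *s (T k m * S i l))) =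
     u *s (a' *s (A z' w' m l *s (S k l * T i m) + B z' w' l m *s (S k m * T i l)))"
    using assms I by (simp add: RTT_def del: scale_scale)
  then show ?case
    by (simp add: A_scale B_scale scale_right_distrib mult_ac)
qed

text \<open>The second of the two identities follows from the first, because \<open>\<zeta>\<close> is central.\<close>
lemma twisted_product_swap:
  assumes \<zeta>: "\<And>m p. m \<in> I \<Longrightarrow> p \<in> I \<Longrightarrow> (\<Sum>i\<in>I. d i *s (T i m * Y p i)) = (if m = p then d m *s \<zeta> else 0)"
    and e: "\<And>i. i \<in> I \<Longrightarrow> d i * e i = 1"
    and comm: "\<And>i m. i \<in> I \<Longrightarrow> m \<in> I \<Longrightarrow> \<zeta> * T i m = T i m * \<zeta>"
    and inv: "mat_inverse I (\<lambda>i m. T m i) C"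
    and I: "p \<in> I" "m \<in> I"
  shows "(\<Sum>i\<in>I. e i *s (Y i p * T m i)) = (if m = p then e m *s \<zeta> else 0)"
proof -
  \<comment> \<open>The first identity reads M N = \<zeta>, so N = C \<zeta> and N M = C \<zeta> M =
    C M \<zeta> = \<zeta>. The inverse C of the transpose is a separate datum, as it is not the
    transpose of Y over a noncommutative ring.\<close>
  let ?M = "\<lambda>m i. T i m" and ?N = "\<lambda>i p. (d i * e p) *s Y p i"
  have fin: "finite I" by simp
  have N: "?N i p = C i p * \<zeta>" if ip: "i \<in> I" "p \<in> I" for i p
  proof -
    have MN: "mat_mult I ?M ?N m p = (if m = p then \<zeta> else 0)" if "m \<in> I" "p \<in> I" for m p
    proof -
      have "mat_mult I ?M ?N m p = e p *s (\<Sum>i\<in>I. d i *s (T i m * Y p i))"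
        by (simp add: mat_mult_def scale_sum_right mult_ac)
      also have "\<dots> = (if m = p then (d p * e p) *s \<zeta> else 0)"
        using \<zeta>[OF that] by (simp add: mult_ac)
      finally show ?thesis using e[OF that(2)] by simp
    qed
    have "?N i p = mat_mult I (mat_mult I C ?M) ?N i p"
      using inv ip mat_mult_cong[of I "mat_mult I C ?M" i mat_unit ?N p ?N] mat_mult_unit_left[OF fin ip(1), of ?N p]
      by (simp add: mat_inverse_def)
    also have "\<dots> = mat_mult I C (\<lambda>m p. if m = p then \<zeta> else 0) i p"
      unfolding mat_mult_assoc using MN ip by (intro mat_mult_cong) auto
    also have "\<dots> = C i p * \<zeta>"
      using ip by (simp add: mat_mult_def if_distrib[of "\<lambda>x. _ * x"] cong: if_cong)
    finally show ?thesis .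
  qed
  have "(\<Sum>i\<in>I. e i *s (Y i p * T m i)) = e m *s (e p *s (\<Sum>i\<in>I. (d p * d m) *s (e i *s (Y i p * T m i))))"
  proof -
    have "e m * (e p * (d p * d m * x)) = x" for x
      using arg_cong2[OF e[OF I(1)] e[OF I(2)], of "\<lambda>a b. a * b * x"] by (simp add: mult_ac)
    then show ?thesis by (simp add: scale_sum_right)
  qed
  also have "(\<Sum>i\<in>I. (d p * d m) *s (e i *s (Y i p * T m i))) = d m *s (\<Sum>i\<in>I. ?N p i * T m i)"
    by (simp add: scale_sum_right mult_ac)
  also have "(\<Sum>i\<in>I. ?N p i * T m i) = (\<Sum>i\<in>I. C p i * \<zeta> * T m i)"
    using N I by (intro sum.cong refl) simp
  also have "\<dots> = mat_mult I C ?M p m * \<zeta>"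
    using comm I by (simp add: mat_mult_def sum_distrib_right mult.assoc)
  also have "\<dots> = (if m = p then \<zeta> else 0)"
    using inv I by (auto simp: mat_inverse_def mat_unit_def)
  finally show ?thesis
    using arg_cong[OF e[OF I(2)], of "\<lambda>x. x * e m"] by (auto simp: mult_ac)
qed

end

section \<open>RTT relations for formal power series\<close>

context rtt_algebra
begin

definition defect :: "'c \<Rightarrow> 'c \<Rightarrow> (nat \<Rightarrow> nat \<Rightarrow> 'b) \<Rightarrow> (nat \<Rightarrow> nat \<Rightarrow> 'b) \<Rightarrow> nat \<Rightarrow> nat \<Rightarrow> nat \<Rightarrow> nat \<Rightarrow> 'b" where
  "defect z w T S i m k l = A z w i k *s (T i m * S k l) + B z w i k *s (T k m * S i l)
     - (A z w m l *s (S k l * T i m) + B z w l m *s (S k m * T i l))"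

lemma RTT_iff_defect:
  "RTT 1 z w 1 z w T S \<longleftrightarrow> (\<forall>i\<in>I. \<forall>m\<in>I. \<forall>k\<in>I. \<forall>l\<in>I. defect z w T S i m k l = 0)"
  by (simp add: RTT_def defect_def)

text \<open>Since R is linear in the pair (z, w), a relation whose arguments are linear forms in the
  variables is a combination of two defects with scalar arguments.\<close>

lemma defect_linear: "defect (z + c * z') (w + c * w') T S i m k l = defect z w T S i m k l + c *s defect z' w' T S i m k l"
proof -
  have "A (z + c * z') (w + c * w') i k = A z w i k + c * A z' w' i k"
    "B (z + c * z') (w + c * w') i k = B z w i k + c * B z' w' i k" for i k
    by (auto simp: A_def B_def algebra_simps)
  then show ?thesis by (simp add: defect_def algebra_simps scale_right_diff_distrib)
qed

end

locale rtt_series = rtt_algebra n \<kappa> \<kappa>' d \<pi> \<theta> \<beta> \<iota>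
  for n and \<kappa> \<kappa>' d \<pi> :: "nat \<Rightarrow> 'k::field" and \<theta> \<beta> and \<iota> :: "'k \<Rightarrow> 'a::ring_1"
begin

notation scale (infixr "*s" 75)

lemma iota_center: "\<iota> c \<in> center"
  by (rule centerI) (rule h_central)

lemma iota_0: "\<iota> 0 = 0"
  using h_add[of 0 0] by simp

definition fscale :: "'k \<Rightarrow> 'a fps \<Rightarrow> 'a fps" where
  "fscale c f = Abs_fps (\<lambda>r. c ^ r *s fps_nth f r)"

lemma fscale_nth [simp]: "fps_nth (fscale c f) r = c ^ r *s fps_nth f r"
  by (simp add: fscale_def)

lemma fscale_1 [simp]: "fscale 1 f = f"
  by (rule fps_ext) simp

sublocale uni: rtt_algebra n \<kappa> \<kappa>' d \<pi> \<theta> \<beta> "\<lambda>c. fps_const (\<iota> c)"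
proof -
  interpret u: central_hom "\<lambda>c. fps_const (\<iota> c)"
  proof
    fix c :: 'k and b :: "'a fps"
    show "fps_const (\<iota> c) * b = b * fps_const (\<iota> c)"
      by (rule centerD[OF center_fps_const[OF iota_center]])
  qed (simp_all add: h_add h_mult h_1 flip: fps_const_add fps_const_mult)
  show "rtt_algebra n \<kappa> \<kappa>' d \<pi> \<theta> \<beta> (\<lambda>c. fps_const (\<iota> c))"
    by unfold_locales
qed

lemma uni_scale_nth [simp]: "fps_nth (uni.scale c f) r = c *s fps_nth f r"
  by (simp add: uni.scale_def scale_def)

text \<open>The coefficients of the relation with \<open>R(z1 q + z2 p, w1 q + w2 p)\<close>, \<open>T(p)\<close> and \<open>S(q)\<close>, for variables \<open>p\<close> and \<open>q\<close>.\<close>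
definition rll_coeffs :: "'k \<Rightarrow> 'k \<Rightarrow> 'k \<Rightarrow> 'k \<Rightarrow> (nat \<Rightarrow> nat \<Rightarrow> 'a fps) \<Rightarrow> (nat \<Rightarrow> nat \<Rightarrow> 'a fps) \<Rightarrow> bool" where
  "rll_coeffs z1 w1 z2 w2 T S \<longleftrightarrow> (\<forall>i\<in>I. \<forall>m\<in>I. \<forall>k\<in>I. \<forall>l\<in>I. \<forall>a b.
     (if b = 0 then 0 else defect z1 w1 (\<lambda>i m. T i m $ a) (\<lambda>k l. S k l $ (b - 1)) i m k l) +
     (if a = 0 then 0 else defect z2 w2 (\<lambda>i m. T i m $ (a - 1)) (\<lambda>k l. S k l $ b) i m k l) = 0)"

text \<open>This is the specialization p = c q. In each degree it is a finite sum over a + b, and R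
  contributes a factor q that is common to both sides and dropped; hence the relations of total
  degree \<open>Suc r\<close> give the coefficient of order r.\<close>

lemma rll_coeffs_univariate:
  assumes R: "rll_coeffs z1 w1 z2 w2 T S"
  shows "uni.RTT 1 (z1 + c * z2) (w1 + c * w2) 1 (z1 + c * z2) (w1 + c * w2) (\<lambda>i m. fscale c (T i m)) S"
  unfolding uni.RTT_iff_defect
proof (intro ballI)
  fix i m k l assume I: "i \<in> I" "m \<in> I" "k \<in> I" "l \<in> I"
  let ?D = "\<lambda>z w a b. defect z w (\<lambda>i m. T i m $ a) (\<lambda>k l. S k l $ b) i m k l"
  have ST: "fps_nth (S k l * fscale c (T i m)) r = (\<Sum>a=0..r. c ^ a *s (S k l $ (r - a) * T i m $ a))" for i m k l r
    unfolding fps_mult_nth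
    by (rule sum.reindex_bij_witness[of _ "\<lambda>s. r - s" "\<lambda>s. r - s"]) auto
  have TS: "fps_nth (fscale c (T i m) * S k l) r = (\<Sum>a=0..r. c ^ a *s (T i m $ a * S k l $ (r - a)))" for i m k l r
    unfolding fps_mult_nth by simp
  have D: "fps_nth (uni.defect z w (\<lambda>i m. fscale c (T i m)) S i m k l) r = (\<Sum>a=0..r. c ^ a *s ?D z w a (r - a))" for z w r
    by (simp add: uni.defect_def defect_def ST TS scale_sum_right sum.distrib sum_subtractf scale_right_distrib
        scale_right_diff_distrib mult_ac)
  show "uni.defect (z1 + c * z2) (w1 + c * w2) (\<lambda>i m. fscale c (T i m)) S i m k l = 0"
  proof (rule fps_ext)
    fix r
    have "0 = (\<Sum>a=0..Suc r. c ^ a *s ((if Suc r - a = 0 then 0 else ?D z1 w1 a (Suc r - a - 1)) +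
        (if a = 0 then 0 else ?D z2 w2 (a - 1) (Suc r - a))))"
      by (simp only: R[unfolded rll_coeffs_def, rule_format, OF I] scale_zero_right sum.neutral_const)
    also have "\<dots> = (\<Sum>a=0..Suc r. c ^ a *s (if Suc r - a = 0 then 0 else ?D z1 w1 a (Suc r - a - 1))) +
       (\<Sum>a=0..Suc r. c ^ a *s (if a = 0 then 0 else ?D z2 w2 (a - 1) (Suc r - a)))"
      by (simp only: scale_right_distrib sum.distrib)
    also have "(\<Sum>a=0..Suc r. c ^ a *s (if Suc r - a = 0 then 0 else ?D z1 w1 a (Suc r - a - 1))) =
        (\<Sum>a=0..r. c ^ a *s ?D z1 w1 a (r - a))"
      by (simp add: Suc_diff_le cong: sum.cong_simp)
    also have "(\<Sum>a=0..Suc r. c ^ a *s (if a = 0 then 0 else ?D z2 w2 (a - 1) (Suc r - a))) =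
        c *s (\<Sum>a=0..r. c ^ a *s ?D z2 w2 a (r - a))"
      by (subst sum.atLeast0_atMost_Suc_shift) (simp add: scale_sum_right)
    finally show "fps_nth (uni.defect (z1 + c * z2) (w1 + c * w2) (\<lambda>i m. fscale c (T i m)) S i m k l) r = fps_nth 0 r"
      by (simp add: uni.defect_linear D)
  qed
qed

text \<open>In series over series the outer variable is p and the inner one is q. A series f becomes
  f(p) by \<open>outer\<close> and f(q) by \<open>fps_const\<close>, which makes the two variables
  independent.\<close>

definition outer :: "'a fps \<Rightarrow> 'a fps fps" where
  "outer f = Abs_fps (\<lambda>r. fps_const (fps_nth f r))"

lemma outer_nth [simp]: "fps_nth (outer f) r = fps_const (fps_nth f r)"
  by (simp add: outer_def)

lemma outer_inner_nth [simp]: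
  "fps_nth (fps_nth (outer f * fps_const g) a) b = fps_nth f a * fps_nth g b"
  "fps_nth (fps_nth (fps_const g * outer f) a) b = fps_nth g b * fps_nth f a"
  by simp_all

lemma outer_simps: "outer (f + g) = outer f + outer g" "outer (f * g) = outer f * outer g" "outer 0 = 0" "outer 1 = 1"
proof -
  show "outer (f * g) = outer f * outer g"
    by (rule fps_ext, rule fps_ext) (simp add: fps_mult_nth fps_sum_nth)
qed (rule fps_ext, simp)+

definition K :: "'k \<Rightarrow> 'a fps fps cen" where
  "K c = to_cen (fps_const (fps_const (\<iota> c)))"

lemma of_K: "of_cen (K c) = fps_const (fps_const (\<iota> c))"
  unfolding K_def by (intro to_cen_inverse center_fps_const iota_center)

sublocale K: ring_hom K
  by standard (simp_all add: of_cen_inject[symmetric] of_cen_simps of_K h_add h_mult h_1)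

definition P :: "'a fps fps cen" where "P = to_cen fps_X"
definition Q :: "'a fps fps cen" where "Q = to_cen (fps_const fps_X)"

lemma of_P: "of_cen P = fps_X" and of_Q: "of_cen Q = fps_const fps_X"
  unfolding P_def Q_def by (intro to_cen_inverse center_fps_const center_fps_X)+

sublocale bi: rtt_algebra n "\<lambda>i. K (\<kappa> i)" "\<lambda>i. K (\<kappa>' i)" "\<lambda>i. K (d i)" "\<lambda>i. K (\<pi> i)" "\<lambda>i k. K (\<theta> i k)" "K \<beta>" of_cen
proof -
  interpret b: rtt_scalars n "\<lambda>i. K (\<kappa> i)" "\<lambda>i. K (\<kappa>' i)" "\<lambda>i. K (d i)" "\<lambda>i. K (\<pi> i)" "\<lambda>i k. K (\<theta> i k)" "K \<beta>"
    by (rule rtt_scalars_hom) unfold_locales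
  show "rtt_algebra n (\<lambda>i. K (\<kappa> i)) (\<lambda>i. K (\<kappa>' i)) (\<lambda>i. K (d i)) (\<lambda>i. K (\<pi> i)) (\<lambda>i k. K (\<theta> i k)) (K \<beta>) of_cen"
    by unfold_locales
qed

lemma rll_coeffs_bivariate:
  fixes c
  assumes R: "rll_coeffs z1 w1 z2 w2 T S"
  defines "z \<equiv> K z1 * Q + K (c * z2) * P" and "w \<equiv> K w1 * Q + K (c * w2) * P"
  shows "bi.RTT 1 z w 1 z w (\<lambda>i m. outer (fscale c (T i m))) (\<lambda>k l. fps_const (S k l))"
  unfolding bi.RTT_iff_defect
proof (intro ballI, goal_cases)
  case I: (1 i m k l)
  have A: "bi.A z w i k = K (A z1 w1 i k) * Q + K (c * A z2 w2 i k) * P" for i k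
    by (auto simp: A_def bi.A_def z_def w_def K.hom_simps algebra_simps)
  have B: "bi.B z w i k = K (B z1 w1 i k) * Q + K (c * B z2 w2 i k) * P" for i k
    by (auto simp: B_def bi.B_def z_def w_def K.hom_simps algebra_simps)
  have nth: "fps_nth (fps_nth (cen.scale (K x * Q + K (c * y) * P) F) a) b =
     (if b = 0 then 0 else x *s fps_nth (fps_nth F a) (b - 1)) +
     (if a = 0 then 0 else c *s (y *s fps_nth (fps_nth F (a - 1)) b))" for x y F a b
    by (simp add: cen.scale_def of_cen_simps of_K of_P of_Q scale_def h_mult distrib_right mult.assoc)
  show ?case
  proof (intro fps_ext, goal_cases)
    case (1 a b)
    let ?D = "\<lambda>z w a b. defect z w (\<lambda>i m. T i m $ a) (\<lambda>k l. S k l $ b) i m k l"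
    have "fps_nth (fps_nth (bi.defect z w (\<lambda>i m. outer (fscale c (T i m))) (\<lambda>k l. fps_const (S k l)) i m k l) a) b =
      c ^ a *s ((if b = 0 then 0 else ?D z1 w1 a (b - 1)) + (if a = 0 then 0 else ?D z2 w2 (a - 1) b))"
      unfolding bi.defect_def A B fps_sub_nth fps_add_nth nth outer_inner_nth
      by (cases a; simp add: defect_def scale_right_distrib scale_right_diff_distrib mult_ac)
    then show ?case
      using R I by (simp add: rll_coeffs_def)
  qed
qed


lemma outer_sum: "outer (sum f J) = (\<Sum>j\<in>J. outer (f j))"
  by (induction J rule: infinite_finite_induct) (simp_all add: outer_simps)

lemma outer_scale: "outer (uni.scale c f) = cen.scale (K c) (outer f)"
  by (rule fps_ext) (simp add: cen.scale_def of_K scale_def)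

lemma inner_sum: "fps_const (sum f J) = (\<Sum>j\<in>J. fps_const (f j :: 'a fps))"
  by (induction J rule: infinite_finite_induct) (simp_all flip: fps_const_add)

lemma inner_scale: "fps_const (uni.scale c f) = cen.scale (K c) (fps_const f)"
  by (simp add: cen.scale_def of_K uni.scale_def)

text \<open>The substitution of the central series \<open>g p q\<close>, where \<open>p\<close> is the outer and \<open>q\<close> the inner variable.\<close>
definition subst :: "'a \<Rightarrow> 'k fps \<Rightarrow> 'a fps fps cen" where
  "subst g x = to_cen (Abs_fps (\<lambda>a. fps_const (\<iota> (fps_nth x a) * g ^ a) * fps_X ^ a))"

lemma of_subst: "g \<in> center \<Longrightarrow> of_cen (subst g x) = Abs_fps (\<lambda>a. fps_const (\<iota> (fps_nth x a) * g ^ a) * fps_X ^ a)"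
  unfolding subst_def
  by (intro to_cen_inverse center_fps)
    (auto simp: fps_X_power_nth intro!: center_mult iota_center center_power center_0)

lemma subst_scale_nth:
  assumes "g \<in> center"
  shows "fps_nth (fps_nth (cen.scale (subst g x) F) a) b =
    (\<Sum>r\<le>min a b. fps_nth x r *s (g ^ r * fps_nth (fps_nth F (a - r)) (b - r)))"
proof -
  have "fps_nth (fps_nth (cen.scale (subst g x) F) a) b =
     (\<Sum>r=0..a. if b < r then 0 else fps_nth x r *s (g ^ r * fps_nth (fps_nth F (a - r)) (b - r)))"
    by (simp add: cen.scale_def of_subst[OF assms] fps_mult_nth[of _ _ a] fps_sum_nth mult.assoc
        fps_X_power_mult_nth scale_def if_distrib cong: if_cong)
  also have "\<dots> = (\<Sum>r\<le>min a b. fps_nth x r *s (g ^ r * fps_nth (fps_nth F (a - r)) (b - r)))"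
    by (rule sum.mono_neutral_cong_right) auto
  finally show ?thesis .
qed

lemma ring_hom_subst:
  assumes g: "g \<in> center"
  shows "ring_hom (subst g)"
proof
  fix x y :: "'k fps"
  show "subst g (x + y) = subst g x + subst g y"
    by (simp add: of_cen_inject[symmetric] of_cen_simps of_subst[OF g] fps_eq_iff h_add distrib_right)
  show "subst g 1 = 1"
    by (simp add: of_cen_inject[symmetric] of_cen_simps of_subst[OF g] fps_eq_iff h_1 iota_0 fps_one_nth)
  have "fps_nth (fps_nth (of_cen (subst g (x * y))) a) b = fps_nth (fps_nth (of_cen (subst g x) * of_cen (subst g y)) a) b" for a b
  proof -
    have gr: "g ^ r * (\<iota> c * z) = \<iota> c * (g ^ r * z)" for r c z
      using centerD[OF center_power[OF g, of r], of "\<iota> c"] by (simp flip: mult.assoc)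
    have "fps_nth (fps_nth (of_cen (subst g x) * of_cen (subst g y)) a) b =
       (\<Sum>r\<le>min a b. fps_nth x r *s (g ^ r * (if a - r = b - r then \<iota> (fps_nth y (a - r)) * g ^ (a - r) else 0)))"
      using subst_scale_nth[OF g, of x "of_cen (subst g y)" a b]
      by (simp add: cen.scale_def of_subst[OF g, of y] fps_X_power_nth cong: if_cong) (simp add: eq_commute if_distrib cong: if_cong)
    also have "\<dots> = (if a = b then \<iota> (fps_nth (x * y) a) * g ^ a else 0)"
    proof (cases "a = b")
      case True
      have "fps_nth x r *s (g ^ r * (\<iota> (fps_nth y (a - r)) * g ^ (a - r))) = \<iota> (fps_nth x r * fps_nth y (a - r)) * g ^ a"
        if "r \<le> a" for r
        using that by (simp add: scale_def gr h_mult mult.assoc flip: power_add)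
      moreover have "\<iota> (sum f J) = (\<Sum>j\<in>J. \<iota> (f j))" for f :: "nat \<Rightarrow> 'k" and J
        by (induction J rule: infinite_finite_induct) (simp_all add: iota_0 h_add)
      ultimately show ?thesis using True
        by (simp add: fps_mult_nth sum_distrib_right atLeast0AtMost)
    next
      case False
      then have "a - r \<noteq> b - r" if "r \<le> min a b" for r using that by auto
      with False show ?thesis by (simp add: sum.neutral)
    qed
    finally show ?thesis by (simp add: of_subst[OF g] fps_X_power_nth)
  qed
  then show "subst g (x * y) = subst g x * subst g y"
    unfolding of_cen_inject[symmetric] of_cen_simps by (intro fps_ext)
qed

lemma subst_const: "g \<in> center \<Longrightarrow> subst g (fps_const c) = K c"
  unfolding of_cen_inject[symmetric] by (simp add: of_K of_subst fps_eq_iff iota_0)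

text \<open>The coefficient of p^a q^b in x(g p q) F(p, q), with F given by its
  coefficients.\<close>

definition conv :: "'a \<Rightarrow> 'k fps \<Rightarrow> (nat \<Rightarrow> nat \<Rightarrow> 'a) \<Rightarrow> nat \<Rightarrow> nat \<Rightarrow> 'a" where
  "conv g x F a b = (\<Sum>r\<le>min a b. fps_nth x r *s (g ^ r * F (a - r) (b - r)))"

sublocale ser: rtt_scalars n "\<lambda>i. fps_const (\<kappa> i)" "\<lambda>i. fps_const (\<kappa>' i)" "\<lambda>i. fps_const (d i)"
  "\<lambda>i. fps_const (\<pi> i)" "\<lambda>i k. fps_const (\<theta> i k)" "fps_const \<beta>"
  by (rule rtt_scalars_hom[OF _ ring_hom_fps_const]) unfold_locales

text \<open>For L^+(z) and L^-(w) the variables are p = z^-1 and q = w, so w/z = p q and R is a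
  power series in p q. The central elements g and g' modify this argument on the two sides.\<close>

definition rll_mixed :: "'k fps \<Rightarrow> 'a \<Rightarrow> 'a \<Rightarrow> (nat \<Rightarrow> nat \<Rightarrow> 'a fps) \<Rightarrow> (nat \<Rightarrow> nat \<Rightarrow> 'a fps) \<Rightarrow> bool" where
  "rll_mixed \<alpha> g g' T S \<longleftrightarrow> (\<forall>i\<in>I. \<forall>m\<in>I. \<forall>k\<in>I. \<forall>l\<in>I. \<forall>a b.
     conv g (\<alpha> * ser.A 1 fps_X i k) (\<lambda>a b. T i m $ a * S k l $ b) a b +
     conv g (\<alpha> * ser.B 1 fps_X i k) (\<lambda>a b. T k m $ a * S i l $ b) a b =
     conv g' (\<alpha> * ser.A 1 fps_X m l) (\<lambda>a b. S k l $ b * T i m $ a) a b +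
     conv g' (\<alpha> * ser.B 1 fps_X l m) (\<lambda>a b. S k m $ b * T i l $ a) a b)"

definition dilate :: "'k \<Rightarrow> 'k fps \<Rightarrow> 'k fps" where
  "dilate c x = x oo (fps_const c * fps_X)"

lemma dilate_nth [simp]: "fps_nth (dilate c x) r = c ^ r * fps_nth x r"
  by (simp add: dilate_def)

lemma ring_hom_dilate: "ring_hom (dilate c)"
  by standard (simp_all add: dilate_def fps_compose_add_distrib fps_compose_mult_distrib)

lemma dilate_simps: "dilate c fps_X = fps_const c * fps_X" "dilate c (fps_const x) = fps_const x"
  by (simp_all add: dilate_def)

lemma dilate_1 [simp]: "dilate 1 x = x"
  by (simp add: fps_eq_iff)

text \<open>Scaling p by c and q by e scales the argument p q of R by their product, both in the
  matrix and in its factor \<alpha>.\<close>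

lemma rll_mixed_bivariate:
  fixes c e
  assumes R: "rll_mixed \<alpha> g g' T S" and g: "g \<in> center" "g' \<in> center"
  defines "u \<equiv> fps_const (c * e) * fps_X"
  shows "bi.RTT (subst g (dilate (c * e) \<alpha>)) 1 (subst g u) (subst g' (dilate (c * e) \<alpha>)) 1 (subst g' u)
    (\<lambda>i m. outer (fscale c (T i m))) (\<lambda>k l. fps_const (fscale e (S k l)))"
  unfolding bi.RTT_def
proof (intro ballI, goal_cases)
  case I: (1 i m k l)
  interpret D: ring_hom "dilate (c * e)" by (rule ring_hom_dilate)
  have AB: "subst g (dilate (c * e) \<alpha>) * bi.A 1 (subst g u) i k = subst g (dilate (c * e) (\<alpha> * ser.A 1 fps_X i k))"
    "subst g (dilate (c * e) \<alpha>) * bi.B 1 (subst g u) i k = subst g (dilate (c * e) (\<alpha> * ser.B 1 fps_X i k))"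
    if g: "g \<in> center" for g i k
  proof -
    interpret G: ring_hom "subst g" by (rule ring_hom_subst[OF g])
    have "ser.A 1 u i k = dilate (c * e) (ser.A 1 fps_X i k)" "ser.B 1 u i k = dilate (c * e) (ser.B 1 fps_X i k)"
      by (auto simp: ser.A_def ser.B_def D.hom_simps dilate_simps u_def)
    then show "subst g (dilate (c * e) \<alpha>) * bi.A 1 (subst g u) i k = subst g (dilate (c * e) (\<alpha> * ser.A 1 fps_X i k))"
      "subst g (dilate (c * e) \<alpha>) * bi.B 1 (subst g u) i k = subst g (dilate (c * e) (\<alpha> * ser.B 1 fps_X i k))"
      using ser.A_hom[OF ring_hom_subst[OF g], of 1 u i k] ser.B_hom[OF ring_hom_subst[OF g], of 1 u i k]
      by (simp_all add: subst_const[OF g] G.hom_1 G.hom_mult D.hom_mult)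
  qed
  have sc: "c ^ r * e ^ r * c ^ (a - r) * e ^ (b - r) = c ^ a * e ^ b" if "r \<le> min a b" for r a b
  proof -
    have "c ^ r * e ^ r * c ^ (a - r) * e ^ (b - r) = (c ^ r * c ^ (a - r)) * (e ^ r * e ^ (b - r))" by (simp add: mult_ac)
    then show ?thesis using that by (simp flip: power_add)
  qed
  have nth: "fps_nth (fps_nth (cen.scale (subst g (dilate (c * e) x)) F) a) b = (c ^ a * e ^ b) *s conv g x F' a b"
    if g: "g \<in> center" and F: "\<And>a b. fps_nth (fps_nth F a) b = (c ^ a * e ^ b) *s F' a b" for g x F F' a b
  proof -
    have "(c * e) ^ r * fps_nth x r * (c ^ (a - r) * e ^ (b - r)) = c ^ a * e ^ b * fps_nth x r" if "r \<le> min a b" for r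
      unfolding sc[OF that, symmetric] by (simp add: power_mult_distrib mult_ac)
    then show ?thesis
      unfolding subst_scale_nth[OF g] conv_def F scale_sum_right
      by (intro sum.cong refl) (simp only: dilate_nth scale_mult_right scale_scale atMost_iff)
  qed
  show ?case
    unfolding cen.scale_right_distrib cen.scale_scale AB[OF g(1)] AB[OF g(2)]
  proof (intro fps_ext, goal_cases)
    case (1 a b)
    show ?case
      using R[unfolded rll_mixed_def, rule_format, OF I, of a b]
      by (simp add: nth[OF g(1), where F' = "\<lambda>a b. T _ _ $ a * S _ _ $ b"]
         nth[OF g(2), where F' = "\<lambda>a b. S _ _ $ b * T _ _ $ a"] mult_ac flip: scale_right_distrib)
  qed
qed

lemma scale_cancel: "c \<noteq> 0 \<Longrightarrow> c *s x = 0 \<longleftrightarrow> x = 0"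
  by (metis left_inverse scale_one scale_scale scale_zero_right)

text \<open>Induction on the degree in p: in the coefficient of p^a q^(b+1) the form u q + v p
  involves the wanted coefficient with the nonzero factor u, and otherwise only lower degrees in
  p.\<close>

lemma linear_cancel:
  assumes u: "u \<noteq> 0" and F: "cen.scale (K u * Q + K v * P) F = 0"
  shows "F = 0"
proof -
  have nth: "fps_nth (fps_nth (cen.scale (K u * Q + K v * P) F) a) b =
     (if b = 0 then 0 else u *s fps_nth (fps_nth F a) (b - 1)) +
     (if a = 0 then 0 else v *s fps_nth (fps_nth F (a - 1)) b)" for a b
    by (simp add: cen.scale_def of_cen_simps of_K of_P of_Q scale_def distrib_right mult.assoc)
  have "fps_nth (fps_nth F a) b = 0" for a b
  proof (induction a arbitrary: b)
    case 0
    then show ?case using nth[of 0 "Suc b"] by (simp add: F scale_cancel[OF u])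
  next
    case (Suc a)
    then show ?case using nth[of "Suc a" "Suc b"] by (simp add: F scale_cancel[OF u])
  qed
  then show ?thesis by (simp add: fps_eq_iff)
qed

end

section \<open>Cancelling scalars in two variables\<close>

context rtt_series
begin

definition cancellable :: "'a fps fps cen \<Rightarrow> bool" where
  "cancellable x \<longleftrightarrow> (\<forall>F. cen.scale x F = 0 \<longrightarrow> F = 0)"

lemma cancellableD:
  assumes "cancellable x" "cen.scale x F = cen.scale x G"
  shows "F = G"
proof -
  have "cen.scale x (F - G) = 0"
    unfolding cen.scale_right_diff_distrib assms(2) by simp
  then have "F - G = 0" using assms(1) unfolding cancellable_def by blast
  then show ?thesis by simp
qed

lemma cancellable_mult:
  assumes "cancellable x" "cancellable y"
  shows "cancellable (x * y)"
  unfolding cancellable_def cen.scale_scale[symmetric] using assms unfolding cancellable_def by blast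

lemma cancellable_linear: "u \<noteq> 0 \<Longrightarrow> cancellable (K u * Q + K v * P)"
  using linear_cancel by (auto simp: cancellable_def)

lemma cancellable_subst:
  assumes "g \<in> center" "fps_nth x 0 \<noteq> 0"
  shows "cancellable (subst g x)"
  unfolding cancellable_def
proof (intro allI impI)
  fix F assume F: "cen.scale (subst g x) F = 0"
  interpret ring_hom "subst g" by (rule ring_hom_subst) fact
  have "F = cen.scale (subst g (inverse x * x)) F"
    using inverse_mult_eq_1[OF assms(2)] by (simp add: hom_1)
  also have "\<dots> = cen.scale (subst g (inverse x)) (cen.scale (subst g x) F)"
    by (simp add: hom_mult)
  finally show "F = 0" by (simp add: F)
qed

lemma cancellable_K: "c \<noteq> 0 \<Longrightarrow> cancellable (K c)"
  using cancellable_subst[of 0 "fps_const c"] by (simp add: subst_const center_0)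

lemma outer_mat_inverse:
  assumes "mat_inverse I T Y"
  shows "mat_inverse I (\<lambda>i m. outer (T i m)) (\<lambda>i m. outer (Y i m))"
proof -
  have "(\<Sum>j\<in>I. outer (x j) * outer (y j)) = outer (\<Sum>j\<in>I. x j * y j)" for x y
    by (simp only: outer_sum outer_simps)
  then show ?thesis
    using assms by (simp add: mat_inverse_iff outer_simps del: One_nat_def)
qed

lemma inner_mat_inverse:
  fixes T Y :: "nat \<Rightarrow> nat \<Rightarrow> 'a fps"
  assumes "mat_inverse I T Y"
  shows "mat_inverse I (\<lambda>i m. fps_const (T i m)) (\<lambda>i m. fps_const (Y i m))"
proof -
  have "(\<Sum>j\<in>I. fps_const (x j * y j)) = fps_const (\<Sum>j\<in>I. x j * y j :: 'a fps)" for x y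
    by (simp only: inner_sum)
  then show ?thesis
    using assms by (simp add: mat_inverse_iff del: One_nat_def)
qed

definition twisted :: "(nat \<Rightarrow> nat \<Rightarrow> 'a fps) \<Rightarrow> (nat \<Rightarrow> nat \<Rightarrow> 'a fps) \<Rightarrow> 'a fps \<Rightarrow> bool" where
  "twisted T Y \<zeta> \<longleftrightarrow> (\<forall>m\<in>I. \<forall>p\<in>I. (\<Sum>i\<in>I. uni.scale (d i) (T i m * Y p i)) = (if m = p then uni.scale (d m) \<zeta> else 0))"

lemma outer_twisted:
  assumes "twisted T Y \<zeta>" "m \<in> I" "p \<in> I"
  shows "(\<Sum>i\<in>I. cen.scale (K (d i)) (outer (T i m) * outer (Y p i))) = (if m = p then cen.scale (K (d m)) (outer \<zeta>) else 0)"
proof -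
  have "(\<Sum>i\<in>I. cen.scale (K (d i)) (outer (T i m) * outer (Y p i))) = outer (\<Sum>i\<in>I. uni.scale (d i) (T i m * Y p i))"
    by (simp only: outer_sum outer_scale outer_simps)
  then show ?thesis using assms by (simp add: twisted_def outer_scale outer_simps del: One_nat_def)
qed

lemma inner_twisted:
  assumes "twisted T Y \<zeta>" "m \<in> I" "p \<in> I"
  shows "(\<Sum>i\<in>I. cen.scale (K (d i)) (fps_const (T i m) * fps_const (Y p i))) = (if m = p then cen.scale (K (d m)) (fps_const \<zeta>) else 0)"
proof -
  have "(\<Sum>i\<in>I. cen.scale (K (d i)) (fps_const (T i m) * fps_const (Y p i))) = fps_const (\<Sum>i\<in>I. uni.scale (d i) (T i m * Y p i))"
    by (simp only: inner_sum inner_scale fps_const_mult)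
  then show ?thesis using assms by (simp add: twisted_def inner_scale del: One_nat_def)
qed

lemma outer_inner_commute:
  assumes "fps_const g * outer f = outer f * fps_const g"
  shows "fps_nth f a * fps_nth g b = fps_nth g b * fps_nth f a"
  using arg_cong[OF assms, of "\<lambda>F. fps_nth (fps_nth F a) b"] by simp

end

section \<open>Centrality of the scalar \<zeta>\<close>

locale rtt_series_generic = rtt_series n \<kappa> \<kappa>' d \<pi> \<theta> \<beta> \<iota>
  for n and \<kappa> \<kappa>' d \<pi> :: "nat \<Rightarrow> 'k::field" and \<theta> \<beta> and \<iota> :: "'k \<Rightarrow> 'a::ring_1" +
  assumes d_nonzero: "i \<in> I \<Longrightarrow> d i \<noteq> 0" and pi_n: "\<pi> n \<noteq> 0" "\<pi> n \<noteq> 1"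
begin

lemma kappa_nonzero: "i \<in> I \<Longrightarrow> \<kappa> i \<noteq> 0" "i \<in> I \<Longrightarrow> \<kappa>' i \<noteq> 0"
  using kappa_inverse[of i] by auto

text \<open>The hypotheses on u choose c such that, up to the factor u, the relation at p = c q has
  the arguments \<open>\<pi> n\<close> and 1, at which the transposed R has its kernel.\<close>

lemma twisted_exists:
  assumes R: "rll_coeffs z1 w1 z2 w2 T T" and Y: "mat_inverse I T Y"
    and u: "u * (z1 + c * z2) = \<pi> n" "u * (w1 + c * w2) = 1"
  shows "\<exists>\<zeta>. twisted (\<lambda>i m. fscale c (T i m)) Y \<zeta>"
proof -
  have "uni.RTT 1 (\<pi> n) 1 1 (\<pi> n) 1 (\<lambda>i m. fscale c (T i m)) T"
    using uni.RTT_scale[OF rll_coeffs_univariate[OF R, of c], of u] by (simp add: u)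
  from uni.twisted_product_scalar[OF this Y, of "inverse (\<pi> n - 1)"]
  show ?thesis using pi_n by (auto simp: twisted_def)
qed

text \<open>The hypotheses on u and c say that scaling p by c replaces z by
  \<open>\<pi> n * z\<close> and keeps w, up to the common factor u. The two scalars of
  \<open>sandwich\<close> then agree. Up to a nonzero constant they are products of linear forms in
  p and q with nonzero coefficient of q, and can be cancelled.\<close>

lemma twisted_commute_same:
  assumes R: "rll_coeffs z1 w1 z2 w2 T S" and zw: "(z1 = 1 \<and> w1 = 0) \<or> (z1 = 0 \<and> w1 = 1)"
    and Y: "mat_inverse I T Y"
    and u: "u * z1 = \<pi> n * z1" "u * (c * z2) = \<pi> n * z2" "u * w1 = w1" "u * (c * w2) = w2"
    and \<zeta>: "twisted (\<lambda>i m. fscale c (T i m)) Y \<zeta>" and I: "k \<in> I" "l \<in> I"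
  shows "fps_nth \<zeta> a * S k l $ b = S k l $ b * fps_nth \<zeta> a"
proof (rule outer_inner_commute)
  define z where "z = K z1 * Q + K z2 * P"
  define w where "w = K w1 * Q + K w2 * P"
  let ?T1 = "\<lambda>i m. outer (fscale c (T i m))" and ?T = "\<lambda>i m. outer (T i m)" and ?S = "\<lambda>k l. fps_const (S k l)"
  have R0: "bi.RTT 1 z w 1 z w ?T ?S"
    using rll_coeffs_bivariate[OF R, of 1] by (simp add: z_def w_def)
  have "K u * (K z1 * Q + K (c * z2) * P) = K (u * z1) * Q + K (u * (c * z2)) * P"
    "K u * (K w1 * Q + K (c * w2) * P) = K (u * w1) * Q + K (u * (c * w2)) * P"
    by (simp_all add: K.hom_mult algebra_simps)
  then have zw': "K u * (K z1 * Q + K (c * z2) * P) = K (\<pi> n) * z" "K u * (K w1 * Q + K (c * w2) * P) = w"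
    unfolding u by (simp_all add: z_def w_def K.hom_mult algebra_simps)
  have R1: "bi.RTT 1 (K (\<pi> n) * z) w 1 (K (\<pi> n) * z) w ?T1 ?S"
    using bi.RTT_scale[OF rll_coeffs_bivariate[OF R, of c], of "K u"] by (simp only: zw')
  let ?x = "1 * 1 * bi.\<Delta> z w * ((K (\<pi> n) * z - w) * (z - w)) * K (d k)"
  have "cen.scale ?x (?S k l * outer \<zeta>) = cen.scale ?x (outer \<zeta> * ?S k l)"
    by (rule bi.sandwich[OF R1 R0 outer_mat_inverse[OF Y] refl refl outer_twisted[OF \<zeta>] I(1) I])
  moreover have lin: "cancellable (K x * z - K y * w)" if "x \<noteq> 0" "y \<noteq> 0" for x y
  proof -
    have "K x * z - K y * w = K (x * z1 - y * w1) * Q + K (x * z2 - y * w2) * P"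
      by (simp add: z_def w_def K.hom_simps algebra_simps)
    then show ?thesis using zw that by (auto intro!: cancellable_linear)
  qed
  have "cancellable ?x"
    using lin[of 1 1] lin[of "\<pi> n" 1] pi_n kappa_nonzero[OF I(1)] d_nonzero[OF I(1)] unfolding bi.Delta_kappa[OF I(1)]
    by (auto intro!: cancellable_mult lin cancellable_K simp: K.hom_1)
  ultimately show "fps_const (S k l) * outer \<zeta> = outer \<zeta> * fps_const (S k l)"
    by (rule cancellableD[rotated])
qed

text \<open>The hypothesis \<open>cross\<close> is the functional equation of f, transferred to the
  factor \<alpha> of the polynomial R-matrix and freed of denominators: the shifted \<alpha> times
  the crossing scalar is \<alpha> times \<Delta>, up to the constant \<open>\<pi> n\<close>.\<close>

context
  fixes \<alpha> g g' T S
  assumes R: "rll_mixed \<alpha> g g' T S" and g: "g \<in> center" "g' \<in> center" and \<alpha>: "fps_nth \<alpha> 0 \<noteq> 0"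
    and cross: "dilate (inverse (\<pi> n)) \<alpha> * ((fps_const (\<pi> n) - fps_X) * (1 - fps_X)) = fps_const (\<pi> n) * (\<alpha> * ser.\<Delta> 1 fps_X)"
begin

lemma Delta_nth_0: "fps_nth (ser.\<Delta> 1 fps_X) 0 = 1"
  by (simp add: ser.\<Delta>_def power2_eq_square)

lemma subst_Delta: "h \<in> center \<Longrightarrow> bi.\<Delta> (subst h x) (subst h y) = subst h (ser.\<Delta> x y)"
  using ser.Delta_hom[OF ring_hom_subst, of h x y] by (simp add: subst_const)

text \<open>Put E = \<alpha> \<Delta>. By \<open>cross\<close>, either scalar of
  \<open>sandwich\<close> becomes the same constant times E(g p q) E(g' p q), which is symmetric in
  g and g'. So they agree although the two sides of the relation have different parameters.\<close>

lemma twisted_commute_mixed_left: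
  assumes Y: "mat_inverse I T Y" and \<zeta>: "twisted (\<lambda>i m. fscale (inverse (\<pi> n)) (T i m)) Y \<zeta>" and I: "k \<in> I" "l \<in> I"
  shows "fps_nth \<zeta> a * S k l $ b = S k l $ b * fps_nth \<zeta> a"
proof (rule outer_inner_commute)
  let ?T1 = "\<lambda>i m. outer (fscale (inverse (\<pi> n)) (T i m))" and ?T = "\<lambda>i m. outer (T i m)" and ?S = "\<lambda>k l. fps_const (S k l)"
  define \<alpha>' where "\<alpha>' = dilate (inverse (\<pi> n)) \<alpha>"
  define E where "E = \<alpha> * ser.\<Delta> 1 fps_X"
  have R0: "bi.RTT (subst g \<alpha>) 1 (subst g fps_X) (subst g' \<alpha>) 1 (subst g' fps_X) ?T ?S"
    using rll_mixed_bivariate[OF R g, of 1 1] by simp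
  have u: "K (\<pi> n) * subst h (fps_const (inverse (\<pi> n)) * fps_X) = subst h fps_X" if h: "h \<in> center" for h
  proof -
    interpret ring_hom "subst h" by (rule ring_hom_subst[OF h])
    show ?thesis using pi_n by (simp add: subst_const[OF h] hom_mult flip: K.hom_mult mult.assoc) (simp add: K.hom_1)
  qed
  have R1: "bi.RTT (subst g \<alpha>') (K (\<pi> n) * 1) (subst g fps_X) (subst g' \<alpha>') (K (\<pi> n) * 1) (subst g' fps_X) ?T1 ?S"
    using bi.RTT_scale[OF rll_mixed_bivariate[OF R g, of "inverse (\<pi> n)" 1], of "K (\<pi> n)"]
    by (simp add: u[OF g(1)] u[OF g(2)] \<alpha>'_def)
  have L: "subst h \<alpha>' * ((K (\<pi> n) * 1 - subst h fps_X) * (1 - subst h fps_X)) = K (\<pi> n) * subst h E"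
    if h: "h \<in> center" for h
  proof -
    interpret ring_hom "subst h" by (rule ring_hom_subst[OF h])
    show ?thesis using arg_cong[OF cross, of "subst h"] by (simp add: \<alpha>'_def E_def hom_simps subst_const[OF h])
  qed
  have D: "subst h \<alpha> * bi.\<Delta> 1 (subst h fps_X) = subst h E" if h: "h \<in> center" for h
  proof -
    interpret ring_hom "subst h" by (rule ring_hom_subst[OF h])
    show ?thesis using subst_Delta[OF h, of 1 fps_X] by (simp add: E_def hom_simps)
  qed
  let ?x = "subst g' \<alpha>' * subst g \<alpha> * bi.\<Delta> 1 (subst g fps_X) * ((K (\<pi> n) * 1 - subst g' fps_X) * (1 - subst g' fps_X)) * K (d k)"
  let ?y = "subst g \<alpha>' * subst g' \<alpha> * bi.\<Delta> 1 (subst g' fps_X) * ((K (\<pi> n) * 1 - subst g fps_X) * (1 - subst g fps_X)) * K (d k)"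
  have S: "cen.scale ?x (?S k l * outer \<zeta>) = cen.scale ?y (outer \<zeta> * ?S k l)"
    by (rule bi.sandwich[OF R1 R0 outer_mat_inverse[OF Y] refl refl outer_twisted[OF \<zeta>] I(1) I])
  have x: "?x = K (\<pi> n) * (subst g E * subst g' E) * K (d k)"
  proof -
    have "?x = (subst g' \<alpha>' * ((K (\<pi> n) * 1 - subst g' fps_X) * (1 - subst g' fps_X))) * (subst g \<alpha> * bi.\<Delta> 1 (subst g fps_X)) * K (d k)"
      by (simp only: mult_ac)
    then show ?thesis unfolding L[OF g(2)] D[OF g(1)] by (simp only: mult_ac)
  qed
  have y: "?y = K (\<pi> n) * (subst g E * subst g' E) * K (d k)"
  proof -
    have "?y = (subst g \<alpha>' * ((K (\<pi> n) * 1 - subst g fps_X) * (1 - subst g fps_X))) * (subst g' \<alpha> * bi.\<Delta> 1 (subst g' fps_X)) * K (d k)"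
      by (simp only: mult_ac)
    then show ?thesis unfolding L[OF g(1)] D[OF g(2)] by (simp only: mult_ac)
  qed
  have E: "fps_nth E 0 \<noteq> 0" using \<alpha> Delta_nth_0 by (simp add: E_def)
  have "cancellable (K (\<pi> n) * (subst g E * subst g' E) * K (d k))"
    by (intro cancellable_mult cancellable_K cancellable_subst g E pi_n d_nonzero I)
  then show "fps_const (S k l) * outer \<zeta> = outer \<zeta> * fps_const (S k l)"
    using S unfolding x y by (rule cancellableD)
qed

text \<open>The roles of the two series are exchanged by \<open>RTT_swap\<close>. The factors
  \<Delta> that it introduces combine with \<open>cross\<close> so that both scalars are a constant
  times the values of \<alpha> N D at g p q and g' p q.\<close>

lemma twisted_commute_mixed_right:
  assumes Y: "mat_inverse I S Y" and \<zeta>: "twisted (\<lambda>i m. fscale (\<pi> n) (S i m)) Y \<zeta>" and I: "k \<in> I" "l \<in> I"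
  shows "fps_nth \<zeta> a * T k l $ b = T k l $ b * fps_nth \<zeta> a"
proof (rule outer_inner_commute[symmetric])
  let ?S1 = "\<lambda>i m. fps_const (fscale (\<pi> n) (S i m))" and ?T = "\<lambda>i m. outer (T i m)" and ?S = "\<lambda>k l. fps_const (S k l)"
  define \<alpha>' where "\<alpha>' = dilate (\<pi> n) \<alpha>"
  define N where "N = (fps_const (\<pi> n) * fps_X - 1) * (fps_X - 1)"
  define D where "D = ser.\<Delta> 1 fps_X"
  define D' where "D' = ser.\<Delta> 1 (fps_const (\<pi> n) * fps_X)"
  \<comment> \<open>This is \<open>cross\<close> with its variable scaled by \<open>\<pi> n\<close>:
    here q is scaled by \<open>\<pi> n\<close>, whereas for the other series p was scaled by the
    inverse.\<close>
  have H: "\<alpha>' * D' = \<alpha> * N"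
  proof -
    interpret ring_hom "dilate (\<pi> n)" by (rule ring_hom_dilate)
    have "dilate (\<pi> n) (ser.\<Delta> 1 fps_X) = D'"
      by (simp add: D'_def ser.\<Delta>_def hom_simps hom_power dilate_simps)
    moreover have "dilate (\<pi> n) (dilate (inverse (\<pi> n)) \<alpha>) = \<alpha>"
      using pi_n by (simp add: fps_eq_iff flip: power_mult_distrib mult.assoc)
    ultimately have "\<alpha> * ((fps_const (\<pi> n) - fps_const (\<pi> n) * fps_X) * (1 - fps_const (\<pi> n) * fps_X)) = fps_const (\<pi> n) * (\<alpha>' * D')"
      using arg_cong[OF cross, of "dilate (\<pi> n)"] by (simp add: hom_simps dilate_simps \<alpha>'_def)
    moreover have "\<alpha> * ((fps_const (\<pi> n) - fps_const (\<pi> n) * fps_X) * (1 - fps_const (\<pi> n) * fps_X)) = fps_const (\<pi> n) * (\<alpha> * N)"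
      by (simp add: N_def algebra_simps)
    moreover have "fps_const (\<pi> n) \<noteq> 0" using pi_n by simp
    ultimately show ?thesis by (metis mult_left_cancel)
  qed
  have "bi.RTT (subst g' \<alpha> * bi.\<Delta> 1 (subst g' fps_X)) (subst g fps_X) 1 (subst g \<alpha> * bi.\<Delta> 1 (subst g fps_X)) (subst g' fps_X) 1 ?S ?T"
    using bi.RTT_swap[OF rll_mixed_bivariate[OF R g, of 1 1]] by simp
  moreover have one: "1 = subst h 1" if "h \<in> center" for h
    using ring_hom.hom_1[OF ring_hom_subst[OF that]] by simp
  have Dl: "subst h x * bi.\<Delta> 1 (subst h y) = subst h (x * ser.\<Delta> 1 y)" if "h \<in> center" for h x y
    using subst_Delta[OF that, of 1 y] ring_hom.hom_mult[OF ring_hom_subst[OF that]] one[OF that] by simp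
  ultimately have R0: "bi.RTT (subst g' (\<alpha> * D)) (subst g fps_X) 1 (subst g (\<alpha> * D)) (subst g' fps_X) 1 ?S ?T"
    by (simp add: Dl g D_def)
  have mul: "subst h (fps_const (\<pi> n) * fps_X) = K (\<pi> n) * subst h fps_X" if "h \<in> center" for h
    using ring_hom.hom_mult[OF ring_hom_subst[OF that]] by (simp add: subst_const[OF that])
  have "bi.RTT (subst g' \<alpha>' * bi.\<Delta> 1 (subst g' (fps_const (\<pi> n) * fps_X))) (subst g (fps_const (\<pi> n) * fps_X)) 1
     (subst g \<alpha>' * bi.\<Delta> 1 (subst g (fps_const (\<pi> n) * fps_X))) (subst g' (fps_const (\<pi> n) * fps_X)) 1 ?S1 ?T"
    using bi.RTT_swap[OF rll_mixed_bivariate[OF R g, of 1 "\<pi> n"]] by (simp add: \<alpha>'_def)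
  note this[unfolded Dl[OF g(1)] Dl[OF g(2)] D'_def[symmetric] H, unfolded mul[OF g(1)] mul[OF g(2)]]
  then have R1: "bi.RTT (subst g' (\<alpha> * N)) (K (\<pi> n) * subst g fps_X) 1 (subst g (\<alpha> * N)) (K (\<pi> n) * subst g' fps_X) 1 ?S1 ?T" .
  let ?x = "subst g (\<alpha> * N) * subst g' (\<alpha> * D) * bi.\<Delta> (subst g fps_X) 1 * ((K (\<pi> n) * subst g' fps_X - 1) * (subst g' fps_X - 1)) * K (d k)"
  let ?y = "subst g' (\<alpha> * N) * subst g (\<alpha> * D) * bi.\<Delta> (subst g' fps_X) 1 * ((K (\<pi> n) * subst g fps_X - 1) * (subst g fps_X - 1)) * K (d k)"
  have S: "cen.scale ?x (?T k l * fps_const \<zeta>) = cen.scale ?y (fps_const \<zeta> * ?T k l)"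
    by (rule bi.sandwich[OF R1 R0 inner_mat_inverse[OF Y] refl refl inner_twisted[OF \<zeta>] I(1) I])
  have D2: "bi.\<Delta> (subst h fps_X) 1 = subst h D" if "h \<in> center" for h
    using subst_Delta[OF that, of fps_X 1] one[OF that] by (simp add: D_def ser.Delta_sym)
  have N2: "(K (\<pi> n) * subst h fps_X - 1) * (subst h fps_X - 1) = subst h N" if "h \<in> center" for h
  proof -
    interpret ring_hom "subst h" by (rule ring_hom_subst[OF that])
    show ?thesis by (simp add: N_def hom_simps subst_const[OF that])
  qed
  have hom: "subst h (x * y) = subst h x * subst h y" if "h \<in> center" for h x y
    by (rule ring_hom.hom_mult[OF ring_hom_subst[OF that]])
  have xy: "?x = subst g (\<alpha> * N * D) * subst g' (\<alpha> * N * D) * K (d k)" "?y = subst g (\<alpha> * N * D) * subst g' (\<alpha> * N * D) * K (d k)"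
    unfolding D2[OF g(1)] D2[OF g(2)] N2[OF g(1)] N2[OF g(2)] hom[OF g(1)] hom[OF g(2)] by (simp_all only: mult_ac)
  have "fps_nth (\<alpha> * N * D) 0 \<noteq> 0" using \<alpha> Delta_nth_0 by (simp add: N_def D_def)
  then have "cancellable (subst g (\<alpha> * N * D) * subst g' (\<alpha> * N * D) * K (d k))"
    by (intro cancellable_mult cancellable_K cancellable_subst g d_nonzero I)
  then show "fps_const \<zeta> * outer (T k l) = outer (T k l) * fps_const \<zeta>"
    using S unfolding xy by (rule cancellableD[symmetric])
qed

end

text \<open>For L^+ the variables are p = z^-1 and q = w^-1, so R(z, w) is proportional to R(q, p);
  for L^- they are z and w, and the matrix is R(p, q). Hence the parameters 1 0 0 1 and 0 1 1
  0.\<close>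

theorem twisted_central:
  fixes L Y :: "pm \<Rightarrow> nat \<Rightarrow> nat \<Rightarrow> 'a fps"
  assumes plus: "rll_coeffs 1 0 0 1 (L Plus) (L Plus)" and minus: "rll_coeffs 0 1 1 0 (L Minus) (L Minus)"
    and mixed: "rll_mixed \<alpha> g g' (L Plus) (L Minus)" and g: "g \<in> center" "g' \<in> center" and \<alpha>: "fps_nth \<alpha> 0 \<noteq> 0"
    and cross: "dilate (inverse (\<pi> n)) \<alpha> * ((fps_const (\<pi> n) - fps_X) * (1 - fps_X)) = fps_const (\<pi> n) * (\<alpha> * ser.\<Delta> 1 fps_X)"
    and Y: "\<And>s. mat_inverse I (L s) (Y s)"
    and C: "\<And>s c. \<exists>C. mat_inverse I (\<lambda>i m. fscale c (L s m i)) C"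
  obtains \<zeta> where "\<And>s s' k l a b. k \<in> I \<Longrightarrow> l \<in> I \<Longrightarrow>
      fps_nth (\<zeta> s) a * L s' k l $ b = L s' k l $ b * fps_nth (\<zeta> s) a"
    and "\<And>s. twisted (\<lambda>i m. fscale (\<pi> n powi (- pm_sgn s)) (L s i m)) (Y s) (\<zeta> s)"
    and "\<And>s p m. p \<in> I \<Longrightarrow> m \<in> I \<Longrightarrow>
      (\<Sum>i\<in>I. uni.scale (inverse (d i)) (Y s i p * fscale (\<pi> n powi (- pm_sgn s)) (L s m i))) =
      (if m = p then uni.scale (inverse (d m)) (\<zeta> s) else 0)"
proof -
  have ex: "\<exists>\<zeta>. twisted (\<lambda>i m. fscale (\<pi> n powi (- pm_sgn s)) (L s i m)) (Y s) \<zeta>" for s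
  proof (cases s)
    case Plus
    then show ?thesis
      using twisted_exists[OF plus Y[of Plus], of "\<pi> n" "inverse (\<pi> n)"] pi_n by (simp add: power_int_minus)
  next
    case Minus
    then show ?thesis
      using twisted_exists[OF minus Y[of Minus], of 1 "\<pi> n"] pi_n by simp
  qed
  then obtain \<zeta> where \<zeta>: "\<And>s. twisted (\<lambda>i m. fscale (\<pi> n powi (- pm_sgn s)) (L s i m)) (Y s) (\<zeta> s)"
    by metis
  have \<zeta>p: "twisted (\<lambda>i m. fscale (inverse (\<pi> n)) (L Plus i m)) (Y Plus) (\<zeta> Plus)"
    and \<zeta>m: "twisted (\<lambda>i m. fscale (\<pi> n) (L Minus i m)) (Y Minus) (\<zeta> Minus)"
    using \<zeta>[of Plus] \<zeta>[of Minus] by (simp_all add: power_int_minus)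
  have comm: "fps_nth (\<zeta> s) a * L s' k l $ b = L s' k l $ b * fps_nth (\<zeta> s) a"
    if I: "k \<in> I" "l \<in> I" for s s' k l a b
  proof -
    have "fps_nth (\<zeta> Plus) a * L Plus k l $ b = L Plus k l $ b * fps_nth (\<zeta> Plus) a"
      by (rule twisted_commute_same[OF plus _ Y _ _ _ _ \<zeta>p I, of "\<pi> n"]) (use pi_n in auto)
    moreover have "fps_nth (\<zeta> Minus) a * L Minus k l $ b = L Minus k l $ b * fps_nth (\<zeta> Minus) a"
      by (rule twisted_commute_same[OF minus _ Y _ _ _ _ \<zeta>m I, of 1]) (use pi_n in auto)
    moreover have "fps_nth (\<zeta> Plus) a * L Minus k l $ b = L Minus k l $ b * fps_nth (\<zeta> Plus) a"
      by (rule twisted_commute_mixed_left[OF mixed g \<alpha> cross Y \<zeta>p I])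
    moreover have "fps_nth (\<zeta> Minus) a * L Plus k l $ b = L Plus k l $ b * fps_nth (\<zeta> Minus) a"
      by (rule twisted_commute_mixed_right[OF mixed g \<alpha> cross Y \<zeta>m I])
    ultimately show ?thesis by (cases s; cases s') simp_all
  qed
  have "(\<Sum>i\<in>I. uni.scale (inverse (d i)) (Y s i p * fscale (\<pi> n powi (- pm_sgn s)) (L s m i))) =
      (if m = p then uni.scale (inverse (d m)) (\<zeta> s) else 0)" if I: "p \<in> I" "m \<in> I" for s p m
  proof -
    let ?T = "\<lambda>i m. fscale (\<pi> n powi (- pm_sgn s)) (L s i m)"
    obtain C where C: "mat_inverse I (\<lambda>i m. ?T m i) C" using C[of "\<pi> n powi (- pm_sgn s)" s] by blast
    have "\<zeta> s * ?T i m = ?T i m * \<zeta> s" if "i \<in> I" "m \<in> I" for i m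
    proof (rule fps_ext)
      fix r
      have "fps_nth (\<zeta> s * ?T i m) r = (\<Sum>j=0..r. fps_nth (?T i m) (r - j) * fps_nth (\<zeta> s) j)"
        using comm[OF that] by (simp add: fps_mult_nth)
      also have "\<dots> = (\<Sum>j=0..r. fps_nth (?T i m) j * fps_nth (\<zeta> s) (r - j))"
        by (rule sum.reindex_bij_witness[of _ "\<lambda>s. r - s" "\<lambda>s. r - s"]) auto
      finally show "fps_nth (\<zeta> s * ?T i m) r = fps_nth (?T i m * \<zeta> s) r" by (simp add: fps_mult_nth)
    qed
    then show ?thesis
      using \<zeta>[of s] d_nonzero by (intro uni.twisted_product_swap[OF _ _ _ C I]) (auto simp: twisted_def simp del: One_nat_def)
  qed
  then show ?thesis using that comm \<zeta> by blast
qed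

end

section \<open>The scalar factor of the R-matrix\<close>

text \<open>Removes the invertible scalar series \<open>\<alpha>\<close> from a relation between two series of the same sign.\<close>
lemma (in rtt_series) strip_series:
  assumes \<alpha>: "fps_nth \<alpha> 0 \<noteq> 0"
    and H: "\<And>a b. (\<Sum>r\<le>a. (if r + b = 0 then 0 else fps_nth \<alpha> r *s F (a - r) (r + b - 1)) +
        (if r = 0 then 0 else fps_nth \<alpha> (r - 1) *s G (a - r) (r + b - 1))) = 0"
  shows "(if b = 0 then 0 else F a (b - 1)) + (if a = 0 then 0 else G (a - 1) b) = 0"
proof (induction a arbitrary: b rule: less_induct)
  case (less a)
  \<comment> \<open>The hypothesis says that the sum of all
    \<open>\<alpha>_r E(a - r, b + r)\<close> vanishes. The induction on a removes the terms with r
    > 0, and \<alpha>_0 is invertible.\<close>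
  define E where "E a b = (if b = 0 then 0 else F a (b - 1)) + (if a = 0 then 0 else G (a - 1) b)" for a b
  have "0 = (\<Sum>r\<le>a. if r + b = 0 then 0 else fps_nth \<alpha> r *s F (a - r) (r + b - 1)) +
      (\<Sum>r\<le>a. if r = 0 then 0 else fps_nth \<alpha> (r - 1) *s G (a - r) (r + b - 1))"
    unfolding sum.distrib[symmetric] H ..
  also have "(\<Sum>r\<le>a. if r = 0 then 0 else fps_nth \<alpha> (r - 1) *s G (a - r) (r + b - 1)) =
      (\<Sum>r\<in>{1..a}. fps_nth \<alpha> (r - 1) *s G (a - r) (r + b - 1))"
    by (rule sum.mono_neutral_cong_right) auto
  also have "\<dots> = (\<Sum>r\<in>{..<a}. fps_nth \<alpha> r *s G (a - r - 1) (b + r))"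
    by (rule sum.reindex_bij_witness[of _ Suc "\<lambda>r. r - 1"]) (auto simp: add.commute)
  also have "\<dots> = (\<Sum>r\<le>a. if a - r = 0 then 0 else fps_nth \<alpha> r *s G (a - r - 1) (b + r))"
    by (rule sum.mono_neutral_cong_left) auto
  also have "(\<Sum>r\<le>a. if r + b = 0 then 0 else fps_nth \<alpha> r *s F (a - r) (r + b - 1)) +
     (\<Sum>r\<le>a. if a - r = 0 then 0 else fps_nth \<alpha> r *s G (a - r - 1) (b + r)) = (\<Sum>r\<le>a. fps_nth \<alpha> r *s E (a - r) (b + r))"
    unfolding sum.distrib[symmetric] by (intro sum.cong refl) (auto simp: E_def scale_right_distrib add.commute)
  also have "\<dots> = (\<Sum>r\<in>{0}. fps_nth \<alpha> r *s E (a - r) (b + r))"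
  proof (rule sum.mono_neutral_right)
    have "E y b = 0" if "y < a" for y b
      using less.IH[OF that] by (simp add: E_def)
    moreover have "a - r < a" if "r \<in> {..a} - {0}" for r
      using that by auto
    ultimately show "\<forall>r\<in>{..a} - {0}. fps_nth \<alpha> r *s E (a - r) (b + r) = 0"
      by simp
  qed auto
  finally show ?case using \<alpha> by (simp add: scale_cancel E_def)
qed

section \<open>The functional equation of f\<close>

fun dilation_coeffs :: "'k::field \<Rightarrow> (nat \<Rightarrow> 'k) \<Rightarrow> nat \<Rightarrow> 'k" where
  "dilation_coeffs c g n = (if n = 0 then 1 else (\<Sum>k<n. dilation_coeffs c g k * g (n - k)) / (c ^ n - 1))"

declare dilation_coeffs.simps [simp del]

text \<open>In order n the equation is f_n (c^n - 1) = the sum of f_k g_(n-k) over k < n, because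
  g_0 = 1. It can be solved for f_n as c is not a root of unity.\<close>

lemma dilation_equation:
  fixes c :: "'k::field"
  assumes c: "\<And>n. n > 0 \<Longrightarrow> c ^ n \<noteq> 1" and g: "fps_nth g 0 = 1"
  shows "\<exists>!f. fps_nth f 0 = 1 \<and> f oo (fps_const c * fps_X) = f * g"
proof -
  have eq: "f oo (fps_const c * fps_X) = f * g \<longleftrightarrow>
      (\<forall>n>0. fps_nth f n * (c ^ n - 1) = (\<Sum>k<n. fps_nth f k * fps_nth g (n - k)))" for f
  proof -
    have "fps_nth (f oo (fps_const c * fps_X)) n = fps_nth (f * g) n \<longleftrightarrow>
        fps_nth f n * (c ^ n - 1) = (\<Sum>k<n. fps_nth f k * fps_nth g (n - k))" for n
      unfolding fps_nth_compose_linear fps_mult_nth atLeast0AtMost lessThan_Suc_atMost[symmetric] sum.lessThan_Suc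
      by (simp add: g algebra_simps)
    moreover have "fps_nth f 0 * (c ^ 0 - 1) = (\<Sum>k<0. fps_nth f k * fps_nth g (0 - k))"
      by simp
    ultimately show ?thesis unfolding fps_eq_iff by (metis gr0I)
  qed
  let ?f = "Abs_fps (dilation_coeffs c (fps_nth g))"
  have f: "fps_nth ?f 0 = 1 \<and> ?f oo (fps_const c * fps_X) = ?f * g"
    unfolding eq
  proof (intro conjI allI impI)
    show "fps_nth ?f 0 = 1" by (simp add: dilation_coeffs.simps)
    fix n :: nat assume n: "n > 0"
    then show "fps_nth ?f n * (c ^ n - 1) = (\<Sum>k<n. fps_nth ?f k * fps_nth g (n - k))"
      using c[OF n] by (simp add: dilation_coeffs.simps[of c _ n])
  qed
  have uniq: "f = h" if "fps_nth f 0 = 1 \<and> f oo (fps_const c * fps_X) = f * g" "fps_nth h 0 = 1 \<and> h oo (fps_const c * fps_X) = h * g" for f h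
  proof (rule fps_ext)
    fix n
    show "fps_nth f n = fps_nth h n"
    proof (induction n rule: less_induct)
      case (less n)
      show ?case
      proof (cases "n = 0")
        case False
        then have "fps_nth f n * (c ^ n - 1) = fps_nth h n * (c ^ n - 1)"
          using that less unfolding eq by simp
        then show ?thesis using c[of n] False by simp
      qed (use that in simp)
    qed
  qed
  show ?thesis
  proof (rule ex1I)
    show "fps_nth ?f 0 = 1 \<and> ?f oo (fps_const c * fps_X) = ?f * g" by (rule f)
  qed (rule uniq[OF _ f])
qed

text \<open>For a = q these factor the numerator in the equation of f, and \<Delta>(1, X). They
  share the factor a' - a X; the other linear factors in X are the denominator of the normalized
  R-matrix, shifted in the first case and unshifted in the second.\<close>

lemma crossing_identity:
  fixes a a' x x' X :: "'a::comm_ring_1"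
  assumes "a * a' = 1" "x * x' = 1"
  shows "(X - a' * a') * (X - a * a * x) = x * (a' - a * X) * (a - a' * x' * X)"
    and "(a - a' * X) * (a' - a * X) = (1 - X)^2 - (a - a')^2 * 1 * X"
proof -
  have [simp]: "a * (a' * z) = z" "x * (x' * z) = z" for z
    using assms by (simp_all flip: mult.assoc)
  have "a' * (a * z) = z" for z by (simp add: mult.left_commute)
  then show "(X - a' * a') * (X - a * a * x) = x * (a' - a * X) * (a - a' * x' * X)"
    "(a - a' * X) * (a' - a * X) = (1 - X)^2 - (a - a')^2 * 1 * X"
    using assms by (simp_all add: algebra_simps power2_eq_square)
qed

lemma qvar_power: "qvar ^ n = Fract (monom 1 n) 1"
proof (induction n)
  case (Suc n)
  have "[:0, 1:] * monom (1::complex) n = monom 1 (Suc n)"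
    by (simp add: monom_Suc)
  then show ?case using Suc by (simp add: qvar_def)
qed (simp add: One_fract_def)

lemma qvar_nonzero: "qvar \<noteq> 0"
  by (simp add: qvar_def Zero_fract_def eq_fract)

lemma qvar_power_neq_1: "n > 0 \<Longrightarrow> qvar ^ n \<noteq> 1"
proof
  assume "n > 0" "qvar ^ n = 1"
  then have "monom (1::complex) n = 1" by (simp add: qvar_power One_fract_def eq_fract)
  then show False using \<open>n > 0\<close> by (metis degree_1 degree_monom_eq less_numeral_extra(3) one_neq_zero)
qed

lemma qvar_powi_eq_1_iff: "qvar powi k = 1 \<longleftrightarrow> k = 0"
  using qvar_power_neq_1[of "nat k"] qvar_power_neq_1[of "nat (- k)"]
  by (cases "k > 0"; cases "k = 0") (auto simp: power_int_def power_inverse)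

lemma f_series:
  assumes "M \<noteq> N"
  defines "x \<equiv> qvar powi shift_exp M N"
  shows "fps_nth (f_series M N) 0 = 1"
    and "f_series M N oo (fps_const (inverse x) * fps_X) = f_series M N *
      (((fps_X - fps_const (qvar powi -2)) * (fps_X - fps_const (qvar powi 2 * x))) / ((fps_X - 1) * (fps_X - fps_const x)))"
proof -
  let ?g = "((fps_X - fps_const (qvar powi -2)) * (fps_X - fps_const (qvar powi 2 * x))) / ((fps_X - 1) * (fps_X - fps_const x))"
  have x: "x \<noteq> 0" by (simp add: x_def qvar_nonzero)
  have "fps_nth ((fps_X - 1) * (fps_X - fps_const x)) 0 \<noteq> 0"
    using x by simp
  then have "fps_nth ?g 0 = 1"
    using x by (subst fps_divide_unit) (simp_all add: qvar_nonzero field_simps power_int_minus)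
  moreover have "inverse x ^ k \<noteq> 1" if "k > 0" for k
  proof -
    have "inverse x ^ k = qvar powi (- shift_exp M N * int k)"
      by (simp add: x_def power_int_mult power_int_minus power_inverse)
    then show ?thesis using assms that by (simp add: qvar_powi_eq_1_iff shift_exp_def)
  qed
  ultimately have "\<exists>!f. fps_nth f 0 = 1 \<and> f oo (fps_const (inverse x) * fps_X) = f * ?g"
    by (rule dilation_equation[rotated])
  moreover have "f_series M N = (THE f. fps_nth f 0 = 1 \<and> f oo (fps_const (inverse x) * fps_X) = f * ?g)"
    by (simp add: f_series_def x_def power_int_minus power_int_add qvar_nonzero mult.commute)
  ultimately show "fps_nth (f_series M N) 0 = 1" "f_series M N oo (fps_const (inverse x) * fps_X) = f_series M N * ?g"
    using theI'[of "\<lambda>f. fps_nth f 0 = 1 \<and> f oo (fps_const (inverse x) * fps_X) = f * ?g"] by simp_all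
qed

definition \<alpha>_series :: "nat \<Rightarrow> nat \<Rightarrow> ratfun fps" where
  "\<alpha>_series M N = f_series M N * inverse (fps_const qvar - fps_const (inverse qvar) * fps_X)"

lemma R_series_eq: "R_series M N i j k l = \<alpha>_series M N * R_poly M N 1 fps_X i j k l"
proof -
  have "fps_nth (fps_const qvar - fps_const (inverse qvar) * fps_X) 0 \<noteq> 0" by (simp add: qvar_nonzero)
  then show ?thesis unfolding R_series_def R_bar_def \<alpha>_series_def by (simp add: fps_divide_unit mult_ac)
qed

lemma \<alpha>_series_nth_0: "M \<noteq> N \<Longrightarrow> fps_nth (\<alpha>_series M N) 0 \<noteq> 0"
  by (simp add: \<alpha>_series_def f_series qvar_nonzero)

text \<open>The shift multiplies f by the quotient of its functional equation. The left side clears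
  the denominator, and one factor of the numerator cancels the shifted denominator of \<alpha>. The
  factor that is left completes the unshifted denominator to \<Delta>.\<close>

lemma \<alpha>_series_crossing:
  assumes "M \<noteq> N"
  defines "x \<equiv> qvar powi shift_exp M N"
  shows "(\<alpha>_series M N oo (fps_const (inverse x) * fps_X)) * ((fps_const x - fps_X) * (1 - fps_X)) =
    fps_const x * (\<alpha>_series M N * ((1 - fps_X)^2 - fps_const (qvar - inverse qvar)^2 * 1 * fps_X))"
proof -
  let ?u = "fps_const qvar - fps_const (inverse qvar) * fps_X"
  let ?v = "fps_const qvar - fps_const (inverse qvar * inverse x) * fps_X"
  let ?den = "(fps_X - 1) * (fps_X - fps_const x)" and ?num = "(fps_X - fps_const (qvar powi -2)) * (fps_X - fps_const (qvar powi 2 * x))"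
  have q: "qvar \<noteq> 0" "x \<noteq> 0" by (simp_all add: x_def qvar_nonzero)
  have c: "fps_const (qvar powi -2) = fps_const (inverse qvar) * fps_const (inverse qvar)"
    "fps_const (qvar powi 2 * x) = fps_const qvar * fps_const qvar * fps_const x"
    "fps_const (inverse qvar * inverse x) = fps_const (inverse qvar) * fps_const (inverse x)"
    "fps_const (qvar - inverse qvar) = fps_const qvar - fps_const (inverse qvar)"
    by (simp_all add: power_int_minus power2_eq_square mult_ac)
  have q': "fps_const qvar * fps_const (inverse qvar) = 1" "fps_const x * fps_const (inverse x) = 1"
    using q by simp_all
  have nz: "fps_nth ?u 0 \<noteq> 0" "fps_nth ?v 0 \<noteq> 0" "fps_nth ?den 0 \<noteq> 0" using q by auto
  have "inverse ?u oo (fps_const (inverse x) * fps_X) = inverse (?u oo (fps_const (inverse x) * fps_X))"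
    using nz by (intro fps_inverse_compose) simp_all
  also have "?u oo (fps_const (inverse x) * fps_X) = ?v"
    by (simp add: fps_compose_sub_distrib fps_compose_mult_distrib flip: fps_const_mult mult.assoc)
  finally have v: "inverse ?u oo (fps_const (inverse x) * fps_X) = inverse ?v" .
  have "(\<alpha>_series M N oo (fps_const (inverse x) * fps_X)) * ((fps_const x - fps_X) * (1 - fps_X)) =
      f_series M N * (?num * inverse ?den * ?den) * inverse ?v"
  proof -
    have den: "(fps_const x - fps_X) * (1 - fps_X) = ?den"
      by (simp add: algebra_simps)
    have "\<alpha>_series M N oo (fps_const (inverse x) * fps_X) = f_series M N * (?num / ?den) * inverse ?v"
      using f_series(2)[OF assms(1)] by (simp add: \<alpha>_series_def fps_compose_mult_distrib v flip: x_def)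
    then show ?thesis unfolding den fps_divide_unit[OF nz(3)] by (simp only: mult_ac)
  qed
  also have "?num * inverse ?den * ?den = ?num"
    using inverse_mult_eq_1[OF nz(3)] by (simp add: mult.assoc)
  also have "?num = fps_const x * (fps_const (inverse qvar) - fps_const qvar * fps_X) * ?v"
    unfolding c by (rule crossing_identity[OF q'])
  also have "f_series M N * (fps_const x * (fps_const (inverse qvar) - fps_const qvar * fps_X) * ?v) * inverse ?v =
     f_series M N * fps_const x * (fps_const (inverse qvar) - fps_const qvar * fps_X) * (inverse ?u * ?u)"
    using inverse_mult_eq_1[OF nz(2)] inverse_mult_eq_1[OF nz(1)] by (simp add: mult_ac)
  also have "\<dots> = fps_const x * (\<alpha>_series M N * (?u * (fps_const (inverse qvar) - fps_const qvar * fps_X)))"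
    by (simp add: \<alpha>_series_def mult_ac)
  also have "?u * (fps_const (inverse qvar) - fps_const qvar * fps_X) = (1 - fps_X)^2 - fps_const (qvar - inverse qvar)^2 * 1 * fps_X"
    unfolding c by (rule crossing_identity[OF q'])
  finally show ?thesis .
qed

section \<open>Removing the grading\<close>

lemma free_parity_involution: "free_parity M (free_parity M x) = x"
proof (rule poly_mapping_eqI)
  fix w
  have "word_sign M w * word_sign M w = 1"
    by (simp add: word_sign_def flip: power_add power_mult_distrib)
  then show "Poly_Mapping.lookup (free_parity M (free_parity M x)) w = Poly_Mapping.lookup x w"
    by (simp add: lookup_free_parity flip: mult.assoc)
qed

lemma uq_parity_add: "uq_parity (x + y) = uq_parity x + uq_parity y"
  by transfer (simp add: free_parity_add two_sided_ideal.zero)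

lemma uq_parity_mult: "uq_parity (x * y) = uq_parity x * uq_parity y"
  by transfer (simp add: free_parity_mult two_sided_ideal.zero)

lemma uq_parity_1: "uq_parity 1 = 1"
  by transfer (simp add: two_sided_ideal.zero)

lemma uq_parity_involution: "uq_parity (uq_parity x) = x"
  by transfer (simp add: free_parity_involution two_sided_ideal.zero)

lemma uq_parity_scalar: "uq_parity (uq_scalar c) = uq_scalar c"
  by transfer (simp add: two_sided_ideal.zero)

lemma free_scalar_add: "free_scalar (x + y) = free_scalar x + free_scalar y"
  by (simp add: free_scalar_def single_add)

lemma free_scalar_mult: "free_scalar (x * y) = free_scalar x * free_scalar y"
  by (simp add: free_scalar_def mult_single)

lemma free_scalar_1: "free_scalar 1 = 1"
  by (simp add: free_scalar_def)

lemma free_scalar_central: "free_scalar c * x = x * free_scalar c"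
  by (induction x rule: free_alg_induct) (simp_all add: distrib_left distrib_right free_scalar_def mult_single mult.commute)

lemma uq_scalar_simps:
  "uq_scalar (x + y) = uq_scalar x + uq_scalar y" "uq_scalar (x * y) = uq_scalar x * uq_scalar y" "uq_scalar 1 = 1"
  by (transfer; simp add: free_scalar_add free_scalar_mult free_scalar_1 two_sided_ideal.zero)+

lemma uq_scalar_central: "uq_scalar c * x = x * uq_scalar c"
  by transfer (simp add: free_scalar_central two_sided_ideal.zero)

lemma uq_parity_0 [simp]: "uq_parity 0 = 0"
  using uq_parity_add[of 0 0] by simp

lemma uq_parity_uminus: "uq_parity (- x) = - uq_parity x"
  using uq_parity_add[of x "- x"] by (simp add: eq_neg_iff_add_eq_0 add.commute)

lemma uq_parity_funpow: "(uq_parity ^^ p) x = (if even p then x else uq_parity x)"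
  by (induction p) (simp_all add: uq_parity_involution)

text \<open>The smash product of the quantum algebra with the group algebra of \<open>\<int>/2\<close>, whose generator \<open>\<tau>\<close> acts by
  the parity automorphism. \<open>SM a b\<close> is \<open>a + b \<tau>\<close>.\<close>
declare [[typedef_overloaded]]

datatype ('m::len0, 'n::len0) smash = SM "('m, 'n) uq" "('m, 'n) uq"

instantiation smash :: (len0, len0) ring_1
begin

definition "0 = SM 0 0"
definition "1 = SM 1 0"
fun plus_smash where "SM a b + SM c d = SM (a + c) (b + d)"
fun minus_smash where "SM a b - SM c d = SM (a - c) (b - d)"
fun uminus_smash where "- SM a b = SM (- a) (- b)"
fun times_smash where "SM a b * SM c d = SM (a * c + b * uq_parity d) (a * d + b * uq_parity c)"

instance
proof
  fix a b c :: "('a, 'b) smash"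
  show "a * b * c = a * (b * c)"
    by (cases a; cases b; cases c)
      (simp add: algebra_simps uq_parity_add uq_parity_mult uq_parity_involution)
  show "(a + b) * c = a * c + b * c" "a * (b + c) = a * b + a * c"
    by (cases a; cases b; cases c; simp add: algebra_simps uq_parity_add)+
  show "(0 :: ('a, 'b) smash) \<noteq> 1"
    by (simp add: zero_smash_def one_smash_def)
  show "a - b = a + - b" by (cases a; cases b) simp
  show "a + b + c = a + (b + c)" by (cases a; cases b; cases c) simp
  show "a + b = b + a" by (cases a; cases b) simp
qed (case_tac a; simp add: zero_smash_def one_smash_def uq_parity_1)+

end

text \<open>\<open>tw a p\<close> is \<open>a \<tau>\<^sup>p\<close>.\<close>
definition tw :: "('m::len0, 'n::len0) uq \<Rightarrow> nat \<Rightarrow> ('m, 'n) smash" where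
  "tw a p = (if even p then SM a 0 else SM 0 a)"

lemma tw_mult: "tw a p * tw b q = tw (a * (uq_parity ^^ p) b) (p + q)"
  by (auto simp: tw_def uq_parity_funpow)

lemma tw_add: "tw (a + b) p = tw a p + tw b p"
  by (simp add: tw_def)

lemma tw_0 [simp]: "tw 0 p = 0"
  by (simp add: tw_def zero_smash_def)

lemma tw_uminus: "tw (- a) p = - tw a p"
  by (simp add: tw_def)

lemma tw_sum: "tw (sum f J) p = (\<Sum>j\<in>J. tw (f j) p)"
  by (induction J rule: infinite_finite_induct) (simp_all add: tw_add)

lemma tw_sign: "tw ((-1) ^ r * a) p = (-1) ^ r * tw a p"
  by (cases "even r") (simp_all add: tw_uminus)

lemma tw_parity: "even (p + q) \<Longrightarrow> tw a p = tw a q"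
  by (auto simp: tw_def)

lemma tw_inject: "tw a p = tw b p \<longleftrightarrow> a = b"
  by (simp add: tw_def)

lemma tw_1: "even p \<Longrightarrow> tw 1 p = 1"
  by (simp add: tw_def one_smash_def)

definition sm_scalar :: "ratfun \<Rightarrow> ('m::len0, 'n::len0) smash" where
  "sm_scalar c = SM (uq_scalar c) 0"

lemma sm_scalar_mult_tw: "sm_scalar c * tw a p = tw (uq_scalar c * a) p"
  by (simp add: sm_scalar_def tw_def)

interpretation sm: central_hom "sm_scalar :: ratfun \<Rightarrow> ('m::len0, 'n::len0) smash"
proof
  fix x y and b :: "('m, 'n) smash"
  show "sm_scalar x * b = b * sm_scalar x"
    by (cases b) (simp add: sm_scalar_def uq_parity_scalar uq_scalar_central)
qed (simp_all add: sm_scalar_def uq_scalar_simps one_smash_def)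

definition twf :: "('m::len0, 'n::len0) uq fps \<Rightarrow> nat \<Rightarrow> ('m, 'n) smash fps" where
  "twf f p = Abs_fps (\<lambda>r. tw (fps_nth f r) p)"

lemma twf_nth [simp]: "fps_nth (twf f p) r = tw (fps_nth f r) p"
  by (simp add: twf_def)

lemma twf_inject: "twf f p = twf g p \<longleftrightarrow> f = g"
  by (simp add: fps_eq_iff tw_inject)

lemma fps_parity_nth [simp]: "fps_nth (fps_parity f) r = uq_parity (fps_nth f r)"
  by (simp add: fps_parity_def)

lemma fps_parity_funpow_nth: "fps_nth ((fps_parity ^^ p) f) r = (uq_parity ^^ p) (fps_nth f r)"
  by (induction p arbitrary: r) simp_all

lemma twf_mult: "twf f p * twf g q = twf (f * (fps_parity ^^ p) g) (p + q)"
  by (rule fps_ext) (simp add: fps_mult_nth tw_mult tw_sum fps_parity_funpow_nth)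

lemma twf_sum: "twf (sum f J) p = (\<Sum>j\<in>J. twf (f j) p)"
  by (rule fps_ext) (simp add: tw_sum fps_sum_nth)

lemma twf_parity: "even (p + q) \<Longrightarrow> twf f p = twf f q"
  by (rule fps_ext) (simp only: twf_nth tw_parity)

lemma twf_0 [simp]: "twf 0 p = 0"
  by (rule fps_ext) simp

lemma twf_1: "even p \<Longrightarrow> twf 1 p = 1"
  by (rule fps_ext) (simp add: tw_1)

lemma fps_parity_simps:
  "fps_parity (f + g) = fps_parity f + fps_parity g" "fps_parity (f * g) = fps_parity f * fps_parity g"
  "fps_parity 0 = 0" "fps_parity 1 = 1" "fps_parity (fps_parity f) = f" "fps_parity (- f) = - fps_parity f"
proof -
  have "uq_parity (sum h J) = (\<Sum>j\<in>J. uq_parity (h j))" for h :: "nat \<Rightarrow> ('a, 'b) uq" and J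
    by (induction J rule: infinite_finite_induct) (simp_all add: uq_parity_add)
  then show "fps_parity (f * g) = fps_parity f * fps_parity g"
    by (simp add: fps_eq_iff fps_mult_nth uq_parity_mult)
qed (simp_all add: fps_eq_iff uq_parity_add uq_parity_involution uq_parity_1 uq_parity_uminus)

lemma fps_parity_sum: "fps_parity (sum f J) = (\<Sum>j\<in>J. fps_parity (f j))"
  by (induction J rule: infinite_finite_induct) (simp_all add: fps_parity_simps)

lemma fps_parity_sign: "fps_parity ((-1) ^ p * f) = (-1) ^ p * fps_parity f"
  by (cases "even p") (simp_all add: fps_parity_simps)

lemma fps_parity_funpow: "(fps_parity ^^ p) f = (if even p then f else fps_parity f)"
  by (induction p) (simp_all add: fps_parity_simps)

text \<open>Moving \<tau>^(i+j) past an entry of B applies the same power of the parity automorphism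
  as moving E_ij past it, so twisting each entry by the parity of its matrix unit is
  multiplicative.\<close>

lemma smat_mult_twf:
  fixes A B :: "('m::len0, 'n::len0) uq fps smat"
  assumes "i \<in> idx M N" "k \<in> idx M N"
  shows "twf (smat_mult M N fps_parity A B i k) (bar M i + bar M k) =
    mat_mult (idx M N) (\<lambda>i j. twf (A i j) (bar M i + bar M j)) (\<lambda>i j. twf (B i j) (bar M i + bar M j)) i k"
  using assms by (auto simp: smat_mult_def mat_mult_def twf_sum twf_mult intro!: sum.cong twf_parity)

text \<open>The uniqueness behind the definite description is that of ordinary matrix inverses over
  the smash product, pulled back along the injective twist.\<close>

lemma smat_inverse_eqI:
  fixes A B :: "('m::len0, 'n::len0) uq fps smat"
  assumes out: "\<And>i j. \<not> (i \<in> idx M N \<and> j \<in> idx M N) \<Longrightarrow> B i j = 0"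
    and AB: "smat_mult M N fps_parity A B = smat_diag M N (\<lambda>_. 1)"
    and BA: "smat_mult M N fps_parity B A = smat_diag M N (\<lambda>_. 1)"
  shows "smat_inverse M N fps_parity A = B"
  unfolding smat_inverse_def
proof (rule the_equality)
  let ?h = "\<lambda>A i j. twf (A i j) (bar M i + bar M j)"
  have inv: "mat_inverse (idx M N) (?h A) (?h C)"
    if "smat_mult M N fps_parity A C = smat_diag M N (\<lambda>_. 1)" "smat_mult M N fps_parity C A = smat_diag M N (\<lambda>_. 1)" for C
    unfolding mat_inverse_def
  proof (intro ballI)
    fix i k assume "i \<in> idx M N" "k \<in> idx M N"
    then show "mat_mult (idx M N) (?h A) (?h C) i k = mat_unit i k \<and> mat_mult (idx M N) (?h C) (?h A) i k = mat_unit i k"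
      by (simp only: smat_mult_twf[symmetric] that) (simp add: smat_diag_def mat_unit_def twf_1)
  qed
  fix C assume C: "(\<forall>i j. \<not> (i \<in> idx M N \<and> j \<in> idx M N) \<longrightarrow> C i j = 0) \<and>
     smat_mult M N fps_parity A C = smat_diag M N (\<lambda>_. 1) \<and> smat_mult M N fps_parity C A = smat_diag M N (\<lambda>_. 1)"
  show "C = B"
  proof (intro ext)
    fix i j
    show "C i j = B i j"
    proof (cases "i \<in> idx M N \<and> j \<in> idx M N")
      case True
      then have "?h C i j = ?h B i j"
        using C AB BA by (intro mat_inverse_unique[of "idx M N" "?h A"] inv) auto
      then show ?thesis by (simp add: twf_inject)
    qed (use C out in auto)
  qed
qed (use assms in auto)

section \<open>The parameters of the superalgebra\<close>

definition kap :: "nat \<Rightarrow> nat \<Rightarrow> ratfun" where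
  "kap M i = (-1) ^ bar M i * qi M i"

definition kap_prod :: "nat \<Rightarrow> nat \<Rightarrow> ratfun" where
  "kap_prod M i = (\<Prod>j=1..i. inverse (kap M j) ^ 2)"

definition dd :: "nat \<Rightarrow> nat \<Rightarrow> ratfun" where
  "dd M i = inverse (kap M i) * kap_prod M (i - 1)"

lemma kap_if: "kap M i = (if i \<le> M then qvar else - inverse qvar)"
  by (simp add: kap_def qi_def bar_def)

lemma kap_nonzero: "kap M i \<noteq> 0"
  by (simp add: kap_if qvar_nonzero)

lemma kap_prod_eq: "kap_prod M i = qvar powi (if i \<le> M then - 2 * int i else 2 * int (i - M) - 2 * int M)"
proof (induction i)
  case (Suc i)
  have "kap_prod M (Suc i) = kap_prod M i * inverse (kap M (Suc i)) ^ 2"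
    by (simp add: kap_prod_def)
  also have "inverse (kap M (Suc i)) ^ 2 = qvar powi (if Suc i \<le> M then - 2 else 2)"
    by (simp add: kap_if power_int_minus power_inverse)
  finally show ?case unfolding Suc
    by (simp add: qvar_nonzero flip: power_int_add) (auto simp: not_le Suc_diff_le algebra_simps intro!: arg_cong[of _ _ "power_int qvar"])
qed (simp add: kap_prod_def)

text \<open>The product over j < i consists of squares and carries no sign; only the remaining
  factor, the inverse of \<kappa> i, brings in the parity sign.\<close>

lemma dd_eq_D_entry: "i > 0 \<Longrightarrow> dd M i = qvar * (-1) ^ bar M i * D_entry M i"
proof -
  assume i: "i > 0"
  have "kap_prod M (i - 1) = qvar powi (if i \<le> M then 2 - 2 * int i else 2 * (int i - int M) - 2 - 2 * int M)"
    unfolding kap_prod_eq using i by (intro arg_cong[of _ _ "power_int qvar"]) (auto simp: of_nat_diff)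
  moreover have "qvar * qvar powi k = qvar powi (k + 1)" "inverse qvar * qvar powi k = qvar powi (k - 1)" for k
    by (simp_all add: power_int_add power_int_diff qvar_nonzero field_simps)
  ultimately show ?thesis
    by (simp add: dd_def kap_if D_entry_def bar_def algebra_simps)
qed

lemma rtt_scalars_kap: "rtt_scalars n (kap M) (\<lambda>i. inverse (kap M i)) (dd M) (kap_prod M)
    (\<lambda>i k. (-1) ^ (bar M i * bar M k)) (qvar - inverse qvar)"
proof
  fix i assume "i \<in> {1..n}"
  then have "kap_prod M i = kap_prod M (i - 1) * inverse (kap M i) ^ 2"
    by (cases i) (simp_all add: kap_prod_def)
  then show "dd M i * inverse (kap M i) = kap_prod M i"
    by (simp add: dd_def power2_eq_square)
  show "qvar - inverse qvar = kap M i - inverse (kap M i)" "kap M i * inverse (kap M i) = 1" "dd M i * kap M i = kap_prod M (i - 1)"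
    by (simp_all add: kap_if dd_def qvar_nonzero)
qed (simp_all add: kap_prod_def mult.commute flip: power_mult_distrib power_add)

locale quantum_affine =
  fixes M N :: nat and \<iota> :: "ratfun \<Rightarrow> ('m::len0, 'n::len0) smash"
  assumes M: "M = LENGTH('m)" and N: "N = LENGTH('n)" and iota: "\<iota> = sm_scalar" and MN: "M \<noteq> N"

sublocale quantum_affine \<subseteq> rtt_series_generic "M + N" "kap M" "\<lambda>i. inverse (kap M i)" "dd M" "kap_prod M"
  "\<lambda>i k. (-1) ^ (bar M i * bar M k)" "qvar - inverse qvar" \<iota>
proof -
  interpret s: rtt_scalars "M + N" "kap M" "\<lambda>i. inverse (kap M i)" "dd M" "kap_prod M"
    "\<lambda>i k. (-1) ^ (bar M i * bar M k)" "qvar - inverse qvar" by (rule rtt_scalars_kap)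
  interpret c: central_hom \<iota> unfolding iota by (rule sm.central_hom_axioms)
  show "rtt_series_generic (M + N) (kap M) (\<lambda>i. inverse (kap M i)) (dd M) (kap_prod M)
    (\<lambda>i k. (-1) ^ (bar M i * bar M k)) (qvar - inverse qvar) \<iota>"
  proof
    show "kap_prod M (M + N) \<noteq> 0" "kap_prod M (M + N) \<noteq> 1"
      using MN by (auto simp: kap_prod_eq qvar_nonzero qvar_powi_eq_1_iff)
    show "dd M i \<noteq> 0" for i by (simp add: dd_def kap_nonzero kap_prod_eq qvar_nonzero)
  qed
qed

section \<open>Entries of the graded products with the R-matrix\<close>

lemma bar_cases: "bar M i = 0 \<or> bar M i = 1"
  by (simp add: bar_def)

lemma sum_single:
  fixes f :: "nat \<Rightarrow> 'a::comm_monoid_add"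
  assumes "finite I" "i \<in> I" "\<And>j. j \<in> I \<Longrightarrow> j \<noteq> i \<Longrightarrow> f j = 0"
  shows "sum f I = f i"
  using assms by (simp add: sum.remove[of I i])

text \<open>This fits R, where E_ij \<otimes> E_kl occurs only if (j, l) is (i, k) or (k,
  i).\<close>

lemma sum_sum_pair:
  fixes F :: "nat \<Rightarrow> nat \<Rightarrow> 'a::comm_monoid_add"
  assumes "finite I" "i \<in> I" "k \<in> I"
    and F: "\<And>j l. j \<in> I \<Longrightarrow> l \<in> I \<Longrightarrow> \<not> (j = i \<and> l = k) \<Longrightarrow> \<not> (j = k \<and> l = i) \<Longrightarrow> F j l = 0"
  shows "(\<Sum>j\<in>I. \<Sum>l\<in>I. F j l) = F i k + (if i = k then 0 else F k i)"
proof -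
  have "(\<Sum>j\<in>I. \<Sum>l\<in>I. F j l) = (\<Sum>(j, l)\<in>I \<times> I. F j l)" by (simp add: sum.cartesian_product)
  also have "\<dots> = (\<Sum>(j, l)\<in>{(i, k), (k, i)}. F j l)"
    using assms(1-3) F by (intro sum.mono_neutral_right) auto
  also have "\<dots> = F i k + (if i = k then 0 else F k i)" by auto
  finally show ?thesis .
qed

lemma free_parity_funpow_0 [simp]: "(free_parity M ^^ p) 0 = 0"
  by (induction p) simp_all

lemma free_parity_funpow_gen:
  assumes "i \<in> idx M N" "j \<in> idx M N"
  shows "(free_parity M ^^ p) (free_L M N s r i j) = (-1) ^ (p * (bar M i + bar M j)) * free_L M N s r i j"
  using assms by (intro free_parity_funpow_sign) (simp add: free_L_def free_parity_gen)

lemma free_R_zero: "\<not> (i = j \<and> k = l) \<Longrightarrow> \<not> (i = l \<and> k = j) \<Longrightarrow> free_R M N g n i j k l = 0"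
proof -
  assume "\<not> (i = j \<and> k = l)" "\<not> (i = l \<and> k = j)"
  then have "R_poly M N 1 fps_X i j k l = 0"
    unfolding R_poly_def by presburger
  then show ?thesis
    by (simp add: free_R_def R_series_eq free_scalar_def)
qed

lemma free_R_parity:
  assumes "free_parity M g = g"
  shows "(free_parity M ^^ p) (free_R M N g n i j k l) = free_R M N g n i j k l"
proof (induction p)
  case (Suc p)
  then show ?case by (simp add: free_R_def free_parity_mult free_parity_power[OF assms])
qed simp

lemma stens_left:
  fixes r t \<nu> :: nat and s s' :: pm and g :: free_alg
  assumes "i \<in> idx M N" "m \<in> idx M N" "k \<in> idx M N" "n \<in> idx M N"
  defines "L \<equiv> free_L M N s r" and "L' \<equiv> free_L M N s' t" and "R \<equiv> free_R M N g \<nu>"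
  shows "stens_mult M N (free_parity M) (stens_mult M N (free_parity M) R (copy1 L)) (copy2 L') i m k n =
    (-1) ^ ((bar M i + bar M m) * (bar M k + bar M n)) * (R i i k k * (L i m * L' k n)) +
    (if i = k then 0 else (-1) ^ ((bar M k + bar M m) * (bar M k + bar M n)) * (R i k k i * (L k m * L' i n)))" (is "?l = ?r")
proof -
  let ?b = "bar M" and ?\<sigma> = "free_parity M"
  have 1: "stens_mult M N ?\<sigma> R (copy1 L) i m k l =
     (\<Sum>j\<in>idx M N. (-1) ^ ((?b k + ?b l) * (?b j + ?b m)) * (R i j k l * (?\<sigma> ^^ (?b i + ?b j + ?b k + ?b l)) (L j m)))"
    if "l \<in> idx M N" for l
  proof -
    have "(\<Sum>l'\<in>idx M N. (-1) ^ ((?b k + ?b l') * (?b j + ?b m)) *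
        (R i j k l' * (?\<sigma> ^^ (?b i + ?b j + ?b k + ?b l')) (copy1 L j m l' l))) =
        (-1) ^ ((?b k + ?b l) * (?b j + ?b m)) * (R i j k l * (?\<sigma> ^^ (?b i + ?b j + ?b k + ?b l)) (L j m))" for j
      using that by (subst sum_single[of _ l]) (simp_all add: copy1_def del: One_nat_def)
    then show ?thesis by (simp add: stens_mult_def)
  qed
  have "stens_mult M N ?\<sigma> (stens_mult M N ?\<sigma> R (copy1 L)) (copy2 L') i m k n =
     (\<Sum>j'\<in>idx M N. \<Sum>l\<in>idx M N. (-1) ^ ((?b k + ?b l) * (?b j' + ?b m)) *
       (stens_mult M N ?\<sigma> R (copy1 L) i j' k l * (?\<sigma> ^^ (?b i + ?b j' + ?b k + ?b l)) (copy2 L' j' m l n)))"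
    by (simp add: stens_mult_def)
  also have "\<dots> = (\<Sum>l\<in>idx M N. stens_mult M N ?\<sigma> R (copy1 L) i m k l * (?\<sigma> ^^ (?b i + ?b m + ?b k + ?b l)) (L' l n))"
    by (rule trans[OF sum_single[of _ m]])
      (use assms(2) in \<open>simp_all add: copy2_def minus_one_power_iff[of "_ * (bar M m + bar M m)"] del: One_nat_def\<close>)
  also have "\<dots> = (\<Sum>l\<in>idx M N. \<Sum>j\<in>idx M N. (-1) ^ ((?b k + ?b l) * (?b j + ?b m)) *
      (R i j k l * (?\<sigma> ^^ (?b i + ?b j + ?b k + ?b l)) (L j m)) * (?\<sigma> ^^ (?b i + ?b m + ?b k + ?b l)) (L' l n))"
    by (intro sum.cong refl) (simp add: 1 sum_distrib_right)
  also have "\<dots> = (-1) ^ ((?b k + ?b k) * (?b i + ?b m)) *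
      (R i i k k * (?\<sigma> ^^ (?b i + ?b i + ?b k + ?b k)) (L i m)) * (?\<sigma> ^^ (?b i + ?b m + ?b k + ?b k)) (L' k n)
     + (if k = i then 0 else (-1) ^ ((?b k + ?b i) * (?b k + ?b m)) *
      (R i k k i * (?\<sigma> ^^ (?b i + ?b k + ?b k + ?b i)) (L k m)) * (?\<sigma> ^^ (?b i + ?b m + ?b k + ?b i)) (L' i n))"
  proof (rule sum_sum_pair)
    show "(-1) ^ ((?b k + ?b l) * (?b j + ?b m)) * (R i j k l * (?\<sigma> ^^ (?b i + ?b j + ?b k + ?b l)) (L j m)) *
        (?\<sigma> ^^ (?b i + ?b m + ?b k + ?b l)) (L' l n) = 0" if "\<not> (l = k \<and> j = i)" "\<not> (l = i \<and> j = k)" for j l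
    proof -
      have "R i j k l = 0" unfolding R_def using that by (intro free_R_zero) auto
      then show ?thesis by simp
    qed
  qed (use assms(1,3) in simp_all)
  also have "\<dots> = ?r"
    unfolding L_def L'_def
      free_parity_funpow_gen[OF assms(1,2)] free_parity_funpow_gen[OF assms(3,4)]
      free_parity_funpow_gen[OF assms(3,2)] free_parity_funpow_gen[OF assms(1,4)]
    using bar_cases[of M i] bar_cases[of M k] bar_cases[of M m] bar_cases[of M n]
    by (elim disjE) (simp_all add: mult.assoc)
  finally show ?thesis .
qed

lemma stens_right:
  fixes r t \<nu> :: nat and s s' :: pm and g :: free_alg
  assumes "i \<in> idx M N" "m \<in> idx M N" "k \<in> idx M N" "n \<in> idx M N" and g: "free_parity M g = g"
  defines "L \<equiv> free_L M N s r" and "L' \<equiv> free_L M N s' t" and "R \<equiv> free_R M N g \<nu>"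
  shows "stens_mult M N (free_parity M) (stens_mult M N (free_parity M) (copy2 L') (copy1 L)) R i m k n =
    L' k n * L i m * R m m n n +
    (if m = n then 0 else (-1) ^ ((bar M k + bar M m) * (bar M m + bar M n)) * (L' k m * L i n * R n m m n))" (is "?l = ?r")
proof -
  let ?b = "bar M" and ?\<sigma> = "free_parity M"
  have 1: "stens_mult M N ?\<sigma> (copy2 L') (copy1 L) i j k l = L' k l * L i j" if jl: "j \<in> idx M N" "l \<in> idx M N" for j l
  proof -
    have "stens_mult M N ?\<sigma> (copy2 L') (copy1 L) i j k l =
      (\<Sum>l'\<in>idx M N. (-1) ^ ((?b k + ?b l') * (?b i + ?b j)) * (L' k l' * (?\<sigma> ^^ (?b i + ?b i + ?b k + ?b l')) (copy1 L i j l' l)))"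
      unfolding stens_mult_def using assms(1)
      by (subst sum_single[of _ i]) (simp_all add: copy2_def del: One_nat_def)
    also have "\<dots> = (-1) ^ ((?b k + ?b l) * (?b i + ?b j)) * (L' k l * (?\<sigma> ^^ (?b i + ?b i + ?b k + ?b l)) (L i j))"
      using jl by (subst sum_single[of _ l]) (simp_all add: copy1_def del: One_nat_def)
    also have "\<dots> = L' k l * L i j"
      unfolding L_def L'_def free_parity_funpow_gen[OF assms(1) jl(1)]
      using bar_cases[of M i] bar_cases[of M k] bar_cases[of M j] bar_cases[of M l]
      by (elim disjE) simp_all
    finally show ?thesis .
  qed
  have "stens_mult M N ?\<sigma> (stens_mult M N ?\<sigma> (copy2 L') (copy1 L)) R i m k n =
    (\<Sum>j\<in>idx M N. \<Sum>l\<in>idx M N. (-1) ^ ((?b k + ?b l) * (?b j + ?b m)) * (L' k l * L i j * R j m l n))"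
    by (subst stens_mult_def) (intro sum.cong refl, simp add: 1 R_def free_R_parity[OF g])
  also have "\<dots> = (-1) ^ ((?b k + ?b n) * (?b m + ?b m)) * (L' k n * L i m * R m m n n)
     + (if m = n then 0 else (-1) ^ ((?b k + ?b m) * (?b n + ?b m)) * (L' k m * L i n * R n m m n))"
  proof (rule sum_sum_pair)
    show "(-1) ^ ((?b k + ?b l) * (?b j + ?b m)) * (L' k l * L i j * R j m l n) = 0"
      if "\<not> (j = m \<and> l = n)" "\<not> (j = n \<and> l = m)" for j l
    proof -
      have "R j m l n = 0" unfolding R_def using that by (intro free_R_zero) auto
      then show ?thesis by simp
    qed
  qed (use assms(2,4) in simp_all)
  also have "\<dots> = ?r"
    using bar_cases[of M k] bar_cases[of M m] bar_cases[of M n]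
    by (elim disjE) simp_all
  finally show ?thesis .
qed

section \<open>Relations and center of the quotient algebra\<close>

lemma abs_uq_simps:
  "abs_uq (x + y) = (abs_uq x + abs_uq y :: ('m::len0, 'n::len0) uq)"
  "abs_uq (x * y) = (abs_uq x * abs_uq y :: ('m, 'n) uq)"
  "abs_uq (x - y) = (abs_uq x - abs_uq y :: ('m, 'n) uq)"
  "abs_uq 0 = (0 :: ('m, 'n) uq)" "abs_uq 1 = (1 :: ('m, 'n) uq)"
  "abs_uq (free_scalar c) = (uq_scalar c :: ('m, 'n) uq)"
  "abs_uq (free_gen h) = (uq_gen h :: ('m, 'n) uq)"
  by (simp_all add: plus_uq.abs_eq times_uq.abs_eq minus_uq.abs_eq zero_uq_def one_uq_def uq_scalar.abs_eq uq_gen.abs_eq)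

lemma abs_uq_sum: "abs_uq (sum f J) = (\<Sum>j\<in>J. abs_uq (f j) :: ('m::len0, 'n::len0) uq)"
  by (induction J rule: infinite_finite_induct) (simp_all add: abs_uq_simps)

lemma abs_uq_power: "abs_uq (x ^ p) = (abs_uq x ^ p :: ('m::len0, 'n::len0) uq)"
  by (induction p) (simp_all add: abs_uq_simps)

lemma abs_uq_sign: "abs_uq ((-1) ^ p * x) = ((-1) ^ p * abs_uq x :: ('m::len0, 'n::len0) uq)"
  using abs_uq_simps(3)[of 0 x, where 'm = 'm and 'n = 'n]
  by (cases "even p") (simp_all add: abs_uq_simps)

lemma abs_uq_relation:
  assumes "x \<in> uq_relations LENGTH('m) LENGTH('n)"
  shows "abs_uq x = (0 :: ('m::len0, 'n::len0) uq)"
  unfolding zero_uq_def uq.abs_eq_iff using two_sided_ideal.gen[OF assms, of 1 1] by simp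

lemma uq_parity_gen:
  "uq_parity (uq_gen h :: ('m::len0, 'n::len0) uq) = (-1) ^ gen_parity LENGTH('m) h * uq_gen h"
  unfolding abs_uq_simps(7)[symmetric] uq_parity.abs_eq free_parity_gen abs_uq_sign ..

lemma uq_parity_funpow_gen:
  "(uq_parity ^^ p) (uq_gen h :: ('m::len0, 'n::len0) uq) = (-1) ^ (p * gen_parity LENGTH('m) h) * uq_gen h"
proof (cases "even p")
  case False
  then have "(-1 :: ('m, 'n) uq) ^ (p * gen_parity LENGTH('m) h) = (-1) ^ gen_parity LENGTH('m) h"
    by (simp add: power_mult)
  then show ?thesis using False by (simp add: uq_parity_funpow uq_parity_gen)
qed (simp add: uq_parity_funpow)

lemma uq_center_gen:
  fixes x :: "('m::len0, 'n::len0) uq"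
  assumes gen: "\<And>h. x * uq_gen h = uq_gen h * x"
  shows "x \<in> center"
proof (rule centerI)
  fix y :: "('m, 'n) uq"
  have word: "x * abs_uq (Poly_Mapping.single (FWord hs) c) = abs_uq (Poly_Mapping.single (FWord hs) c) * x" for hs c
  proof (induction hs)
    case Nil
    have "Poly_Mapping.single (FWord []) c = free_scalar c"
      by (simp add: free_scalar_def zero_free_word_def)
    then show ?case by (simp add: abs_uq_simps uq_scalar_central)
  next
    case (Cons h hs)
    have "Poly_Mapping.single (FWord (h # hs)) c = free_gen h * Poly_Mapping.single (FWord hs) c"
      by (simp add: free_gen_def mult_single plus_free_word_def)
    then show ?case using Cons gen[of h] by (simp add: abs_uq_simps) (metis mult.assoc)
  qed
  have "x * abs_uq F = abs_uq F * x" for F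
  proof (induction F rule: free_alg_induct)
    case (add w c F)
    then show ?case using word[of "letters w" c] by (simp add: abs_uq_simps distrib_left distrib_right)
  qed (simp add: abs_uq_simps)
  then show "x * y = y * x"
    by (induction y rule: uq.abs_induct)
qed

lemma uq_GenQc_central: "(uq_gen GenQc :: ('m::len0, 'n::len0) uq) \<in> center"
proof (rule uq_center_gen)
  show "uq_gen GenQc * uq_gen h = uq_gen h * (uq_gen GenQc :: ('m, 'n) uq)" for h
    using abs_uq_relation[OF uq_relations.qc_central, of h, where 'm = 'm and 'n = 'n] by (simp add: abs_uq_simps)
qed

lemma center_inverse:
  assumes x: "x \<in> center" and y: "x * y = 1" "y * x = 1"
  shows "y \<in> center"
proof (rule centerI)
  fix b
  have "y * b = y * (b * (x * y))" by (simp add: y)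
  also have "\<dots> = y * (x * b) * y" by (simp only: centerD[OF x] mult.assoc)
  also have "\<dots> = b * y" by (simp add: y flip: mult.assoc)
  finally show "y * b = b * y" .
qed

lemma uq_GenQcInv_central: "(uq_gen GenQcInv :: ('m::len0, 'n::len0) uq) \<in> center"
proof (rule center_inverse[OF uq_GenQc_central])
  show "uq_gen GenQc * uq_gen GenQcInv = (1 :: ('m, 'n) uq)" "uq_gen GenQcInv * uq_gen GenQc = (1 :: ('m, 'n) uq)"
    using abs_uq_relation[OF uq_relations.qc_inverse_right, where 'm = 'm and 'n = 'n]
      abs_uq_relation[OF uq_relations.qc_inverse_left, where 'm = 'm and 'n = 'n]
    by (simp_all add: abs_uq_simps)
qed

lemma tw_center:
  assumes "x \<in> center" "uq_parity x = x"
  shows "tw x 0 \<in> center"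
proof (rule centerI)
  fix y :: "('a, 'b) smash"
  obtain a b where y: "y = SM a b" by (cases y)
  have "uq_parity (uq_parity b) = b" for b :: "('a, 'b) uq" by (rule uq_parity_involution)
  show "tw x 0 * y = y * tw x 0"
    by (simp add: y tw_def assms(2) centerD[OF assms(1)])
qed

section \<open>The relations of the quantum algebra in ungraded form\<close>

context quantum_affine
begin

abbreviation "\<rho> \<equiv> \<alpha>_series M N"

abbreviation rll_term :: "free_alg \<Rightarrow> nat \<Rightarrow> ratfun fps \<Rightarrow> ratfun fps \<Rightarrow> ('m, 'n) smash \<Rightarrow> ('m, 'n) smash \<Rightarrow> ('m, 'n) smash" where
  "rll_term g \<nu> a b x y \<equiv> fps_nth (\<rho> * a) \<nu> *s (tw (abs_uq g) 0 ^ \<nu> * x) + fps_nth (\<rho> * b) \<nu> *s (tw (abs_uq g) 0 ^ \<nu> * y)"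

text \<open>The twist by \<open>\<tau>\<close> turns the graded relations into ungraded ones, and \<open>q\<^sub>i\<close> into \<open>\<kappa> i\<close>.\<close>
definition T :: "pm \<Rightarrow> nat \<Rightarrow> nat \<Rightarrow> ('m, 'n) smash fps" where
  "T s i m = twf (uq_L s i m) (bar M i)"

lemma T_nth: "T s i m $ r = tw (uq_gen (GenL s i m r)) (bar M i)"
  by (simp add: T_def uq_L_def)

lemma tw_product:
  "tw (uq_gen (GenL s i m r) * uq_gen (GenL s' k l t)) (bar M i + bar M k) =
    (-1) ^ (bar M i * (bar M k + bar M l)) * (T s i m $ r * T s' k l $ t)"
proof -
  have "T s i m $ r * T s' k l $ t =
    (-1) ^ (bar M i * (bar M k + bar M l)) * tw (uq_gen (GenL s i m r) * uq_gen (GenL s' k l t)) (bar M i + bar M k)"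
    unfolding T_nth tw_mult uq_parity_funpow_gen
    by (cases "even (bar M i * (bar M k + bar M l))") (simp_all add: M tw_uminus)
  then show ?thesis by (simp flip: mult.assoc power_add)
qed

lemma tw_term:
  "tw (abs_uq ((-1) ^ p * (free_R M N g \<nu> i j k l * x))) q =
    (-1) ^ p * (fps_nth (R_series M N i j k l) \<nu> *s (tw (abs_uq g) 0 ^ \<nu> * tw (abs_uq x) q))"
proof -
  have 1: "tw G 0 * tw y q = tw (G * y) q" for G y :: "('m, 'n) uq"
    by (simp add: tw_mult)
  have "tw (G ^ \<nu> * y) q = tw G 0 ^ \<nu> * tw y q" for G y :: "('m, 'n) uq"
    by (induction \<nu>) (simp_all add: mult.assoc flip: 1)
  then show ?thesis
    unfolding abs_uq_sign tw_sign scale_def iota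
    by (simp add: free_R_def abs_uq_simps abs_uq_power mult.assoc sm.scale_def flip: sm_scalar_mult_tw)
qed

lemma sign_mult_fps_nth: "fps_nth ((-1) ^ p * f) r = (-1) ^ p * fps_nth (f :: ratfun fps) r"
  by (cases "even p") simp_all

text \<open>For i = k the sign turns q_i into \<kappa> i; for other pairs it cancels the factor
  \<theta> of the ungraded matrix.\<close>

lemma R_series_diag:
  assumes "i \<in> I" "k \<in> I"
  shows "R_series M N i i k k = (-1) ^ (bar M i * bar M k) * (\<rho> * ser.A 1 fps_X i k)"
proof -
  have [simp]: "fps_const ((-1) ^ p) = ((-1) ^ p :: ratfun fps)" for p
    by (cases "even p") simp_all
  have "R_poly M N 1 fps_X i i k k = (-1) ^ (bar M i * bar M k) * ser.A 1 fps_X i k"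
    using assms bar_cases[of M i] unfolding R_poly_def ser.A_def unfolding kap_def
    by (auto simp: algebra_simps simp flip: fps_const_neg power_add)
  then show ?thesis by (simp add: R_series_eq mult.left_commute)
qed

lemma R_series_off:
  assumes "i \<in> I" "k \<in> I" "i \<noteq> k"
  shows "R_series M N i k k i = (-1) ^ bar M k * (\<rho> * ser.B 1 fps_X i k)"
proof -
  have "R_poly M N 1 fps_X i k k i = (-1) ^ bar M k * ser.B 1 fps_X i k"
    using assms unfolding R_poly_def ser.B_def
    by (auto simp: qi_def bar_def algebra_simps simp flip: fps_const_neg)
  then show ?thesis by (simp add: R_series_eq mult.left_commute)
qed

lemma sign_pull:
  "(-1) ^ a * (((-1) ^ b * c) *s (y * ((-1) ^ e * x))) = (-1) ^ (a + b + e) * (c *s (y * x))"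
  by (cases "even a"; cases "even b"; cases "even e") simp_all

lemma sign_cong: "even (a + b) \<Longrightarrow> (-1) ^ a * x = (-1) ^ b * (x :: ('m, 'n) smash)"
  by (cases "even a") simp_all

text \<open>After the twist by \<tau>^(i+k) all signs combine into one that is common to both
  summands. It is the same as in \<open>right_term\<close> and therefore drops out of the
  relation.\<close>

lemma left_term:
  assumes I: "i \<in> I" "m \<in> I" "k \<in> I" "l \<in> I"
  shows "tw (abs_uq (stens_mult M N (free_parity M) (stens_mult M N (free_parity M) (free_R M N g \<nu>) (copy1 (free_L M N s r)))
      (copy2 (free_L M N s' t)) i m k l)) (bar M i + bar M k) =
    (-1) ^ (bar M i * bar M k + bar M k * bar M m + bar M m * bar M l) *
     (rll_term g \<nu> (ser.A 1 fps_X i k) (ser.B 1 fps_X i k)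
       (T s i m $ r * T s' k l $ t) (T s k m $ r * T s' i l $ t))"
    (is "_ = (-1) ^ ?e * (?U + ?V)")
proof -
  have prod: "tw (abs_uq (free_L M N s r i m * free_L M N s' t k l)) (bar M i + bar M k) =
      (-1) ^ (bar M i * (bar M k + bar M l)) * (T s i m $ r * T s' k l $ t)"
    if "i \<in> I" "m \<in> I" "k \<in> I" "l \<in> I" for i m k l
    unfolding free_L_def abs_uq_simps(2) using that by (simp add: abs_uq_simps tw_product)
  have V: "tw (abs_uq (if i = k then 0 else (-1) ^ ((bar M k + bar M m) * (bar M k + bar M l)) *
      (free_R M N g \<nu> i k k i * (free_L M N s r k m * free_L M N s' t i l)))) (bar M i + bar M k) = (-1) ^ ?e * ?V"
  proof (cases "i = k")
    case True
    then show ?thesis by (simp add: abs_uq_simps)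
  next
    case False
    show ?thesis
      unfolding if_not_P[OF False] tw_term R_series_off[OF I(1,3) False] sign_mult_fps_nth
        prod[OF I(3,2,1,4), unfolded add.commute[of "bar M k" "bar M i"]] sign_pull
      by (rule sign_cong) auto
  qed
  show ?thesis
    unfolding distrib_left[of "(-1) ^ ?e" ?U ?V] stens_left[OF I] abs_uq_simps(1) tw_add V tw_term R_series_diag[OF I(1,3)] sign_mult_fps_nth prod[OF I] sign_pull
    by (rule arg_cong2[of _ _ _ _ "(+)"], rule sign_cong) auto
qed

lemma right_term:
  assumes I: "i \<in> I" "m \<in> I" "k \<in> I" "l \<in> I" and g: "free_parity M g = g" "(abs_uq g :: ('m, 'n) uq) \<in> center"
  shows "tw (abs_uq (stens_mult M N (free_parity M) (stens_mult M N (free_parity M) (copy2 (free_L M N s' t)) (copy1 (free_L M N s r)))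
      (free_R M N g \<nu>) i m k l)) (bar M i + bar M k) =
    (-1) ^ (bar M i * bar M k + bar M k * bar M m + bar M m * bar M l) *
     (rll_term g \<nu> (ser.A 1 fps_X m l) (ser.B 1 fps_X l m)
       (T s' k l $ t * T s i m $ r) (T s' k m $ t * T s i l $ r))"
    (is "_ = (-1) ^ ?e * (?U + ?V)")
proof -
  have prod: "tw (abs_uq (free_L M N s' t k l * free_L M N s r i m)) (bar M i + bar M k) =
      (-1) ^ (bar M k * (bar M i + bar M m)) * (T s' k l $ t * T s i m $ r)"
    if "i \<in> I" "m \<in> I" "k \<in> I" "l \<in> I" for i m k l
    unfolding free_L_def abs_uq_simps(2) add.commute[of "bar M i" "bar M k"] using that by (simp add: abs_uq_simps tw_product)
  have comm: "(tw (abs_uq (x * free_R M N g \<nu> i j k l)) q :: ('m, 'n) smash) = tw (abs_uq ((-1) ^ 0 * (free_R M N g \<nu> i j k l * x))) q" for x i j k l q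
  proof -
    have "(abs_uq (free_R M N g \<nu> i j k l) :: ('m, 'n) uq) \<in> center"
      unfolding free_R_def abs_uq_simps abs_uq_power
      by (intro center_mult center_power g centerI uq_scalar_central)
    then show ?thesis by (simp add: abs_uq_simps centerD)
  qed
  have comm': "(tw (abs_uq ((-1) ^ p * (x * free_R M N g \<nu> i j k l))) q :: ('m, 'n) smash) = tw (abs_uq ((-1) ^ p * (free_R M N g \<nu> i j k l * x))) q" for p x i j k l q
    using comm[of x i j k l q] unfolding abs_uq_sign tw_sign by simp
  have V: "tw (abs_uq (if m = l then 0 else (-1) ^ ((bar M k + bar M m) * (bar M m + bar M l)) *
      (free_L M N s' t k m * free_L M N s r i l * free_R M N g \<nu> l m m l))) (bar M i + bar M k) = (-1) ^ ?e * ?V"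
  proof (cases "m = l")
    case True
    then show ?thesis by (simp add: abs_uq_simps)
  next
    case False
    show ?thesis
      unfolding if_not_P[OF False] comm' tw_term R_series_off[OF I(4,2) not_sym[OF False]] sign_mult_fps_nth
        prod[OF I(1,4,3,2)] sign_pull
      by (rule sign_cong) auto
  qed
  show ?thesis
    unfolding distrib_left[of "(-1) ^ ?e" ?U ?V] stens_right[OF I g(1)] abs_uq_simps(1) tw_add V comm tw_term R_series_diag[OF I(2,4)] sign_mult_fps_nth prod[OF I] sign_pull
    by (rule arg_cong2[of _ _ _ _ "(+)"], rule sign_cong) auto
qed

lemma rll_smash:
  assumes I: "i \<in> I" "m \<in> I" "k \<in> I" "l \<in> I"
    and g': "free_parity M g' = g'" "(abs_uq g' :: ('m, 'n) uq) \<in> center"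
    and rel: "rll_left M N g s s' a b i m k l - rll_right M N g' s s' a b i m k l \<in> uq_relations M N"
  shows "(\<Sum>(\<nu>, r, t)\<in>rll_terms s s' a b.
      rll_term g \<nu> (ser.A 1 fps_X i k) (ser.B 1 fps_X i k)
       (T s i m $ r * T s' k l $ t) (T s k m $ r * T s' i l $ t)) =
    (\<Sum>(\<nu>, r, t)\<in>rll_terms s s' a b.
      rll_term g' \<nu> (ser.A 1 fps_X m l) (ser.B 1 fps_X l m)
       (T s' k l $ t * T s i m $ r) (T s' k m $ t * T s i l $ r))"
    (is "?x = ?y")
proof -
  let ?e = "bar M i * bar M k + bar M k * bar M m + bar M m * bar M l"
  have "abs_uq (rll_left M N g s s' a b i m k l) = (abs_uq (rll_right M N g' s s' a b i m k l) :: ('m, 'n) uq)"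
    using abs_uq_relation[OF rel[unfolded M N]] by (simp add: abs_uq_simps M N)
  then have "tw (abs_uq (rll_left M N g s s' a b i m k l) :: ('m, 'n) uq) (bar M i + bar M k) =
      tw (abs_uq (rll_right M N g' s s' a b i m k l)) (bar M i + bar M k)" by simp
  then have "(-1) ^ ?e * ?x = (-1) ^ ?e * ?y"
    unfolding rll_left_def rll_right_def abs_uq_sum tw_sum case_prod_unfold left_term[OF I] right_term[OF I g'] sum_distrib_left .
  then have "(-1) ^ ?e * ((-1) ^ ?e * ?x) = (-1) ^ ?e * ((-1) ^ ?e * ?y)" by simp
  then show ?thesis by (simp flip: mult.assoc power_add)
qed

lemma rll_mixed_T: "rll_mixed \<rho> (tw (uq_gen GenQcInv) 0) (tw (uq_gen GenQc) 0) (T Plus) (T Minus)"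
  unfolding rll_mixed_def
proof (intro ballI allI, goal_cases)
  case I: (1 i m k l a b)
  \<comment> \<open>In the monomial z^-a w^b the term \<nu> of R takes \<nu> from both exponents, so
    \<nu> runs up to the smaller one.\<close>
  have terms: "(\<Sum>(\<nu>, r, t)\<in>rll_terms Plus Minus (- int a) (int b). F \<nu> r t) = (\<Sum>\<nu>\<le>min a b. F \<nu> (a - \<nu>) (b - \<nu>))"
    for F :: "nat \<Rightarrow> nat \<Rightarrow> nat \<Rightarrow> ('m, 'n) smash"
    by (rule sum.reindex_bij_witness[of _ "\<lambda>\<nu>. (\<nu>, a - \<nu>, b - \<nu>)" fst]) (auto simp: rll_terms_def intro!: arg_cong2[of _ _ _ _ "F _"])
  have "rll_left M N (free_gen GenQcInv) Plus Minus (- int a) (int b) i m k l -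
      rll_right M N (free_gen GenQc) Plus Minus (- int a) (int b) i m k l \<in> uq_relations M N"
    using I by (intro uq_relations.rll_mixed)
  from rll_smash[OF I _ _ this]
  show ?case
    unfolding terms conv_def by (simp add: free_parity_gen abs_uq_simps uq_GenQc_central sum.distrib)
qed

lemma series_nth_linear:
  "fps_nth (x * ser.A 1 fps_X i k) r = fps_nth x r * A 1 0 i k + (if r = 0 then 0 else fps_nth x (r - 1) * A 0 1 i k)"
  "fps_nth (x * ser.B 1 fps_X i k) r = fps_nth x r * B 1 0 i k + (if r = 0 then 0 else fps_nth x (r - 1) * B 0 1 i k)"
proof -
  have "ser.A 1 fps_X i k = fps_const (A 1 0 i k) + fps_X * fps_const (A 0 1 i k)"
    "ser.B 1 fps_X i k = fps_const (B 1 0 i k) + fps_X * fps_const (B 0 1 i k)"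
    by (auto simp: ser.A_def A_def ser.B_def B_def algebra_simps simp flip: fps_const_neg)
  then show "fps_nth (x * ser.A 1 fps_X i k) r = fps_nth x r * A 1 0 i k + (if r = 0 then 0 else fps_nth x (r - 1) * A 0 1 i k)"
    "fps_nth (x * ser.B 1 fps_X i k) r = fps_nth x r * B 1 0 i k + (if r = 0 then 0 else fps_nth x (r - 1) * B 0 1 i k)"
    by (simp_all add: distrib_left mult.left_commute[of x fps_X])
qed

text \<open>R(1, u) = R(1, 0) + u R(0, 1), and the factor u lowers the index of the scalar series by
  one.\<close>

lemma rll_same_defect:
  fixes s
  assumes I: "i \<in> I" "m \<in> I" "k \<in> I" "l \<in> I"
  defines "D \<equiv> \<lambda>z w r t. defect z w (\<lambda>i m. T s i m $ r) (\<lambda>k l. T s k l $ t) i m k l"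
  shows "(\<Sum>(\<nu>, r, t)\<in>rll_terms s s a b. fps_nth \<rho> \<nu> *s D 1 0 r t +
     (if \<nu> = 0 then 0 else fps_nth \<rho> (\<nu> - 1) *s D 0 1 r t)) = 0"
proof -
  have "rll_left M N 1 s s a b i m k l - rll_right M N 1 s s a b i m k l \<in> uq_relations M N"
    using I by (intro uq_relations.rll_same)
  note R = rll_smash[OF I _ _ this]
  have one: "(tw (abs_uq 1) 0 :: ('m, 'n) smash) ^ \<nu> * x = x" for \<nu> x
    by (simp add: abs_uq_simps tw_1)
  have "fps_nth \<rho> \<nu> *s D 1 0 r t + (if \<nu> = 0 then 0 else fps_nth \<rho> (\<nu> - 1) *s D 0 1 r t) =
      (fps_nth (\<rho> * ser.A 1 fps_X i k) \<nu> *s (T s i m $ r * T s k l $ t) +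
      fps_nth (\<rho> * ser.B 1 fps_X i k) \<nu> *s (T s k m $ r * T s i l $ t)) -
      (fps_nth (\<rho> * ser.A 1 fps_X m l) \<nu> *s (T s k l $ t * T s i m $ r) +
      fps_nth (\<rho> * ser.B 1 fps_X l m) \<nu> *s (T s k m $ t * T s i l $ r))" for \<nu> r t
    unfolding D_def defect_def series_nth_linear
    by (simp add: scale_left_distrib scale_right_distrib scale_right_diff_distrib)
  then show ?thesis
    using R unfolding one by (simp add: center_1 abs_uq_simps case_prod_unfold sum_subtractf)
qed

lemma rll_coeffs_T: "rll_coeffs 1 0 0 1 (T Plus) (T Plus)" "rll_coeffs 0 1 1 0 (T Minus) (T Minus)"
  unfolding rll_coeffs_def
proof (safe intro!: ballI allI)
  fix i m k l a b assume I: "i \<in> I" "m \<in> I" "k \<in> I" "l \<in> I"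
  define D where "D s z w r t = defect z w (\<lambda>i m. T s i m $ r) (\<lambda>k l. T s k l $ t) i m k l" for s z w r t
  note \<alpha> = \<alpha>_series_nth_0[OF MN]
  note rel = rll_same_defect[OF I, folded D_def]
  \<comment> \<open>Here w/z = p/q, and R(1, p/q) becomes R(q, p) on multiplication by q = w^-1. The
    coefficient of p^a q^b is thus that of z^-a w^(1-b) in the original relation.\<close>
  have plus: "(\<Sum>(\<nu>, r, t)\<in>rll_terms Plus Plus (- int a) (1 - int b). F \<nu> r t) =
      (\<Sum>\<nu>\<le>a. if \<nu> + b = 0 then 0 else F \<nu> (a - \<nu>) (\<nu> + b - 1))" (is "?l = ?r") for F :: "nat \<Rightarrow> nat \<Rightarrow> nat \<Rightarrow> ('m, 'n) smash" and a b
  proof -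
    have "?l =
       (\<Sum>\<nu>\<in>{\<nu>. \<nu> \<le> a \<and> \<nu> + b \<noteq> 0}. F \<nu> (a - \<nu>) (\<nu> + b - 1))"
      by (rule sum.reindex_bij_witness[of _ "\<lambda>\<nu>. (\<nu>, a - \<nu>, \<nu> + b - 1)" fst]) (auto simp: rll_terms_def intro!: arg_cong2[of _ _ _ _ "F _"])
    also have "\<dots> = ?r"
      by (rule sum.mono_neutral_cong_left) auto
    finally show ?thesis .
  qed
  have "(if b = 0 then 0 else D Plus 1 0 a (b - 1)) + (if a = 0 then 0 else D Plus 0 1 (a - 1) b) = 0"
  proof (rule strip_series[OF \<alpha>])
    fix a b
    show "(\<Sum>\<nu>\<le>a. (if \<nu> + b = 0 then 0 else fps_nth \<rho> \<nu> *s D Plus 1 0 (a - \<nu>) (\<nu> + b - 1)) +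
        (if \<nu> = 0 then 0 else fps_nth \<rho> (\<nu> - 1) *s D Plus 0 1 (a - \<nu>) (\<nu> + b - 1))) = 0"
      using rel[of Plus "- int a" "1 - int b"] unfolding plus
      by (subst (asm) sum.cong[OF refl]) (auto cong: if_cong)
  qed
  then show "(if b = 0 then 0 else defect 1 0 (\<lambda>i m. T Plus i m $ a) (\<lambda>k l. T Plus k l $ (b - 1)) i m k l) +
     (if a = 0 then 0 else defect 0 1 (\<lambda>i m. T Plus i m $ (a - 1)) (\<lambda>k l. T Plus k l $ b) i m k l) = 0"
    unfolding D_def .
  \<comment> \<open>Now w/z = q/p and the relation is multiplied by p = z, hence the exponent a - 1.
    The terms of R lower the degree in q, so \<open>strip_series\<close> is applied with a and b
    exchanged.\<close>
  have minus: "(\<Sum>(\<nu>, r, t)\<in>rll_terms Minus Minus (int a - 1) (int b). F \<nu> r t) =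
      (\<Sum>\<nu>\<le>b. if \<nu> + a = 0 then 0 else F \<nu> (\<nu> + a - 1) (b - \<nu>))" (is "?l = ?r") for F :: "nat \<Rightarrow> nat \<Rightarrow> nat \<Rightarrow> ('m, 'n) smash" and a b
  proof -
    have "?l =
       (\<Sum>\<nu>\<in>{\<nu>. \<nu> \<le> b \<and> \<nu> + a \<noteq> 0}. F \<nu> (\<nu> + a - 1) (b - \<nu>))"
      by (rule sum.reindex_bij_witness[of _ "\<lambda>\<nu>. (\<nu>, \<nu> + a - 1, b - \<nu>)" fst]) (auto simp: rll_terms_def intro!: arg_cong2[of _ _ _ _ "F _"])
    also have "\<dots> = ?r"
      by (rule sum.mono_neutral_cong_left) auto
    finally show ?thesis .
  qed
  have "(if a = 0 then 0 else (\<lambda>x y. D Minus 1 0 y x) b (a - 1)) + (if b = 0 then 0 else (\<lambda>x y. D Minus 0 1 y x) (b - 1) a) = 0"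
  proof (rule strip_series[OF \<alpha>])
    fix a b
    show "(\<Sum>\<nu>\<le>a. (if \<nu> + b = 0 then 0 else fps_nth \<rho> \<nu> *s D Minus 1 0 (\<nu> + b - 1) (a - \<nu>)) +
        (if \<nu> = 0 then 0 else fps_nth \<rho> (\<nu> - 1) *s D Minus 0 1 (\<nu> + b - 1) (a - \<nu>))) = 0"
      using rel[of Minus "int b - 1" "int a"] unfolding minus
      by (subst (asm) sum.cong[OF refl]) (auto cong: if_cong)
  qed
  then show "(if b = 0 then 0 else defect 0 1 (\<lambda>i m. T Minus i m $ a) (\<lambda>k l. T Minus k l $ (b - 1)) i m k l) +
     (if a = 0 then 0 else defect 1 0 (\<lambda>i m. T Minus i m $ (a - 1)) (\<lambda>k l. T Minus k l $ b) i m k l) = 0"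
    unfolding D_def by (simp only: add.commute)
qed

end

section \<open>Inverses of the generating matrices\<close>

lemma triangular_idx_inverse:
  fixes A :: "nat \<Rightarrow> nat \<Rightarrow> 'a::ring_1"
  assumes "(\<forall>i\<in>{1..n}. \<forall>j\<in>{1..n}. i < j \<longrightarrow> A j i = 0) \<or> (\<forall>i\<in>{1..n}. \<forall>j\<in>{1..n}. i < j \<longrightarrow> A i j = 0)"
    and "\<And>i. i \<in> {1..n} \<Longrightarrow> \<exists>u. A i i * u = 1 \<and> u * A i i = 1"
  shows "\<exists>B. mat_inverse {1..n} A B"
proof -
  have set: "set [1..<Suc n] = {1..n}" "set (rev [1..<Suc n]) = {1..n}" by auto
  have sorted: "sorted_wrt (<) [1..<Suc n]" by (rule sorted_wrt_upt)
  from assms(1) show ?thesis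
  proof
    assume *: "\<forall>i\<in>{1..n}. \<forall>j\<in>{1..n}. i < j \<longrightarrow> A j i = 0"
    have "sorted_wrt (\<lambda>i j. A j i = 0) [1..<Suc n]"
      by (rule sorted_wrt_mono_rel[OF _ sorted]) (use * in auto)
    then show ?thesis using triangular_mat_inverse[of "[1..<Suc n]" A] assms(2) unfolding set by simp
  next
    assume *: "\<forall>i\<in>{1..n}. \<forall>j\<in>{1..n}. i < j \<longrightarrow> A i j = 0"
    have "sorted_wrt (\<lambda>i j. A i j = 0) [1..<Suc n]"
      by (rule sorted_wrt_mono_rel[OF _ sorted]) (use * in auto)
    then have "sorted_wrt (\<lambda>i j. A j i = 0) (rev [1..<Suc n])"
      by (simp only: sorted_wrt_rev)
    then show ?thesis using triangular_mat_inverse[of "rev [1..<Suc n]" A] assms(2) unfolding set by simp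
  qed
qed

lemma fps_compose_scale_nth:
  fixes f :: "'a::ring_1 fps"
  shows "fps_nth (f oo (fps_const c * fps_X)) r = fps_nth f r * c ^ r"
proof -
  have "(fps_const c * fps_X) ^ i = fps_const (c ^ i) * fps_X ^ i" for i
  proof (induction i)
    case (Suc i)
    have "(fps_const c * fps_X) ^ Suc i = fps_const c * (fps_X * fps_const (c ^ i)) * fps_X ^ i"
      by (simp add: Suc mult.assoc)
    also have "fps_X * fps_const (c ^ i) = fps_const (c ^ i) * fps_X"
      by (rule fps_ext) simp
    finally show ?case by (simp add: mult.assoc flip: fps_const_mult)
  qed simp
  then have "fps_nth (f oo (fps_const c * fps_X)) r = (\<Sum>i=0..r. if i = r then fps_nth f i * c ^ i else 0)"
    unfolding fps_compose_nth by (intro sum.cong refl) (simp add: fps_X_power_nth)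
  then show ?thesis by simp
qed

context quantum_affine
begin

abbreviation "\<sigma> \<equiv> (fps_parity :: ('m, 'n) uq fps \<Rightarrow> _)"

definition L :: "pm \<Rightarrow> ('m, 'n) uq fps smat" where "L s = uq_L s"

lemma L_nth: "L s i j $ r = uq_gen (GenL s i j r)"
  by (simp add: L_def uq_L_def)

lemma uq_gen_zero:
  assumes "i \<in> I" "j \<in> I" "i < j"
  shows "(uq_gen (GenL Plus j i 0) :: ('m, 'n) uq) = 0" "(uq_gen (GenL Minus i j 0) :: ('m, 'n) uq) = 0"
  using assms abs_uq_relation[OF uq_relations.plus_zero, of i j, where 'm = 'm and 'n = 'n]
    abs_uq_relation[OF uq_relations.minus_zero, of i j, where 'm = 'm and 'n = 'n]
  by (simp_all add: abs_uq_simps M N)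

definition opp :: "pm \<Rightarrow> pm" where "opp s = (case s of Plus \<Rightarrow> Minus | Minus \<Rightarrow> Plus)"

lemma uq_gen_diag:
  assumes "i \<in> I"
  shows "uq_gen (GenL s i i 0) * uq_gen (GenL (opp s) i i 0) = (1 :: ('m, 'n) uq)"
  using assms abs_uq_relation[OF uq_relations.minus_plus_diag, of i, where 'm = 'm and 'n = 'n]
    abs_uq_relation[OF uq_relations.plus_minus_diag, of i, where 'm = 'm and 'n = 'n]
  by (cases s) (simp_all add: abs_uq_simps M N opp_def)

lemma opp_opp [simp]: "opp (opp s) = s"
  by (cases s) (simp_all add: opp_def)

lemma L_triangular:
  "(\<forall>i\<in>I. \<forall>j\<in>I. i < j \<longrightarrow> fps_nth (L s j i) 0 = 0) \<or> (\<forall>i\<in>I. \<forall>j\<in>I. i < j \<longrightarrow> fps_nth (L s i j) 0 = 0)"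
  by (cases s) (simp_all add: L_nth uq_gen_zero del: One_nat_def)

lemma L_parity: "\<sigma> (L s i j) = (-1) ^ (bar M i + bar M j) * L s i j"
  by (rule fps_ext) (cases "even (bar M i + bar M j)"; simp add: L_nth uq_parity_gen M)

lemma fsign_mult: "(-1) ^ p * x * ((-1) ^ q * y) = (-1) ^ (p + q) * (x * y)" for x y :: "('m, 'n) uq fps"
  by (cases "even p"; cases "even q") simp_all

lemma fsign_commute: "(-1) ^ p * ((-1) ^ q * x) = (-1) ^ q * ((-1) ^ p * x)" for x :: "('m, 'n) uq fps"
  by (simp add: add.commute flip: mult.assoc power_add)

lemma fsign_add: "(-1) ^ p * ((-1) ^ q * x) = (-1) ^ (p + q) * x" for x :: "('m, 'n) uq fps"
  by (simp add: power_add mult.assoc)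

lemma fsign_cong: "even (p + q) \<Longrightarrow> (-1) ^ p * x = (-1) ^ q * x" for x :: "('m, 'n) uq fps"
  by (cases "even p") simp_all

lemma fsign_even: "even p \<Longrightarrow> (-1) ^ p * x = x" for x :: "('m, 'n) uq fps"
  by simp

lemma fsign_nth: "fps_nth ((-1) ^ p * f) r = (-1) ^ p * fps_nth f r" for f :: "('m, 'n) uq fps"
  by (cases "even p") simp_all

lemma sigma_funpow:
  assumes "\<sigma> x = (-1) ^ p * x"
  shows "(\<sigma> ^^ q) x = (-1) ^ (q * p) * x"
  using assms by (cases "even q") (auto simp: fps_parity_funpow power_mult)

text \<open>The sign in the multiplication of even matrices is a coboundary.\<close>
lemma smat_mult_even:
  fixes X Z :: "('m, 'n) uq fps smat"
  assumes "\<And>j. j \<in> I \<Longrightarrow> \<sigma> (Z j k) = (-1) ^ (bar M j + bar M k) * Z j k" and I: "i \<in> I" "k \<in> I"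
  shows "smat_mult M N \<sigma> (\<lambda>i j. (-1) ^ (bar M j * (bar M i + 1)) * X i j)
      (\<lambda>i j. if i \<in> I \<and> j \<in> I then (-1) ^ (bar M j * (bar M i + 1)) * Z i j else 0) i k =
    (-1) ^ (bar M k * (bar M i + 1)) * mat_mult I X Z i k"
proof -
  have "(-1) ^ (bar M j * (bar M i + 1)) * X i j * (\<sigma> ^^ (bar M i + bar M j)) (if j \<in> I \<and> k \<in> I then (-1) ^ (bar M k * (bar M j + 1)) * Z j k else 0) =
    (-1) ^ (bar M k * (bar M i + 1)) * (X i j * Z j k)" if j: "j \<in> I" for j
  proof -
    have "\<sigma> ((-1) ^ (bar M k * (bar M j + 1)) * Z j k) = (-1) ^ (bar M j + bar M k) * ((-1) ^ (bar M k * (bar M j + 1)) * Z j k)"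
      unfolding fps_parity_sign assms(1)[OF j] by (simp add: add.commute flip: mult.assoc power_add)
    from sigma_funpow[OF this] show ?thesis
      using j I by (simp only: simp_thms if_True mult.assoc[of "_ ^ _" "_ ^ _" "Z j k", symmetric] power_add[symmetric] fsign_mult)
        (rule fsign_cong, auto)
  qed
  then show ?thesis
    using I by (simp only: smat_mult_def mat_mult_def sum_distrib_left simp_thms if_True cong: sum.cong)
qed

lemma smat_mult_even':
  fixes X Z :: "('m, 'n) uq fps smat"
  assumes "\<And>j. j \<in> I \<Longrightarrow> \<sigma> (Z j k) = (-1) ^ (bar M j + bar M k) * Z j k" and I: "i \<in> I" "k \<in> I"
  shows "smat_mult M N \<sigma> (\<lambda>i j. if i \<in> I \<and> j \<in> I then (-1) ^ (bar M j * (bar M i + 1)) * X i j else 0)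
      (\<lambda>i j. (-1) ^ (bar M j * (bar M i + 1)) * Z i j) i k =
    (-1) ^ (bar M k * (bar M i + 1)) * mat_mult I X Z i k"
proof -
  have "smat_mult M N \<sigma> (\<lambda>i j. if i \<in> I \<and> j \<in> I then (-1) ^ (bar M j * (bar M i + 1)) * X i j else 0)
      (\<lambda>i j. (-1) ^ (bar M j * (bar M i + 1)) * Z i j) i k =
    smat_mult M N \<sigma> (\<lambda>i j. (-1) ^ (bar M j * (bar M i + 1)) * X i j)
      (\<lambda>i j. if i \<in> I \<and> j \<in> I then (-1) ^ (bar M j * (bar M i + 1)) * Z i j else 0) i k"
    using I by (simp only: smat_mult_def simp_thms if_True cong: sum.cong)
  also have "\<dots> = (-1) ^ (bar M k * (bar M i + 1)) * mat_mult I X Z i k"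
    by (rule smat_mult_even) (use assms in auto)
  finally show ?thesis .
qed

definition even_inverse :: "('m, 'n) uq fps smat \<Rightarrow> ('m, 'n) uq fps smat \<Rightarrow> bool" where
  "even_inverse X y \<longleftrightarrow> (\<forall>i j. \<not> (i \<in> I \<and> j \<in> I) \<longrightarrow> y i j = 0) \<and>
    smat_mult M N \<sigma> X y = smat_diag M N (\<lambda>_. 1) \<and> smat_mult M N \<sigma> y X = smat_diag M N (\<lambda>_. 1) \<and>
    (\<forall>i j. \<sigma> (y i j) = (-1) ^ (bar M i + bar M j) * y i j)"

lemmas even_inverseD = even_inverse_def[THEN iffD1, THEN conjunct1, rule_format]
  even_inverse_def[THEN iffD1, THEN conjunct2, THEN conjunct1]
  even_inverse_def[THEN iffD1, THEN conjunct2, THEN conjunct2, THEN conjunct1]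
  even_inverse_def[THEN iffD1, THEN conjunct2, THEN conjunct2, THEN conjunct2, rule_format]

text \<open>With the coboundary signs, L becomes an ordinary matrix A with triangular constant term,
  which has an inverse B. Applying the parity automorphism to A B = B A = 1 yields a second inverse
  of A, so B is even by uniqueness; this evenness is what allows the signs to be put back.\<close>

lemma L_inverse: "\<exists>y. even_inverse (L s) y"
proof -
  let ?e = "\<lambda>i j. bar M j * (bar M i + 1)"
  define A where "A i j = (-1) ^ ?e i j * L s i j" for i j
  have "\<exists>B0. mat_inverse I (\<lambda>i j. fps_nth (A i j) 0) B0"
  proof (rule triangular_idx_inverse)
    show "(\<forall>i\<in>I. \<forall>j\<in>I. i < j \<longrightarrow> fps_nth (A j i) 0 = 0) \<or> (\<forall>i\<in>I. \<forall>j\<in>I. i < j \<longrightarrow> fps_nth (A i j) 0 = 0)"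
      using L_triangular[of s] by (auto simp: A_def fsign_nth simp del: One_nat_def)
    fix i assume i: "i \<in> I"
    show "\<exists>u. fps_nth (A i i) 0 * u = 1 \<and> u * fps_nth (A i i) 0 = 1"
      using uq_gen_diag[OF i, of s] uq_gen_diag[OF i, of "opp s"] bar_cases[of M i]
      by (intro exI[of _ "uq_gen (GenL (opp s) i i 0)"]) (auto simp: A_def fsign_nth L_nth)
  qed
  then obtain B where B: "mat_inverse I A B"
    using mat_fps_inverse[of I A] by auto
  have sA: "\<sigma> (A i j) = (-1) ^ (bar M i + bar M j) * A i j" for i j
    unfolding A_def fps_parity_sign L_parity by (simp flip: mult.assoc power_add add: add.commute)
  then have sA': "A i j = (-1) ^ (bar M i + bar M j) * \<sigma> (A i j)" for i j
    by (simp flip: mult.assoc power_add)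
  have sB: "\<sigma> (B i j) = (-1) ^ (bar M i + bar M j) * B i j" if "i \<in> I" "j \<in> I" for i j
  proof -
    define B' where "B' i j = (-1) ^ (bar M i + bar M j) * \<sigma> (B i j)" for i j
    have unit: "(-1) ^ (bar M i + bar M k) * (mat_unit i k :: ('m, 'n) uq fps) = mat_unit i k" for i k
      by (simp add: mat_unit_def)
    have "mat_inverse I A B'"
      unfolding mat_inverse_def
    proof (intro ballI conjI)
      fix i k assume ik: "i \<in> I" "k \<in> I"
      have *: "\<sigma> (mat_mult I A B i k) = mat_unit i k" "\<sigma> (mat_mult I B A i k) = mat_unit i k"
        using B ik by (auto simp: mat_inverse_def mat_unit_def fps_parity_simps)
      have "mat_mult I A B' i k = (-1) ^ (bar M i + bar M k) * \<sigma> (mat_mult I A B i k)"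
        unfolding mat_mult_def fps_parity_sum sum_distrib_left
        by (intro sum.cong refl, subst sA') (simp only: B'_def fsign_mult fps_parity_simps, rule fsign_cong, auto)
      then show "mat_mult I A B' i k = mat_unit i k" by (simp only: * unit)
      have "mat_mult I B' A i k = (-1) ^ (bar M i + bar M k) * \<sigma> (mat_mult I B A i k)"
        unfolding mat_mult_def fps_parity_sum sum_distrib_left
        by (intro sum.cong refl, subst sA') (simp only: B'_def fsign_mult fps_parity_simps, rule fsign_cong, auto)
      then show "mat_mult I B' A i k = mat_unit i k" by (simp only: * unit)
    qed
    then have "(-1) ^ (bar M i + bar M j) * B i j = (-1) ^ (bar M i + bar M j) * B' i j"
      using mat_inverse_unique[OF _ B _ that, of B'] by simp
    then show ?thesis by (simp add: B'_def flip: mult.assoc power_add)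
  qed
  define y where "y i j = (if i \<in> I \<and> j \<in> I then (-1) ^ ?e i j * B i j else 0)" for i j
  have L: "L s = (\<lambda>i j. (-1) ^ ?e i j * A i j)"
    by (intro ext) (simp add: A_def flip: mult.assoc power_add)
  have unit: "(-1) ^ ?e i k * (mat_unit i k :: ('m, 'n) uq fps) = (if i = k then 1 else 0)" for i k
    by (simp add: mat_unit_def)
  have "even_inverse (L s) y"
    unfolding even_inverse_def
  proof (intro conjI allI)
    show "smat_mult M N \<sigma> (L s) y = smat_diag M N (\<lambda>_. 1)"
    proof (intro ext)
      fix i k
      show "smat_mult M N \<sigma> (L s) y i k = smat_diag M N (\<lambda>_. 1) i k"
      proof (cases "i \<in> I \<and> k \<in> I")
        case True
        then have "smat_mult M N \<sigma> (L s) y i k = (-1) ^ ?e i k * mat_mult I A B i k"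
          unfolding L y_def by (intro smat_mult_even sB) auto
        also have "mat_mult I A B i k = mat_unit i k" using B True by (simp add: mat_inverse_def)
        finally show ?thesis using True unfolding unit by (simp add: smat_diag_def)
      qed (auto simp: smat_mult_def smat_diag_def)
    qed
    show "smat_mult M N \<sigma> y (L s) = smat_diag M N (\<lambda>_. 1)"
    proof (intro ext)
      fix i k
      show "smat_mult M N \<sigma> y (L s) i k = smat_diag M N (\<lambda>_. 1) i k"
      proof (cases "i \<in> I \<and> k \<in> I")
        case True
        then have "smat_mult M N \<sigma> y (L s) i k = (-1) ^ ?e i k * mat_mult I B A i k"
          unfolding L y_def by (intro smat_mult_even' sA) auto
        also have "mat_mult I B A i k = mat_unit i k" using B True by (simp add: mat_inverse_def)
        finally show ?thesis using True unfolding unit by (simp add: smat_diag_def)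
      qed (auto simp: smat_mult_def smat_diag_def)
    qed
    show "\<sigma> (y i j) = (-1) ^ (bar M i + bar M j) * y i j" for i j
    proof (cases "i \<in> I \<and> j \<in> I")
      case True
      then show ?thesis
        unfolding y_def by (simp only: simp_thms if_True fps_parity_sign sB) (rule fsign_commute)
    next
      case False
      then show ?thesis by (auto simp: y_def fps_parity_simps)
    qed
  qed (auto simp: y_def)
  then show ?thesis by blast
qed


section \<open>The shifted series and the return from the smash product\<close>

lemma scale_tw: "c *s tw x p = tw (uq_scalar c * x) p"
  unfolding iota by (simp add: sm.scale_def sm_scalar_mult_tw)

lemma uni_scale_twf: "uni.scale c (twf f p) = twf (fps_const (uq_scalar c) * f) p"
  by (rule fps_ext) (simp add: scale_tw)

lemma uq_scalar_power: "(uq_scalar x :: ('m, 'n) uq) ^ r = uq_scalar (x ^ r)"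
  by (induction r) (simp_all add: uq_scalar_simps)

definition Ls :: "pm \<Rightarrow> ('m, 'n) uq fps smat" where
  "Ls s = uq_L_shifted s (shift_exp M N)"

lemma kap_prod_total: "kap_prod M (M + N) = qvar powi shift_exp M N"
  by (simp add: kap_prod_eq shift_exp_def)

lemma Ls_nth: "Ls s i j $ r = uq_scalar ((kap_prod M (M + N) powi (- pm_sgn s)) ^ r) * L s i j $ r"
proof -
  have "qvar powi (- pm_sgn s * shift_exp M N) = kap_prod M (M + N) powi (- pm_sgn s)"
    unfolding kap_prod_total by (simp add: mult.commute flip: power_int_mult)
  then show ?thesis
    by (simp add: Ls_def uq_L_shifted_def fps_compose_scale_nth L_def uq_scalar_power uq_scalar_central)
qed

lemma fscale_T: "fscale (kap_prod M (M + N) powi (- pm_sgn s)) (T s i m) = twf (Ls s i m) (bar M i)"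
  by (rule fps_ext) (simp add: T_def Ls_nth L_def scale_tw)

lemma Ls_parity: "\<sigma> (Ls s i j) = (-1) ^ (bar M i + bar M j) * Ls s i j"
proof (rule fps_ext)
  fix r
  have "uq_parity (L s i j $ r) = (-1) ^ (bar M i + bar M j) * L s i j $ r"
    using arg_cong[OF L_parity[of s i j], of "\<lambda>f. fps_nth f r"] by (simp add: fsign_nth)
  then show "fps_nth (\<sigma> (Ls s i j)) r = fps_nth ((-1) ^ (bar M i + bar M j) * Ls s i j) r"
    by (cases "even (bar M i + bar M j)") (simp_all add: Ls_nth uq_parity_mult uq_parity_scalar)
qed

text \<open>Over a noncommutative ring the transpose of an invertible matrix need not be invertible.
  Here the constant term is triangular with invertible diagonal, and transposition keeps
  this.\<close>

lemma T_transpose_inverse: "\<exists>C. mat_inverse I (\<lambda>i m. fscale c (T s m i)) C"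
proof -
  have tw0: "tw x p = 0 \<longleftrightarrow> x = 0" for x :: "('m, 'n) uq" and p
    using tw_inject[of x p 0] by simp
  have "\<exists>B0. mat_inverse I (\<lambda>i m. fps_nth (fscale c (T s m i)) 0) B0"
  proof (rule triangular_idx_inverse)
    show "(\<forall>i\<in>I. \<forall>j\<in>I. i < j \<longrightarrow> fps_nth (fscale c (T s i j)) 0 = 0) \<or>
        (\<forall>i\<in>I. \<forall>j\<in>I. i < j \<longrightarrow> fps_nth (fscale c (T s j i)) 0 = 0)"
      using L_triangular[of s] by (auto simp: T_def L_def simp del: One_nat_def)
    fix i assume i: "i \<in> I"
    have "tw (uq_gen (GenL s i i 0)) (bar M i) * tw (uq_gen (GenL (opp s) i i 0)) (bar M i) = (1 :: ('m, 'n) smash)" for s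
    proof -
      have "(uq_parity ^^ p) (uq_gen (GenL s i i 0) :: ('m, 'n) uq) = uq_gen (GenL s i i 0)" for p s
        by (simp add: uq_parity_funpow uq_parity_gen)
      then show ?thesis unfolding tw_mult by (simp add: uq_gen_diag[OF i] tw_1)
    qed
    from this[of s] this[of "opp s"]
    show "\<exists>u. fps_nth (fscale c (T s i i)) 0 * u = 1 \<and> u * fps_nth (fscale c (T s i i)) 0 = 1"
      by (intro exI[of _ "tw (uq_gen (GenL (opp s) i i 0)) (bar M i)"]) (simp add: T_nth)
  qed
  then show ?thesis using mat_fps_inverse[of I "\<lambda>i m. fscale c (T s m i)"] by auto
qed

text \<open>T has \<tau>^i on the entry (i, j). Moving it past \<sigma>^j applied to y_jk gives the
  power i + j of the graded product; this fixes the power of \<sigma> in the inverse.\<close>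

lemma T_inverse:
  assumes "even_inverse (L s) y"
  shows "mat_inverse I (T s) (\<lambda>i k. twf ((\<sigma> ^^ bar M i) (y i k)) (bar M k))"
  unfolding mat_inverse_iff
proof (intro ballI conjI)
  fix i k assume I: "i \<in> I" "k \<in> I"
  have comp: "(\<sigma> ^^ p) ((\<sigma> ^^ q) x) = (\<sigma> ^^ (p + q)) x" for p q x
    by (simp add: funpow_add)
  have "(\<Sum>j\<in>I. T s i j * twf ((\<sigma> ^^ bar M j) (y j k)) (bar M k)) = twf (smat_mult M N \<sigma> (L s) y i k) (bar M i + bar M k)"
    using I by (simp add: T_def twf_mult comp smat_mult_def twf_sum L_def)
  then show "(\<Sum>j\<in>I. T s i j * twf ((\<sigma> ^^ bar M j) (y j k)) (bar M k)) = (if i = k then 1 else 0)"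
    using I by (simp add: even_inverseD(2,3)[OF assms] smat_diag_def twf_1)
  have "(\<Sum>j\<in>I. twf ((\<sigma> ^^ bar M i) (y i j)) (bar M j) * T s j k) = (\<Sum>j\<in>I. twf ((\<sigma> ^^ bar M i) (y i j) * (\<sigma> ^^ bar M j) (L s j k)) 0)"
    by (intro sum.cong refl) (simp add: T_def twf_mult L_def, rule twf_parity, simp)
  also have "\<dots> = twf ((\<sigma> ^^ bar M i) (smat_mult M N \<sigma> y (L s) i k)) 0"
  proof -
    have mult: "(\<sigma> ^^ p) (x * z) = (\<sigma> ^^ p) x * (\<sigma> ^^ p) z" "(\<sigma> ^^ p) (sum f J) = (\<Sum>j\<in>J. (\<sigma> ^^ p) (f j))" for p x z f and J :: "nat set"
      by (simp_all add: fps_parity_funpow fps_parity_simps fps_parity_sum)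
    have "(\<sigma> ^^ (bar M i + (bar M i + q))) x = (\<sigma> ^^ q) x" for q x
      by (simp add: fps_parity_funpow)
    then show ?thesis using I by (simp add: smat_mult_def mult comp twf_sum)
  qed
  finally show "(\<Sum>j\<in>I. twf ((\<sigma> ^^ bar M i) (y i j)) (bar M j) * T s j k) = (if i = k then 1 else 0)"
    using I by (simp add: even_inverseD(2,3)[OF assms] smat_diag_def twf_1 fps_parity_funpow fps_parity_simps)
qed

lemma smash_crossing:
  "dilate (inverse (kap_prod M (M + N))) \<rho> * ((fps_const (kap_prod M (M + N)) - fps_X) * (1 - fps_X)) =
    fps_const (kap_prod M (M + N)) * (\<rho> * ser.\<Delta> 1 fps_X)"
  using \<alpha>_series_crossing[OF MN] by (simp add: kap_prod_total dilate_def ser.\<Delta>_def)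

text \<open>The two ungraded identities with all powers of \<tau> collected on the right and
  removed. They are the wanted identities up to the signs of the supertransposes.\<close>

definition central_pair :: "pm \<Rightarrow> ('m, 'n) uq fps smat \<Rightarrow> ('m, 'n) uq fps \<Rightarrow> bool" where
  "central_pair s y z \<longleftrightarrow> (\<forall>r. fps_nth z r \<in> center) \<and> (\<forall>m\<in>I. \<forall>p\<in>I.
    (\<Sum>i\<in>I. fps_const (uq_scalar (dd M i)) * (Ls s i m * (\<sigma> ^^ (bar M i + bar M p)) (y p i))) =
      (if m = p then fps_const (uq_scalar (dd M m)) * z else 0) \<and>
    (\<Sum>i\<in>I. fps_const (uq_scalar (inverse (dd M i))) * ((\<sigma> ^^ bar M i) (y i p) * (\<sigma> ^^ bar M p) (Ls s m i))) =
      (if m = p then fps_const (uq_scalar (inverse (dd M m))) * z else 0))"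

theorem central_series:
  assumes y: "\<And>s. even_inverse (L s) (y s)"
  shows "\<exists>z. \<forall>s. central_pair s (y s) (z s)"
proof -
  let ?Y = "\<lambda>s i k. twf ((\<sigma> ^^ bar M i) (y s i k)) (bar M k)"
  have g: "(tw (uq_gen GenQcInv) 0 :: ('m, 'n) smash) \<in> center" "(tw (uq_gen GenQc) 0 :: ('m, 'n) smash) \<in> center"
    by (intro tw_center uq_GenQc_central uq_GenQcInv_central; simp add: uq_parity_gen)+
  obtain \<zeta> where comm: "\<And>s s' k l a b. k \<in> I \<Longrightarrow> l \<in> I \<Longrightarrow>
      fps_nth (\<zeta> s) a * T s' k l $ b = T s' k l $ b * fps_nth (\<zeta> s) a"
    and tw1_fscale: "\<And>s. twisted (\<lambda>i m. fscale (kap_prod M (M + N) powi (- pm_sgn s)) (T s i m)) (?Y s) (\<zeta> s)"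
    and tw2_fscale: "\<And>s p m. p \<in> I \<Longrightarrow> m \<in> I \<Longrightarrow>
      (\<Sum>i\<in>I. uni.scale (inverse (dd M i)) (?Y s i p * fscale (kap_prod M (M + N) powi (- pm_sgn s)) (T s m i))) =
      (if m = p then uni.scale (inverse (dd M m)) (\<zeta> s) else 0)"
    by (rule twisted_central[where L = T and Y = ?Y, OF rll_coeffs_T rll_mixed_T g \<alpha>_series_nth_0[OF MN] smash_crossing
        T_inverse[OF y] T_transpose_inverse]) blast
  note tw1 = tw1_fscale[unfolded fscale_T] and tw2 = tw2_fscale[unfolded fscale_T]
  have comp: "(\<sigma> ^^ p) ((\<sigma> ^^ q) x) = (\<sigma> ^^ (p + q)) x" for p q x
    by (simp add: funpow_add)
  define X where "X s m p = (\<Sum>i\<in>I. fps_const (uq_scalar (dd M i)) * (Ls s i m * (\<sigma> ^^ (bar M i + bar M p)) (y s p i)))" for s m p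
  have tw1': "twf (X s m p) 0 = (if m = p then uni.scale (dd M m) (\<zeta> s) else 0)" if "m \<in> I" "p \<in> I" for s m p
  proof -
    have "twf (Ls s i m) (bar M i) * ?Y s p i = twf (Ls s i m * (\<sigma> ^^ (bar M i + bar M p)) (y s p i)) 0" for i
      unfolding twf_mult comp by (rule twf_parity) simp
    then show ?thesis
      using tw1[of s, unfolded twisted_def, rule_format, OF that]
      unfolding X_def twf_sum by (simp add: uni_scale_twf del: One_nat_def)
  qed
  \<comment> \<open>M \<noteq> N excludes M = N = 0, so there is an index from which z can be read
    off. The diagonal equation at 1 also shows that \<zeta> has no component along \<tau>.\<close>
  have one: "1 \<in> I" using MN by auto
  define z where "z s = fps_const (uq_scalar (inverse (dd M 1))) * X s 1 1" for s
  have dd: "dd M i \<noteq> 0" for i by (simp add: dd_def kap_nonzero kap_prod_eq qvar_nonzero)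
  have \<zeta>: "\<zeta> s = twf (z s) 0" for s
    using tw1'[OF one one, of s] dd by (simp add: z_def flip: uni_scale_twf)
  have X: "X s m p = (if m = p then fps_const (uq_scalar (dd M m)) * z s else 0)" if "m \<in> I" "p \<in> I" for s m p
  proof -
    have "twf (X s m p) 0 = twf (if m = p then fps_const (uq_scalar (dd M m)) * z s else 0) 0"
      using tw1'[OF that, of s] by (simp add: \<zeta> uni_scale_twf)
    then show ?thesis by (simp only: twf_inject)
  qed
  have tw2': "(\<Sum>i\<in>I. fps_const (uq_scalar (inverse (dd M i))) * ((\<sigma> ^^ bar M i) (y s i p) * (\<sigma> ^^ bar M p) (Ls s m i))) =
        (if m = p then fps_const (uq_scalar (inverse (dd M m))) * z s else 0)" (is "?l = ?r") if I: "m \<in> I" "p \<in> I" for s m p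
  proof -
    have "twf ?l (bar M p + bar M m) = (if m = p then twf (fps_const (uq_scalar (inverse (dd M m))) * z s) 0 else 0)"
      using tw2[OF I(2,1), of s] by (simp add: twf_sum twf_mult uni_scale_twf \<zeta>)
    also have "\<dots> = twf ?r (bar M p + bar M m)"
      by (cases "m = p") (simp_all add: twf_parity[of "bar M p + bar M p" 0])
    finally have "twf ?l (bar M p + bar M m) = twf ?r (bar M p + bar M m)" .
    then show ?thesis by (simp only: twf_inject)
  qed
  \<comment> \<open>The series commutes with l_kl \<tau>^k. To conclude that it commutes with l_kl,
    it has to be fixed by the parity automorphism.\<close>
  have z_even: "\<sigma> (z s) = z s" for s
  proof -
    have c: "\<sigma> (fps_const (uq_scalar c)) = fps_const (uq_scalar c)" for c
      by (rule fps_ext) (simp add: uq_parity_scalar)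
    have "\<sigma> ((\<sigma> ^^ q) (y s p i)) = (-1) ^ (bar M p + bar M i) * (\<sigma> ^^ q) (y s p i)" for q p i
      by (cases "even q") (simp_all add: fps_parity_funpow even_inverseD(4)[OF y] fps_parity_sign)
    then have "\<sigma> (Ls s i m * (\<sigma> ^^ q) (y s m i)) = Ls s i m * (\<sigma> ^^ q) (y s m i)" for i m q
      unfolding fps_parity_simps(2) Ls_parity by (simp only: fsign_mult) (rule fsign_even, auto)
    then show ?thesis by (simp add: z_def X_def fps_parity_simps fps_parity_sum c)
  qed
  have "fps_nth (z s) a \<in> center" for s a
  proof (rule uq_center_gen)
    fix h
    have pz: "(uq_parity ^^ q) (fps_nth (z s) a) = fps_nth (z s) a" for q
      using arg_cong[OF z_even[of s], of "\<lambda>f. fps_nth f a"] by (simp add: uq_parity_funpow)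
    show "fps_nth (z s) a * uq_gen h = uq_gen h * fps_nth (z s) a"
    proof (cases h)
      case (GenL s' k l b)
      show ?thesis
      proof (cases "k \<in> I \<and> l \<in> I")
        case True
        then have "tw (fps_nth (z s) a * uq_gen h) (bar M k) = tw (uq_gen h * fps_nth (z s) a) (bar M k)"
          using comm[of k l s a s' b] by (simp add: \<zeta> T_nth tw_mult pz GenL)
        then show ?thesis by (simp only: tw_inject)
      next
        case False
        then have "uq_gen h = (0 :: ('m, 'n) uq)"
          using abs_uq_relation[OF uq_relations.outside, of k l s' b, where 'm = 'm and 'n = 'n] unfolding GenL
          by (simp add: abs_uq_simps M N)
        then show ?thesis by simp
      qed
    qed (simp_all add: centerD[OF uq_GenQc_central] centerD[OF uq_GenQcInv_central])
  qed
  then have "central_pair s (y s) (z s)" for s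
    using X[of _ _ s] tw2'[of _ _ s] unfolding central_pair_def X_def by blast
  then show ?thesis by blast
qed

end

theorem proposition1p1:
  assumes "LENGTH('m::len0) \<noteq> LENGTH('n::len0)"
  shows "\<exists>\<zeta> :: pm \<Rightarrow> ('m, 'n) uq fps. \<forall>s.
    uq_st (uq_L_shifted s (shift_exp LENGTH('m) LENGTH('n))) \<odot> uq_D \<odot> uq_st (uq_inverse (uq_L s))
      = uq_scale (\<zeta> s) uq_D \<and>
    uq_st (uq_inverse (uq_L s)) \<odot> uq_D_inv \<odot> uq_st (uq_L_shifted s (shift_exp LENGTH('m) LENGTH('n)))
      = uq_scale (\<zeta> s) uq_D_inv \<and>
    (\<forall>r. fps_nth (\<zeta> s) r \<in> center)"
proof -
  interpret quantum_affine "LENGTH('m)" "LENGTH('n)" "sm_scalar :: ratfun \<Rightarrow> ('m, 'n) smash"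
    by standard (use assms in simp_all)
  let ?M = "LENGTH('m)" and ?N = "LENGTH('n)"
  obtain y where Y: "\<And>s. even_inverse (L s) (y s)"
    using L_inverse by metis
  note y = even_inverseD[OF Y]
  have inv: "uq_inverse (uq_L s) = y s" for s
    unfolding uq_inverse_def using y by (intro smat_inverse_eqI) (auto simp: L_def)
  obtain z where z: "\<And>s. central_pair s (y s) (z s)"
    using central_series[OF Y] by blast
  let ?c = "\<lambda>x. fps_const (uq_scalar x) :: ('m, 'n) uq fps"
  have c_comm: "?c x * f = f * ?c x" for x f
    by (rule centerD[OF center_fps_const[OF centerI[OF uq_scalar_central]]])
  have c_mult: "?c (x * x') = ?c x * ?c x'" for x x'
    by (simp add: uq_scalar_simps)
  have "?c 0 = 0"
    using uq_scalar_simps(1)[of 0 0, where 'a = 'm and 'b = 'n] by simp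
  then have c_uminus: "?c (- x) = - ?c x" for x
    using uq_scalar_simps(1)[of x "- x", where 'a = 'm and 'b = 'n] by (simp add: eq_neg_iff_add_eq_0 add.commute flip: fps_const_neg)
  have c_sign: "?c ((-1) ^ p * x) = (-1) ^ p * ?c x" for p x
    by (cases "even p") (simp_all add: c_uminus)
  have sc: "(\<sigma> ^^ p) (?c x) = ?c x" for p x
    by (auto simp: fps_eq_iff uq_parity_scalar fps_parity_funpow)
  \<comment> \<open>D differs from the weights by the factor q, which drops out as D stands on both
    sides, and by the parity sign, which meets the signs of the supertransposes.\<close>
  have D: "?c (D_entry ?M i) = ?c (inverse qvar) * ((-1) ^ bar ?M i * ?c (dd ?M i))"
    and D': "?c (inverse (D_entry ?M i)) = ?c qvar * ((-1) ^ bar ?M i * ?c (inverse (dd ?M i)))" if "i \<in> I" for i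
  proof -
    have d: "dd ?M i = qvar * (-1) ^ bar ?M i * D_entry ?M i" by (rule dd_eq_D_entry) (use that in simp)
    have "D_entry ?M i = inverse qvar * ((-1) ^ bar ?M i * dd ?M i)" "inverse (D_entry ?M i) = qvar * ((-1) ^ bar ?M i * inverse (dd ?M i))"
      unfolding d using qvar_nonzero bar_cases[of ?M i] by auto
    then show "?c (D_entry ?M i) = ?c (inverse qvar) * ((-1) ^ bar ?M i * ?c (dd ?M i))"
      "?c (inverse (D_entry ?M i)) = ?c qvar * ((-1) ^ bar ?M i * ?c (inverse (dd ?M i)))"
      by (simp_all only: c_mult[of "inverse qvar"] c_mult[of qvar] c_sign)
  qed
  have mult_diag: "(X \<odot> uq_diag d) i k = X i k * ?c (d k)" if "i \<in> I" "k \<in> I" for X d i k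
  proof -
    have "(\<sigma> ^^ p) 0 = 0" for p
      by (simp add: fps_parity_funpow fps_parity_simps)
    then have "X i j * (\<sigma> ^^ (bar ?M i + bar ?M j)) (if j \<in> I \<and> j = k then ?c (d j) else 0) = (if j = k then X i j * ?c (d j) else 0)"
      if "j \<in> I" for j
      using that by (cases "j = k") (simp_all add: sc)
    then have "(X \<odot> uq_diag d) i k = (\<Sum>j\<in>I. if j = k then X i j * ?c (d j) else 0)"
      using that unfolding uq_mult_def smat_mult_def uq_diag_def smat_diag_def
      by (simp only: simp_thms if_True cong: sum.cong)
    then show ?thesis using that by simp
  qed
  have sign3: "((-1) ^ a * x * (?c u * ((-1) ^ b * ?c v))) * ((-1) ^ e * w) = (-1) ^ (a + b + e) * (?c u * (?c v * (x * w)))" for a b e x u v w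
  proof -
    have "x * (?c u * ?c v) * w = ?c u * (?c v * (x * w))"
      unfolding c_mult[symmetric] c_comm[of "u * v" x, symmetric] by (simp only: mult.assoc c_mult)
    then show ?thesis by (cases "even a"; cases "even b"; cases "even e") (simp_all flip: fps_const_neg)
  qed
  have sig: "(\<sigma> ^^ q) ((-1) ^ a * x) = (-1) ^ (a + q * p) * x" if "\<sigma> x = (-1) ^ p * x" for q a p x
  proof -
    have "(\<sigma> ^^ q) ((-1) ^ a * x) = (-1) ^ a * (\<sigma> ^^ q) x"
      by (simp add: fps_parity_funpow fps_parity_sign)
    then show ?thesis by (simp only: sigma_funpow[OF that] fsign_add)
  qed
  have sig0: "(\<sigma> ^^ q) x = (-1) ^ (q * p) * x" if "\<sigma> x = (-1) ^ p * x" for q p x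
    by (rule sigma_funpow[OF that])
  have csign: "?c u * ((-1) ^ a * x) = (-1) ^ a * (?c u * x)" for u a x
    by (cases "even a") simp_all
  have mult_sign: "x * ((-1) ^ a * w) = (-1) ^ a * (x * w)" for x a and w :: "('m, 'n) uq fps"
    by (cases "even a") simp_all
  have out: "(X \<odot> X') i k = 0" if "\<not> (i \<in> I \<and> k \<in> I)" for X X' :: "('m, 'n) uq fps smat" and i k
    using that unfolding uq_mult_def smat_mult_def by (simp only: if_False simp_thms if_cancel)
  have first: "uq_st (Ls s) \<odot> uq_D \<odot> uq_st (y s) = uq_scale (z s) uq_D" for s
  proof (intro ext)
    fix m p
    show "(uq_st (Ls s) \<odot> uq_D \<odot> uq_st (y s)) m p = uq_scale (z s) uq_D m p"
    proof (cases "m \<in> I \<and> p \<in> I")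
      case True
      let ?b = "bar ?M"
      let ?t = "\<lambda>i. ?c (dd ?M i) * (Ls s i m * (\<sigma> ^^ (?b i + ?b p)) (y s p i))"
      have "(uq_st (Ls s) \<odot> uq_D \<odot> uq_st (y s)) m p =
         (\<Sum>i\<in>I. (uq_st (Ls s) \<odot> uq_D) m i * (\<sigma> ^^ (?b m + ?b i)) (uq_st (y s) i p))"
        using True by (simp add: uq_mult_def[of "_ \<odot> _"] smat_mult_def[of _ _ _ "_ \<odot> _"])
      \<comment> \<open>All signs that involve the summation index cancel. The rest depends on m and
        p, and for m = p it reduces to the parity sign in D.\<close>
      also have "\<dots> = (\<Sum>i\<in>I. (-1) ^ (?b m + ?b m * ?b p + ?b p) * (?c (inverse qvar) * ?t i))"
      proof (intro sum.cong refl, goal_cases)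
        case i: (1 i)
        have "(uq_st (Ls s) \<odot> uq_D) m i * (\<sigma> ^^ (?b m + ?b i)) (uq_st (y s) i p) =
          ((-1) ^ (?b m * (?b m + ?b i)) * Ls s i m * (?c (inverse qvar) * ((-1) ^ ?b i * ?c (dd ?M i)))) *
          ((-1) ^ (?b i * (?b i + ?b p) + (?b m + ?b i) * (?b p + ?b i)) * y s p i)"
          unfolding uq_D_def mult_diag[OF conjunct1[OF True] i] D[OF i] using True i
          by (simp only: uq_st_def supertranspose_def simp_thms if_True sig[OF y(4)])
        also have "\<dots> = (-1) ^ (?b m + ?b m * ?b p + ?b p) * (?c (inverse qvar) * ?t i)"
          unfolding sign3 unfolding sig0[OF y(4)] csign mult_sign[of "Ls s i m"] fsign_add by (rule fsign_cong) auto
        finally show ?case .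
      qed
      also have "\<dots> = (-1) ^ (?b m + ?b m * ?b p + ?b p) * (?c (inverse qvar) * (if m = p then ?c (dd ?M m) * z s else 0))"
        using z[of s, unfolded central_pair_def] True by (simp only: sum_distrib_left[symmetric])
      also have "\<dots> = uq_scale (z s) uq_D m p"
      proof (cases "m = p")
        case True
        have "(-1) ^ (?b p + ?b p * ?b p + ?b p) * (?c (inverse qvar) * (?c (dd ?M p) * z s)) =
            (-1) ^ ?b p * (?c (inverse qvar) * (?c (dd ?M p) * z s))"
          by (rule fsign_cong) auto
        also have "\<dots> = ?c (D_entry ?M p) * z s"
          using \<open>m \<in> I \<and> p \<in> I\<close> True by (simp only: D csign mult.assoc)
        finally show ?thesis
          using \<open>m \<in> I \<and> p \<in> I\<close> True by (simp add: uq_scale_def uq_D_def uq_diag_def smat_diag_def c_comm)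
      qed (simp add: uq_scale_def uq_D_def uq_diag_def smat_diag_def)
      finally show ?thesis .
    next
      case False
      then show ?thesis
        by (subst out) (auto simp: uq_scale_def uq_D_def uq_diag_def smat_diag_def)
    qed
  qed
  have second: "uq_st (y s) \<odot> uq_D_inv \<odot> uq_st (Ls s) = uq_scale (z s) uq_D_inv" for s
  proof (intro ext)
    fix p k
    show "(uq_st (y s) \<odot> uq_D_inv \<odot> uq_st (Ls s)) p k = uq_scale (z s) uq_D_inv p k"
    proof (cases "p \<in> I \<and> k \<in> I")
      case True
      let ?b = "bar ?M"
      let ?t = "\<lambda>i. ?c (inverse (dd ?M i)) * ((\<sigma> ^^ ?b i) (y s i p) * (\<sigma> ^^ ?b p) (Ls s k i))"
      have "(uq_st (y s) \<odot> uq_D_inv \<odot> uq_st (Ls s)) p k =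
         (\<Sum>i\<in>I. (uq_st (y s) \<odot> uq_D_inv) p i * (\<sigma> ^^ (?b p + ?b i)) (uq_st (Ls s) i k))"
        using True by (simp add: uq_mult_def[of "_ \<odot> _"] smat_mult_def[of _ _ _ "_ \<odot> _"])
      \<comment> \<open>The powers of \<sigma> are kept as in \<open>central_pair\<close>; the sign
        that remains depends on p alone and is the one in the inverse of D.\<close>
      also have "\<dots> = (\<Sum>i\<in>I. (-1) ^ ?b p * (?c qvar * ?t i))"
      proof (intro sum.cong refl, goal_cases)
        case i: (1 i)
        have "(uq_st (y s) \<odot> uq_D_inv) p i * (\<sigma> ^^ (?b p + ?b i)) (uq_st (Ls s) i k) =
          ((-1) ^ (?b p * (?b p + ?b i)) * y s i p * (?c qvar * ((-1) ^ ?b i * ?c (inverse (dd ?M i))))) *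
          ((-1) ^ (?b i * (?b i + ?b k) + (?b p + ?b i) * (?b k + ?b i)) * Ls s k i)"
          unfolding uq_D_inv_def mult_diag[OF conjunct1[OF True] i] D'[OF i] using True i
          by (simp only: uq_st_def supertranspose_def simp_thms if_True sig[OF Ls_parity])
        also have "\<dots> = (-1) ^ ?b p * (?c qvar * ?t i)"
          unfolding sign3 unfolding sig0[OF y(4)] sig0[OF Ls_parity] fsign_mult csign fsign_add by (rule fsign_cong) auto
        finally show ?case .
      qed
      also have "\<dots> = (-1) ^ ?b p * (?c qvar * (if k = p then ?c (inverse (dd ?M k)) * z s else 0))"
        using z[of s, unfolded central_pair_def] True by (simp only: sum_distrib_left[symmetric])
      also have "\<dots> = uq_scale (z s) uq_D_inv p k"
      proof (cases "k = p")
        case True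
        have "(-1) ^ ?b p * (?c qvar * (?c (inverse (dd ?M p)) * z s)) = ?c (inverse (D_entry ?M p)) * z s"
          using \<open>p \<in> I \<and> k \<in> I\<close> by (simp only: D' csign mult.assoc)
        then show ?thesis
          using \<open>p \<in> I \<and> k \<in> I\<close> True by (simp add: uq_scale_def uq_D_inv_def uq_diag_def smat_diag_def c_comm)
      qed (simp add: uq_scale_def uq_D_inv_def uq_diag_def smat_diag_def)
      finally show ?thesis .
    next
      case False
      then show ?thesis
        by (subst out) (auto simp: uq_scale_def uq_D_inv_def uq_diag_def smat_diag_def)
    qed
  qed
  show ?thesis
    using first second z unfolding inv Ls_def central_pair_def by blast
qed

end
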